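(* Let $\mathcal{X}\subseteq\mathbb{R}^D$ be compact, $\mu$ a probability measure on $\mathcal{X}$, and $\mathcal{K}=\mathcal{W}:\mathcal{X}\times\mathcal{X}\to[0,1]$ a continuous symmetric kernel whose integral operator on $L^2(\mu)$ has eigenvalues in $[0,1]$ and such that $\mathcal{K}(x,x)=c$ for all $x\in\mathcal{X}$, for some constant $c\le1$. Let $X_n=\{x_1,\dots,x_n\}$ be i.i.d. from $\mu$, $\alpha_n\le1$, and let $A$ be the adjacency matrix of the latent position random graph with sparsity level $\alpha_n$. Assume $\alpha_n\gtrsim\log n/n$. Let $K_n$ be the modified USVT kernel built from $A$ with threshold $\gamma_n$. For any $q>0$, there exist three constants $\rho_q,b_q,B_q\in\mathbb{R}_{>0}$ such that, for any $\delta\in(0,1)$, $\varepsilon>0$ and for $\gamma_n=\rho_q(\alpha_nn)^{3/4}$, $$n\ge N_K(\delta,\varepsilon)\ \Rightarrow\ \mathbb{P}\Big(\max\Big(\Big\|\tfrac{K_n-\mathcal{K}_{|X_n\times X_n}}{n}\Big\|_F,\ \Big|\mathrm{tr}\big(\tfrac{K_n}{n}\big)-\mathrm{tr}\big(\tfrac{\mathcal{K}_{|X_n\times X_n}}{n}\big)\Big|\Big)\ge\varepsilon\Big)\le\delta,$$ where $$N_K(\delta,\varepsilon)=\max\Big(\frac{1}{\delta^q},\ \frac{b_q}{\alpha_n\varepsilon^8},\ \frac{B_q}{\alpha_n\varepsilon^4}\Big).$$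
   Context: Latent position random graph: conditionally on $x_1,\dots,x_n$, the entries $a_{i,j}=a_{j,i}$ of the symmetric matrix $A$ are independent with $a_{i,j}\sim\mathrm{Ber}(\alpha_n\mathcal{W}(x_i,x_j))$. $\alpha_n\gtrsim\log n/n$ means that there is a constant $C_0>0$ with $\alpha_n\ge C_0\log n/n$. $\mathcal{K}_{|X_n\times X_n}=[\mathcal{K}(x_i,x_j)]_{i,j=1}^n$; $\|\cdot\|_F$ is the Frobenius norm; $\mathbb{P}$ is over $X_n$ and $A$. Modified USVT kernel: with eigendecomposition $A=\sum_{i=1}^n\lambda_iu_iu_i^t$ and threshold $\gamma_n\ge0$, let $\widetilde A_{\gamma_n}=\frac{1}{\alpha_n}\sum_{\lambda_i\ge\gamma_n}\lambda_iu_iu_i^t$; $\bar A_{\gamma_n}=\widetilde A_{\gamma_n}+C(\widetilde A_{\gamma_n})I$ with $C(\widetilde A_{\gamma_n})=\max(c-\mathrm{tr}(\widetilde A_{\gamma_n})/n,\,0)$; and $K_n=C'(\bar A_{\gamma_n})\bar A_{\gamma_n}$ with $C'(\bar A_{\gamma_n})=\min\big(\tfrac{n}{\lambda_{\max}(\bar A_{\gamma_n})},\,(1+\tfrac{1}{(\alpha_nn)^{1/4}})^{-1}\big)$, $\lambda_{\max}$ denoting the largest eigenvalue. *)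

theory Defs
  imports
    "HOL-Probability.Probability"
    "Jordan_Normal_Form.Char_Poly"
begin

subsection \<open>The integral operator of a kernel\<close>

definition square_integrable :: "'a measure \<Rightarrow> ('a \<Rightarrow> real) \<Rightarrow> bool" where
  "square_integrable \<mu> f \<longleftrightarrow> f \<in> borel_measurable \<mu> \<and> integrable \<mu> (\<lambda>x. (f x)\<^sup>2)"

definition integral_operator ::
  "'a measure \<Rightarrow> ('a \<Rightarrow> 'a \<Rightarrow> real) \<Rightarrow> ('a \<Rightarrow> real) \<Rightarrow> 'a \<Rightarrow> real" where
  "integral_operator \<mu> K f x = (\<integral>y. K x y * f y \<partial>\<mu>)"

(* The space L^2(\<mu>) is the square integrable functions up to almost everywhere equality, so that
   a nonzero eigenvector is a function which is not almost everywhere 0. The scalars are real: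
   the operators considered have a real symmetric kernel, so all their eigenvalues are real and
   have real eigenfunctions. *)
definition integral_operator_eigenvalue ::
  "'a measure \<Rightarrow> ('a \<Rightarrow> 'a \<Rightarrow> real) \<Rightarrow> real \<Rightarrow> bool" where
  "integral_operator_eigenvalue \<mu> K k \<longleftrightarrow>
     (\<exists>f. square_integrable \<mu> f \<and> \<not> (AE x in \<mu>. f x = 0) \<and>
          (AE x in \<mu>. integral_operator \<mu> K f x = k * f x))"

subsection \<open>Latent position random graphs\<close>

(* Points and vertices are indexed by 0, ..., n - 1. The last clause gives the law of A
   conditionally on the sigma-algebra generated by (x 0, ..., x (n - 1)): for every 0/1 pattern e,
   the conditional probability that the entries of index i \<le> j are those of e is the product of the
   probabilities given to e i j by Ber(\<alpha> W (x i) (x j)). *)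
definition latent_position_graph ::
  "'w measure \<Rightarrow> 'a measure \<Rightarrow> ('a \<Rightarrow> 'a \<Rightarrow> real) \<Rightarrow> real \<Rightarrow> nat \<Rightarrow>
   (nat \<Rightarrow> 'w \<Rightarrow> 'a) \<Rightarrow> ('w \<Rightarrow> real mat) \<Rightarrow> bool" where
  "latent_position_graph M \<mu> W \<alpha> n x A \<longleftrightarrow>
     prob_space M \<and>
     prob_space.indep_vars M (\<lambda>_. \<mu>) x {..<n} \<and>
     (\<forall>i<n. distr M \<mu> (x i) = \<mu>) \<and>
     (\<forall>\<omega>\<in>space M. A \<omega> \<in> carrier_mat n n) \<and>
     (\<forall>\<omega>\<in>space M. \<forall>i<n. \<forall>j<n. A \<omega> $$ (i, j) \<in> {0, 1} \<and> A \<omega> $$ (i, j) = A \<omega> $$ (j, i)) \<and>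
     (\<forall>i<n. \<forall>j<n. (\<lambda>\<omega>. A \<omega> $$ (i, j)) \<in> borel_measurable M) \<and>
     (\<forall>e :: nat \<Rightarrow> nat \<Rightarrow> bool. AE \<omega> in M.
        real_cond_exp M
          (vimage_algebra (space M) (\<lambda>\<omega>. \<lambda>i\<in>{..<n}. x i \<omega>) (PiM {..<n} (\<lambda>_. \<mu>)))
          (indicat_real {\<omega> \<in> space M. \<forall>j<n. \<forall>i\<le>j. A \<omega> $$ (i, j) = of_bool (e i j)}) \<omega>
        = (\<Prod>(i, j) \<in> {(i, j). i \<le> j \<and> j < n}.
             pmf (bernoulli_pmf (\<alpha> * W (x i \<omega>) (x j \<omega>))) (e i j)))"

subsection \<open>Matrices\<close>

definition mat_trace :: "real mat \<Rightarrow> real" where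
  "mat_trace A = (\<Sum>i<dim_row A. A $$ (i, i))"

definition frobenius_norm :: "real mat \<Rightarrow> real" where
  "frobenius_norm A = sqrt (\<Sum>i<dim_row A. \<Sum>j<dim_col A. (A $$ (i, j))\<^sup>2)"

definition lambda_max :: "real mat \<Rightarrow> real" where
  "lambda_max A = Max {k. eigenvalue A k}"

definition kernel_matrix :: "nat \<Rightarrow> ('a \<Rightarrow> 'a \<Rightarrow> real) \<Rightarrow> (nat \<Rightarrow> 'a) \<Rightarrow> real mat" where
  "kernel_matrix n K x = mat n n (\<lambda>(i, j). K (x i) (x j))"

(* The sum over i in I of l i times the matrix (u i) (u i)^t. *)
definition rank_one_sum :: "nat \<Rightarrow> nat set \<Rightarrow> (nat \<Rightarrow> real) \<Rightarrow> (nat \<Rightarrow> real Matrix.vec) \<Rightarrow> real mat" where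
  "rank_one_sum n I l u = mat n n (\<lambda>(r, s). \<Sum>i\<in>I. l i * (vec_index (u i) r * vec_index (u i) s))"

definition eigendecomposition :: "real mat \<Rightarrow> (nat \<Rightarrow> real) \<Rightarrow> (nat \<Rightarrow> real Matrix.vec) \<Rightarrow> bool" where
  "eigendecomposition A l u \<longleftrightarrow>
     (let n = dim_row A in
        (\<forall>i<n. u i \<in> carrier_vec n) \<and>
        (\<forall>i<n. \<forall>j<n. scalar_prod (u i) (u j) = (if i = j then 1 else 0)) \<and>
        A = rank_one_sum n {..<n} l u)"

subsection \<open>The modified USVT kernel\<close>

(* The choice of eigendecomposition of a symmetric A is immaterial: the value below is
   f(A) / \<alpha> in the functional calculus, where f t = t for t \<ge> \<gamma> and f t = 0 otherwise. *)
definition usvt_tilde :: "real \<Rightarrow> real \<Rightarrow> real mat \<Rightarrow> real mat" where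
  "usvt_tilde \<alpha> \<gamma> A =
     (case (SOME (l, u). eigendecomposition A l u) of (l, u) \<Rightarrow>
        (1 / \<alpha>) \<cdot>\<^sub>m rank_one_sum (dim_row A) {i. i < dim_row A \<and> \<gamma> \<le> l i} l u)"

definition usvt_bar :: "real \<Rightarrow> real \<Rightarrow> real \<Rightarrow> real mat \<Rightarrow> real mat" where
  "usvt_bar c \<alpha> \<gamma> A =
     (let n = dim_row A; T = usvt_tilde \<alpha> \<gamma> A in
        T + max (c - mat_trace T / real n) 0 \<cdot>\<^sub>m 1\<^sub>m n)"

definition usvt_kernel :: "real \<Rightarrow> real \<Rightarrow> real \<Rightarrow> real mat \<Rightarrow> real mat" where
  "usvt_kernel c \<alpha> \<gamma> A =
     (let n = dim_row A; T = usvt_bar c \<alpha> \<gamma> A in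
        min (real n / lambda_max T) (inverse (1 + 1 / (\<alpha> * real n) powr (1 / 4))) \<cdot>\<^sub>m T)"

definition N_K :: "real \<Rightarrow> real \<Rightarrow> real \<Rightarrow> real \<Rightarrow> real \<Rightarrow> real \<Rightarrow> real" where
  "N_K q b B \<alpha> \<delta> \<epsilon> =
     Max {1 / \<delta> powr q, b / (\<alpha> * \<epsilon> ^ 8), B / (\<alpha> * \<epsilon> ^ 4)}"

end

theory Submission
  imports
    Defs
    "HOL-Complex_Analysis.Great_Picard"
    "Jordan_Normal_Form.Spectral_Radius"
begin

text \<open>
  Let \<open>G\<close> be the kernel matrix at the sampled points and \<open>d = \<alpha> n\<close>. Conditionally on the points, \<open>A - \<alpha> G\<close>
  has independent centered entries. With high probability its operator norm is \<open>O(sqrt d)\<close>,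
  even when \<open>d\<close> is only of order \<open>log n\<close>: in the expansion of
  \<open>E tr (A - \<alpha> G)\<^bsup>2p\<^esup>\<close> over closed walks only walks without simple edges survive, and their weighted number
  on \<open>n\<close> vertices is at most \<open>n / r\<close> times their number on \<open>r\<close> vertices as soon as \<open>r \<ge> d + p\<close> (dimension
  reduction in the manner of Bandeira and van Handel). The latter number is bounded by the trace moment of an \<open>r \<times> r\<close> matrix
  with bounded entries, for which a net argument is sharp. Taking \<open>p\<close> of order \<open>d\<close> and Markov's inequality
  gives the claim.

  The matrix \<open>G\<close> is almost surely positive semidefinite: otherwise the form of the integral operator would take a
  negative value, and its minimizing sequences would converge to an eigenfunction with a negative
  eigenvalue. Thresholding at \<open>\<gamma> \<approx> d\<^bsup>3/4\<^esup>\<close>, well above the noise, therefore yields a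
  positive semidefinite matrix \<open>T\<close> with \<open>\<parallel>T - G\<parallel>\<^sub>o\<^sub>p = O(\<gamma> / \<alpha>)\<close> and \<open>tr T \<le> n (c + O(d\<^bsup>-1/4\<^esup>))\<close>, and
  \<open>\<parallel>T - G\<parallel>\<^sub>F\<^sup>2 \<le> \<parallel>T - G\<parallel>\<^sub>o\<^sub>p (tr T + tr G)\<close>. The shift and the rescaling that produce \<open>K\<^sub>n\<close> are
  perturbations of relative size \<open>O(d\<^bsup>-1/4\<^esup>)\<close>, so all errors are \<open>O(d\<^bsup>-1/8\<^esup>)\<close>.
\<close>

subsection \<open>The spectral theorem for real symmetric matrices\<close>

text \<open>Matrix Bernstein inequalities lose a factor sqrt (log n) in the sparse regime, and a net
  argument applied directly to \<open>A\<close> gives too little, because the entries have size 1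
  but variance only about \<alpha>. Comparing walks moves the problem to a matrix of dimension about
  d with entries of order 1, where the net loses only a constant. The moment order p is bounded from
  below twice: by d, for the comparison, and by (1 + 1/q) log n, so that the factor exp (- p) gained
  in Markov's inequality beats the factor n coming from the trace. The assumption \<alpha> n \<ge>
  C0 log n lets a multiple of d meet both demands.

  The threshold d^(3/4) balances two relative errors: thresholding moves the matrix by \<gamma> /
  \<alpha>, which is d^(-1/4) relative to n, and the noise is d^(-1/4) relative to \<gamma>. The
  Frobenius norm takes the square root of the first, whence d^(-1/8) and the eighth power of
  \<epsilon> in the sample size.\<close>

lemma symmetric_real_eigenvector:
  fixes W :: "nat \<Rightarrow> nat \<Rightarrow> real"
  assumes sym: "\<And>i j. i < n \<Longrightarrow> j < n \<Longrightarrow> W i j = W j i" and n: "n > 0"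
  shows "\<exists>e k. (\<Sum>i<n. (e i)\<^sup>2) = 1 \<and> (\<forall>i<n. (\<Sum>j<n. W i j * e j) = k * e i)"
proof -
  let ?C = "mat n n (\<lambda>(i, j). complex_of_real (W i j))"
  from spectrum_non_empty[of ?C n] n obtain z v where "eigenvector ?C v z"
    unfolding spectrum_def eigenvalue_def by auto
  hence v: "v \<in> carrier_vec n" "v \<noteq> 0\<^sub>v n" "?C *\<^sub>v v = z \<cdot>\<^sub>v v"
    unfolding eigenvector_def by auto
  define a where "a i = Re (vec_index v i)" for i
  define b where "b i = Im (vec_index v i)" for i
  have row: "(\<Sum>j<n. complex_of_real (W i j) * vec_index v j) = z * vec_index v i" if "i < n" for i
  proof -
    have "vec_index (?C *\<^sub>v v) i = (\<Sum>j<n. complex_of_real (W i j) * vec_index v j)"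
      using that v(1) by (auto simp: scalar_prod_def lessThan_atLeast0 intro!: sum.cong)
    thus ?thesis using v(1,3) that by simp
  qed
  have Wa: "(\<Sum>j<n. W i j * a j) = Re z * a i - Im z * b i" if "i < n" for i
    using arg_cong[OF row[OF that], of Re] by (simp add: a_def b_def)
  have Wb: "(\<Sum>j<n. W i j * b j) = Re z * b i + Im z * a i" if "i < n" for i
    using arg_cong[OF row[OF that], of Im] by (simp add: a_def b_def)
  \<comment> \<open>Symmetry of W in the form b^t W a = a^t W b. It forces Im z = 0, after which a
    and b both solve the eigenvalue equation and one of them is nonzero.\<close>
  have "(\<Sum>i<n. b i * (\<Sum>j<n. W i j * a j)) = (\<Sum>i<n. a i * (\<Sum>j<n. W i j * b j))"
    unfolding sum_distrib_left
    by (subst sum.swap, intro sum.cong refl) (simp add: sym mult_ac)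
  hence "(\<Sum>i<n. b i * (Re z * a i - Im z * b i) - a i * (Re z * b i + Im z * a i)) = 0"
    by (simp add: Wa Wb sum_subtractf)
  hence "(\<Sum>i<n. - Im z * ((a i)\<^sup>2 + (b i)\<^sup>2)) = 0"
    by (simp add: algebra_simps power2_eq_square)
  hence "Im z * (\<Sum>i<n. (a i)\<^sup>2 + (b i)\<^sup>2) = 0"
    by (simp add: sum_negf flip: sum_distrib_left)
  moreover have "(\<Sum>i<n. (a i)\<^sup>2 + (b i)\<^sup>2) \<noteq> 0"
  proof
    assume "(\<Sum>i<n. (a i)\<^sup>2 + (b i)\<^sup>2) = 0"
    hence "a i = 0 \<and> b i = 0" if "i < n" for i
      using that by (subst (asm) sum_nonneg_eq_0_iff) (auto simp: sum_power2_eq_zero_iff)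
    hence "v = 0\<^sub>v n"
      using v(1) by (intro eq_vecI) (auto simp: a_def b_def complex_eq_iff)
    thus False using v(2) by simp
  qed
  ultimately have Im: "Im z = 0" by simp
  obtain f where f: "\<And>i. i < n \<Longrightarrow> (\<Sum>j<n. W i j * f j) = Re z * f i" "(\<Sum>i<n. (f i)\<^sup>2) \<noteq> 0"
  proof (cases "(\<Sum>i<n. (a i)\<^sup>2) = 0")
    case True
    with \<open>(\<Sum>i<n. (a i)\<^sup>2 + (b i)\<^sup>2) \<noteq> 0\<close> show ?thesis
      using Wb Im by (intro that[of b]) (auto simp: sum.distrib)
  qed (use Wa Im that[of a] in auto)
  define s where "s = sqrt (\<Sum>i<n. (f i)\<^sup>2)"
  have s: "s > 0" "s\<^sup>2 = (\<Sum>i<n. (f i)\<^sup>2)"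
    using f(2) by (auto simp: s_def sum_nonneg less_le)
  show ?thesis
  proof (intro exI[of _ "\<lambda>i. f i / s"] exI[of _ "Re z"] conjI allI impI)
    show "(\<Sum>i<n. (f i / s)\<^sup>2) = 1"
      using s f(2) by (simp add: power_divide flip: sum_divide_distrib)
    show "(\<Sum>j<n. W i j * (f j / s)) = Re z * (f i / s)" if "i < n" for i
      using f(1)[OF that] by (simp flip: sum_divide_distrib)
  qed
qed

text \<open>The reflection that exchanges the first basis vector with \<open>e\<close>.\<close>
lemma orthogonal_mat_with_first_row:
  fixes e :: "nat \<Rightarrow> real"
  assumes "(\<Sum>i<Suc n. (e i)\<^sup>2) = 1"
  shows "\<exists>H. H \<in> carrier_mat (Suc n) (Suc n) \<and> H * H\<^sup>T = 1\<^sub>m (Suc n) \<and> (\<forall>i<Suc n. H $$ (0, i) = e i)"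
proof -
  define w where "w i = (if i = 0 then 1 - e 0 else - e i)" for i
  define N where "N = (\<Sum>i<Suc n. (w i)\<^sup>2)"
  have tail: "(\<Sum>i<n. (e (Suc i))\<^sup>2) = 1 - (e 0)\<^sup>2"
    using assms by (simp add: sum.lessThan_Suc_shift del: sum.lessThan_Suc)
  have N: "N = 2 * (1 - e 0)"
    unfolding N_def w_def
    by (simp add: sum.lessThan_Suc_shift tail power2_diff algebra_simps del: sum.lessThan_Suc)
  \<comment> \<open>If N = 0, then e is the first basis vector; division by zero gives t = 0 and H
    is the identity, as it should be.\<close>
  define t where "t = 2 / N"
  define H where "H = mat (Suc n) (Suc n) (\<lambda>(i, j). of_bool (i = j) - t * w i * w j)"
  have tt: "t * t * N = 2 * t" by (simp add: t_def)
  have "H * H\<^sup>T = 1\<^sub>m (Suc n)"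
  proof (rule eq_matI)
    fix i j assume "i < dim_row (1\<^sub>m (Suc n) :: real mat)" "j < dim_col (1\<^sub>m (Suc n) :: real mat)"
    hence ij: "i < Suc n" "j < Suc n" by auto
    have "(H * H\<^sup>T) $$ (i, j) =
      (\<Sum>k<Suc n. (of_bool (i = k) - t * w i * w k) * (of_bool (j = k) - t * w j * w k))"
      using ij by (simp add: H_def scalar_prod_def lessThan_atLeast0 del: sum.op_ivl_Suc)
    also have "\<dots> = (\<Sum>k<Suc n. of_bool (i = k) * of_bool (j = k) - of_bool (i = k) * (t * w j * w k)
        - of_bool (j = k) * (t * w i * w k) + (w i * w j * (t * t)) * (w k)\<^sup>2)"
      by (intro sum.cong) (auto simp: algebra_simps power2_eq_square)
    also have "\<dots> = of_bool (i = j) - t * w j * w i - t * w i * w j + (w i * w j * (t * t)) * N"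
      unfolding sum.distrib sum_subtractf N_def sum_distrib_left[symmetric]
      using ij by (simp add: of_bool_def if_distrib[of "\<lambda>x. x * _"] sum.delta' sum.delta cong: if_cong del: sum.lessThan_Suc)
    also have "\<dots> = of_bool (i = j) + w i * w j * (t * t * N - 2 * t)"
      by (simp add: algebra_simps)
    finally show "(H * H\<^sup>T) $$ (i, j) = 1\<^sub>m (Suc n) $$ (i, j)"
      using ij by (simp add: tt)
  qed (auto simp: H_def)
  moreover have "H $$ (0, i) = e i" if i: "i < Suc n" for i
  proof (cases "N = 0")
    case True
    hence "(w i)\<^sup>2 = 0" unfolding N_def using i by (subst (asm) sum_nonneg_eq_0_iff) auto
    thus ?thesis using i N True by (auto simp: H_def w_def split: if_splits)
  next
    case False
    hence "t * w 0 = 1" using N by (simp add: t_def w_def field_simps)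
    thus ?thesis using i by (auto simp: H_def w_def split: if_splits)
  qed
  ultimately show ?thesis by (intro exI[of _ H]) (auto simp: H_def)
qed

text \<open>Deflation: conjugation by an orthogonal \<open>H\<close> whose first row is an
  eigenvector turns the first column into k times the first basis vector. By symmetry
  \<open>B\<close> is then block diagonal, and the induction hypothesis diagonalizes the remaining
  block.\<close>

lemma symmetric_mat_orthogonally_diagonalizable:
  fixes A :: "real mat"
  assumes "A \<in> carrier_mat n n" "A\<^sup>T = A"
  shows "\<exists>Q l. Q \<in> carrier_mat n n \<and> Q * Q\<^sup>T = 1\<^sub>m n \<and> A = Q\<^sup>T * (mat_diag n l * Q)"
  using assms
proof (induction n arbitrary: A)
  case 0
  thus ?case by (intro exI[of _ "1\<^sub>m 0"] exI) (auto intro!: eq_matI)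
next
  case (Suc n)
  let ?N = "Suc n"
  note A = Suc.prems(1)
  have symA: "A $$ (i, j) = A $$ (j, i)" if "i < ?N" "j < ?N" for i j
    using Suc.prems that by (metis carrier_matD index_transpose_mat(1))
  obtain e k where e: "(\<Sum>i<?N. (e i)\<^sup>2) = 1"
    and ev: "\<And>i. i < ?N \<Longrightarrow> (\<Sum>j<?N. A $$ (i, j) * e j) = k * e i"
    using symmetric_real_eigenvector[of ?N "\<lambda>i j. A $$ (i, j)"] symA by blast
  obtain H where H: "H \<in> carrier_mat ?N ?N" "H * H\<^sup>T = 1\<^sub>m ?N" "\<And>i. i < ?N \<Longrightarrow> H $$ (0, i) = e i"
    using orthogonal_mat_with_first_row[OF e] by blast
  have HTH: "H\<^sup>T * H = 1\<^sub>m ?N"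
    using mat_mult_left_right_inverse[OF H(1) _ H(2)] H(1) by simp
  define B where "B = H * A * H\<^sup>T"
  have B: "B \<in> carrier_mat ?N ?N" using A H by (simp add: B_def)
  have BT: "B\<^sup>T = B"
    using A H Suc.prems(2) by (simp add: B_def transpose_mult[of _ ?N ?N _ ?N] assoc_mult_mat[of _ ?N ?N _ ?N _ ?N] mult_carrier_mat[of _ ?N ?N _ ?N])
  have B0: "B $$ (i, 0) = k * of_bool (i = 0)" if i: "i < ?N" for i
  proof -
    have "B $$ (i, 0) = (\<Sum>r<?N. H $$ (i, r) * (\<Sum>s<?N. A $$ (r, s) * e s))"
      using A H i unfolding B_def assoc_mult_mat[OF H(1) A transpose_carrier_mat[THEN iffD2, OF H(1)]]
      by (simp add: scalar_prod_def lessThan_atLeast0 H(3) del: sum.op_ivl_Suc)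
    also have "\<dots> = (\<Sum>r<?N. H $$ (i, r) * (k * H $$ (0, r)))"
      by (intro sum.cong) (auto simp: ev H(3) simp del: sum.lessThan_Suc)
    also have "\<dots> = k * (\<Sum>r<?N. H $$ (i, r) * H $$ (0, r))"
      unfolding sum_distrib_left by (simp add: mult_ac)
    also have "(\<Sum>r<?N. H $$ (i, r) * H $$ (0, r)) = (H * H\<^sup>T) $$ (i, 0)"
      using H(1) i by (simp add: scalar_prod_def lessThan_atLeast0 del: sum.op_ivl_Suc)
    finally show ?thesis using i H(2) by simp
  qed
  define C where "C = mat n n (\<lambda>(i, j). B $$ (Suc i, Suc j))"
  have symB: "B $$ (i, j) = B $$ (j, i)" if "i < ?N" "j < ?N" for i j
    using B BT that by (metis carrier_matD index_transpose_mat(1))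
  have "C \<in> carrier_mat n n" "C\<^sup>T = C"
    using symB by (auto simp: C_def intro!: eq_matI)
  then obtain Q l where Q: "Q \<in> carrier_mat n n" "Q * Q\<^sup>T = 1\<^sub>m n" "C = Q\<^sup>T * (mat_diag n l * Q)"
    using Suc.IH[of C] by blast
  define P where "P = four_block_mat (1\<^sub>m 1) (0\<^sub>m 1 n) (0\<^sub>m n 1) Q"
  define l' where "l' i = (if i = 0 then k else l (i - 1))" for i
  have P: "P \<in> carrier_mat ?N ?N" using four_block_carrier_mat[OF one_carrier_mat[of 1] Q(1)] by (simp add: P_def)
  have PT: "P\<^sup>T = four_block_mat (1\<^sub>m 1) (0\<^sub>m 1 n) (0\<^sub>m n 1) Q\<^sup>T"
    unfolding P_def by (subst transpose_four_block_mat[of _ 1 1 _ n _ n]) (use Q(1) in auto)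
  have PPT: "P * P\<^sup>T = 1\<^sub>m ?N"
    unfolding PT unfolding P_def
    by (subst mult_four_block_mat[of _ 1 1 _ n _ n _ _ 1 _ n]) (use Q in \<open>auto intro!: eq_matI\<close>)
  have D: "mat_diag ?N l' = four_block_mat (k \<cdot>\<^sub>m 1\<^sub>m 1) (0\<^sub>m 1 n) (0\<^sub>m n 1) (mat_diag n l)"
    by (intro eq_matI) (auto simp: mat_diag_def l'_def)
  have D0: "0\<^sub>m n (Suc 0) + mat_diag n l * 0\<^sub>m n (Suc 0) = 0\<^sub>m n (Suc 0)"
    by (intro eq_matI) (auto simp: mat_diag_def)
  have DQ: "0\<^sub>m n n + mat_diag n l * Q = mat_diag n l * Q"
    using Q(1) by (intro left_add_zero_mat mult_carrier_mat[of _ n n]) auto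
  have DQc: "mat_diag n l * Q \<in> carrier_mat n n"
    using Q(1) by (intro mult_carrier_mat[of _ n n]) auto
  have Z0: "0\<^sub>m (Suc 0) n + 0\<^sub>m (Suc 0) n * (mat_diag n l * Q) = 0\<^sub>m (Suc 0) n"
    using Q(1) by (intro eq_matI) (auto simp: scalar_prod_def mat_diag_def)
  have DP: "mat_diag ?N l' * P = four_block_mat (k \<cdot>\<^sub>m 1\<^sub>m 1) (0\<^sub>m 1 n) (0\<^sub>m n 1) (mat_diag n l * Q)"
    unfolding D P_def
    by (subst mult_four_block_mat[of _ 1 1 _ n _ n _ _ 1 _ n]) (use Q D0 DQ in \<open>auto intro!: cong_four_block_mat\<close>)
  have E0: "0\<^sub>m n n + Q\<^sup>T * (mat_diag n l * Q) = Q\<^sup>T * (mat_diag n l * Q)"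
    using Q(1) DQc by (intro left_add_zero_mat mult_carrier_mat[of _ n n]) auto
  have E1: "0\<^sub>m n (Suc 0) + Q\<^sup>T * 0\<^sub>m n (Suc 0) = 0\<^sub>m n (Suc 0)"
    using Q(1) by (intro eq_matI) (auto simp: scalar_prod_def)
  have "P\<^sup>T * (mat_diag ?N l' * P) = four_block_mat (k \<cdot>\<^sub>m 1\<^sub>m 1) (0\<^sub>m 1 n) (0\<^sub>m n 1) C"
    unfolding DP PT Q(3)
    by (subst mult_four_block_mat[of _ 1 1 _ n _ n _ _ 1 _ n])
      (use Q DQc E0 E1 Z0 in \<open>auto intro!: cong_four_block_mat\<close>)
  also have "\<dots> = B"
    using B B0 symB by (intro eq_matI) (auto simp: C_def)
  finally have BP: "B = P\<^sup>T * (mat_diag ?N l' * P)" ..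
  have "A = (H\<^sup>T * H) * A * (H\<^sup>T * H)" using A by (simp add: HTH)
  also have "\<dots> = H\<^sup>T * B * H"
    using A H unfolding B_def by (simp add: assoc_mult_mat[of _ ?N ?N _ ?N _ ?N] mult_carrier_mat[of _ ?N ?N _ ?N])
  also have "\<dots> = (P * H)\<^sup>T * (mat_diag ?N l' * (P * H))"
    using P H unfolding BP by (simp add: transpose_mult[of _ ?N ?N _ ?N] assoc_mult_mat[of _ ?N ?N _ ?N _ ?N] mult_carrier_mat[of _ ?N ?N _ ?N])
  finally have "A = (P * H)\<^sup>T * (mat_diag ?N l' * (P * H))" .
  moreover have "(P * H) * (P * H)\<^sup>T = P * (H * H\<^sup>T) * P\<^sup>T"
    using P H(1) by (simp add: transpose_mult[of _ ?N ?N _ ?N] assoc_mult_mat[of _ ?N ?N _ ?N _ ?N] mult_carrier_mat[of _ ?N ?N _ ?N])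
  hence "(P * H) * (P * H)\<^sup>T = 1\<^sub>m ?N" using P PPT H(2) by simp
  ultimately show ?case using P H(1) by (intro exI[of _ "P * H"] exI[of _ l']) auto
qed

text \<open>Matrices are plain functions read on indices below n, which makes swapping sums easy.
  Row and column orthogonality are both recorded: the first gives the action on eigenvectors, the
  second Parseval's identity.\<close>

definition spectral :: "nat \<Rightarrow> (nat \<Rightarrow> nat \<Rightarrow> real) \<Rightarrow> (nat \<Rightarrow> real) \<Rightarrow> (nat \<Rightarrow> nat \<Rightarrow> real) \<Rightarrow> bool" where
  "spectral n W l u \<longleftrightarrow>
     (\<forall>i<n. \<forall>j<n. (\<Sum>r<n. u i r * u j r) = of_bool (i = j)) \<and>
     (\<forall>r<n. \<forall>s<n. (\<Sum>i<n. u i r * u i s) = of_bool (r = s)) \<and>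
     (\<forall>r<n. \<forall>s<n. W r s = (\<Sum>i<n. l i * (u i r * u i s)))"

lemma spectral_exists:
  assumes "\<And>i j. i < n \<Longrightarrow> j < n \<Longrightarrow> W i j = W j i"
  shows "\<exists>l u. spectral n W l u"
proof -
  let ?A = "mat n n (\<lambda>(i, j). W i j)"
  have "?A\<^sup>T = ?A" using assms by (intro eq_matI) auto
  then obtain Q l where Q: "Q \<in> carrier_mat n n" "Q * Q\<^sup>T = 1\<^sub>m n" and A: "?A = Q\<^sup>T * (mat_diag n l * Q)"
    using symmetric_mat_orthogonally_diagonalizable[of ?A n] by auto
  have Q': "Q\<^sup>T * Q = 1\<^sub>m n" using mat_mult_left_right_inverse[OF Q(1) _ Q(2)] Q(1) by simp
  show ?thesis
  proof (intro exI[of _ l] exI[of _ "\<lambda>i r. Q $$ (i, r)"], unfold spectral_def, intro conjI allI impI)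
    fix i j assume ij: "i < n" "j < n"
    show "(\<Sum>r<n. Q $$ (i, r) * Q $$ (j, r)) = of_bool (i = j)"
      using arg_cong[OF Q(2), of "\<lambda>X. X $$ (i, j)"] ij Q(1)
      by (simp add: scalar_prod_def lessThan_atLeast0)
    show "(\<Sum>r<n. Q $$ (r, i) * Q $$ (r, j)) = of_bool (i = j)"
      using arg_cong[OF Q', of "\<lambda>X. X $$ (i, j)"] ij Q(1)
      by (simp add: scalar_prod_def lessThan_atLeast0)
    show "W i j = (\<Sum>r<n. l r * (Q $$ (r, i) * Q $$ (r, j)))"
      using arg_cong[OF A, of "\<lambda>X. X $$ (i, j)"] ij Q(1)
      by (simp add: mat_diag_mult_left[OF Q(1)] scalar_prod_def lessThan_atLeast0 mult_ac)
  qed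
qed

section \<open>Powers, traces and quadratic forms in an eigenbasis\<close>

primrec mpow :: "nat \<Rightarrow> (nat \<Rightarrow> nat \<Rightarrow> real) \<Rightarrow> nat \<Rightarrow> nat \<Rightarrow> nat \<Rightarrow> real" where
  "mpow n W 0 = (\<lambda>i j. of_bool (i = j))"
| "mpow n W (Suc k) = (\<lambda>i j. \<Sum>l<n. W i l * mpow n W k l j)"

definition trace_pow :: "nat \<Rightarrow> (nat \<Rightarrow> nat \<Rightarrow> real) \<Rightarrow> nat \<Rightarrow> real" where
  "trace_pow n W k = (\<Sum>i<n. mpow n W k i i)"

definition quad :: "nat \<Rightarrow> (nat \<Rightarrow> nat \<Rightarrow> real) \<Rightarrow> (nat \<Rightarrow> real) \<Rightarrow> real" where
  "quad n W v = (\<Sum>r<n. \<Sum>s<n. W r s * (v r * v s))"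

lemma spectral_quad:
  assumes "spectral n W l u"
  shows "quad n W v = (\<Sum>i<n. l i * (\<Sum>r<n. u i r * v r)\<^sup>2)"
proof -
  have "quad n W v = (\<Sum>r<n. \<Sum>s<n. \<Sum>i<n. l i * (u i r * u i s) * (v r * v s))"
    using assms unfolding quad_def spectral_def by (simp add: sum_distrib_right)
  also have "\<dots> = (\<Sum>r<n. \<Sum>i<n. \<Sum>s<n. l i * (u i r * u i s) * (v r * v s))"
    by (intro sum.cong refl sum.swap)
  also have "\<dots> = (\<Sum>i<n. \<Sum>r<n. \<Sum>s<n. l i * (u i r * u i s) * (v r * v s))"
    by (rule sum.swap)
  also have "\<dots> = (\<Sum>i<n. l i * (\<Sum>r<n. u i r * v r)\<^sup>2)"
    by (simp add: power2_eq_square sum_product sum_distrib_left mult_ac)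
  finally show ?thesis .
qed

lemma spectral_parseval:
  assumes "spectral n W l u"
  shows "(\<Sum>i<n. (\<Sum>r<n. u i r * v r)\<^sup>2) = (\<Sum>r<n. (v r)\<^sup>2)"
proof -
  have "(\<Sum>i<n. (\<Sum>r<n. u i r * v r)\<^sup>2) = (\<Sum>i<n. \<Sum>r<n. \<Sum>s<n. (u i r * u i s) * (v r * v s))"
    by (simp add: power2_eq_square sum_product mult_ac)
  also have "\<dots> = (\<Sum>r<n. \<Sum>i<n. \<Sum>s<n. (u i r * u i s) * (v r * v s))"
    by (rule sum.swap)
  also have "\<dots> = (\<Sum>r<n. \<Sum>s<n. \<Sum>i<n. (u i r * u i s) * (v r * v s))"
    by (intro sum.cong refl sum.swap)
  also have "\<dots> = (\<Sum>r<n. \<Sum>s<n. of_bool (r = s) * (v r * v s))"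
    using assms unfolding spectral_def by (simp flip: sum_distrib_right)
  also have "\<dots> = (\<Sum>r<n. (v r)\<^sup>2)"
    by (intro sum.cong) (auto simp: power2_eq_square of_bool_def if_distrib[of "\<lambda>x. x * _"] cong: if_cong)
  finally show ?thesis .
qed

lemma spectral_quad_eigenvector:
  assumes "spectral n W l u" "i < n"
  shows "quad n W (u i) = l i"
proof -
  have "quad n W (u i) = (\<Sum>j<n. l j * of_bool (j = i))"
    unfolding spectral_quad[OF assms(1)]
    using assms by (intro sum.cong) (auto simp: spectral_def)
  thus ?thesis using assms(2) by (simp add: of_bool_def if_distrib cong: if_cong)
qed

lemma spectral_norm_eigenvector: "spectral n W l u \<Longrightarrow> i < n \<Longrightarrow> (\<Sum>r<n. (u i r)\<^sup>2) = 1"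
  by (simp add: spectral_def power2_eq_square)

lemma spectral_mpow:
  assumes "spectral n W l u" "r < n" "s < n"
  shows "mpow n W k r s = (\<Sum>i<n. l i ^ k * (u i r * u i s))"
  using assms(2)
proof (induction k arbitrary: r)
  case 0
  thus ?case using assms by (simp add: spectral_def)
next
  case (Suc k)
  have "mpow n W (Suc k) r s =
      (\<Sum>t<n. (\<Sum>i<n. l i * (u i r * u i t)) * (\<Sum>j<n. l j ^ k * (u j t * u j s)))"
    using Suc assms(1) by (simp add: spectral_def)
  also have "\<dots> = (\<Sum>t<n. \<Sum>i<n. \<Sum>j<n. l i * l j ^ k * u i r * u j s * (u i t * u j t))"
    by (simp add: sum_product mult_ac)
  also have "\<dots> = (\<Sum>i<n. \<Sum>t<n. \<Sum>j<n. l i * l j ^ k * u i r * u j s * (u i t * u j t))"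
    by (rule sum.swap)
  also have "\<dots> = (\<Sum>i<n. \<Sum>j<n. \<Sum>t<n. l i * l j ^ k * u i r * u j s * (u i t * u j t))"
    by (intro sum.cong refl sum.swap)
  also have "\<dots> = (\<Sum>i<n. \<Sum>j<n. l i * l j ^ k * u i r * u j s * of_bool (i = j))"
    using assms(1) unfolding spectral_def by (simp flip: sum_distrib_left)
  also have "\<dots> = (\<Sum>i<n. l i ^ Suc k * (u i r * u i s))"
    by (intro sum.cong) (auto simp: of_bool_def if_distrib cong: if_cong)
  finally show ?case .
qed

lemma spectral_trace_pow:
  assumes "spectral n W l u"
  shows "trace_pow n W k = (\<Sum>i<n. l i ^ k)"
proof -
  have "trace_pow n W k = (\<Sum>i<n. \<Sum>j<n. l j ^ k * (u j i * u j i))"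
    unfolding trace_pow_def using spectral_mpow[OF assms] by simp
  also have "\<dots> = (\<Sum>j<n. \<Sum>i<n. l j ^ k * (u j i * u j i))" by (rule sum.swap)
  also have "\<dots> = (\<Sum>j<n. l j ^ k)"
    using assms by (simp add: spectral_def flip: sum_distrib_left)
  finally show ?thesis .
qed

text \<open>The trace of an even power is a sum of nonnegative powers of eigenvalues, so it
  dominates the power of the largest one. This is how a trace moment controls the operator
  norm.\<close>

lemma quad_le_trace_pow:
  assumes sym: "\<And>i j. i < n \<Longrightarrow> j < n \<Longrightarrow> W i j = W j i"
    and tr: "trace_pow n W (2 * p) \<le> t ^ (2 * p)" and "t \<ge> 0" "p > 0"
  shows "\<bar>quad n W v\<bar> \<le> t * (\<Sum>r<n. (v r)\<^sup>2)"
proof -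
  obtain l u where sp: "spectral n W l u" using spectral_exists[of n W] sym by blast
  have l: "\<bar>l i\<bar> \<le> t" if "i < n" for i
  proof -
    have "\<bar>l i\<bar> ^ (2 * p) \<le> (\<Sum>j<n. \<bar>l j\<bar> ^ (2 * p))"
      using that by (intro member_le_sum) auto
    also have "\<dots> = trace_pow n W (2 * p)"
      unfolding spectral_trace_pow[OF sp] by (simp add: power_even_abs)
    finally have "\<bar>l i\<bar> ^ (2 * p) \<le> t ^ (2 * p)" using tr by simp
    thus ?thesis using assms(3,4) by (simp add: power_mono_iff)
  qed
  have "\<bar>quad n W v\<bar> \<le> (\<Sum>i<n. \<bar>l i\<bar> * (\<Sum>r<n. u i r * v r)\<^sup>2)"
    unfolding spectral_quad[OF sp] by (rule order.trans[OF sum_abs]) (simp add: abs_mult)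
  also have "\<dots> \<le> (\<Sum>i<n. t * (\<Sum>r<n. u i r * v r)\<^sup>2)"
    using l by (intro sum_mono mult_right_mono) auto
  also have "\<dots> = t * (\<Sum>r<n. (v r)\<^sup>2)"
    by (simp add: spectral_parseval[OF sp] flip: sum_distrib_left)
  finally show ?thesis .
qed

text \<open>The converse passage costs a factor n. It is applied in dimension 2 p, where this factor
  cancels against the one won by the dimension reduction.\<close>

lemma trace_pow_le_quad:
  assumes sym: "\<And>i j. i < n \<Longrightarrow> j < n \<Longrightarrow> W i j = W j i"
    and quad: "\<And>v. (\<Sum>r<n. (v r)\<^sup>2) \<le> 1 \<Longrightarrow> \<bar>quad n W v\<bar> \<le> t"
  shows "trace_pow n W (2 * p) \<le> real n * t ^ (2 * p)"
proof -
  obtain l u where sp: "spectral n W l u" using spectral_exists[of n W] sym by blast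
  have "trace_pow n W (2 * p) = (\<Sum>i<n. \<bar>l i\<bar> ^ (2 * p))"
    unfolding spectral_trace_pow[OF sp] by (simp add: power_even_abs)
  also have "\<dots> \<le> (\<Sum>i<n. t ^ (2 * p))"
  proof (intro sum_mono power_mono)
    fix i assume i: "i \<in> {..<n}"
    show "\<bar>l i\<bar> \<le> t"
      using quad[of "u i"] spectral_quad_eigenvector[OF sp] spectral_norm_eigenvector[OF sp] i by simp
  qed auto
  finally show ?thesis by simp
qed

subsection \<open>Closed walks\<close>

text \<open>A closed walk is the list of its vertices; the closing step back to the head is supplied
  by \<open>rotate1\<close> in \<open>steps\<close>. Edges are unordered, stored as (min, max), and
  may be loops, since the diagonal of the adjacency matrix is random as well.\<close>

definition walks :: "nat \<Rightarrow> nat \<Rightarrow> nat list set" where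
  "walks n k = {u. set u \<subseteq> {..<n} \<and> length u = k}"

definition steps :: "'a list \<Rightarrow> ('a \<times> 'a) list" where
  "steps u = zip u (rotate1 u)"

definition edge :: "nat \<times> nat \<Rightarrow> nat \<times> nat" where
  "edge p = (min (fst p) (snd p), max (fst p) (snd p))"

definition edges :: "nat list \<Rightarrow> (nat \<times> nat) list" where
  "edges u = map edge (steps u)"

text \<open>An edge passed exactly once contributes the mean of a centered entry, which is 0, so
  only these walks survive in expectation.\<close>

definition no_simple_edge :: "nat list \<Rightarrow> bool" where
  "no_simple_edge u \<longleftrightarrow> (\<forall>e\<in>set (edges u). count_list (edges u) e \<noteq> 1)"

lemma finite_walks [simp]: "finite (walks n k)"
  unfolding walks_def using finite_lists_length_eq[of "{..<n}" k] by simp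

lemma mpow_Suc_walks:
  assumes "j < n"
  shows "mpow n W (Suc k) i j = (\<Sum>xs\<in>walks n k. prod_list (map (\<lambda>(a, b). W a b) (zip (i # xs) (xs @ [j]))))"
proof (induction k arbitrary: i)
  case 0
  have "walks n 0 = {[]}" by (auto simp: walks_def)
  thus ?case using assms by (simp add: of_bool_def if_distrib cong: if_cong)
next
  case (Suc k)
  have "walks n (Suc k) = (\<lambda>(xs, l). l # xs) ` (walks n k \<times> {..<n})"
    unfolding walks_def by (rule lists_length_Suc_eq)
  hence "(\<Sum>xs\<in>walks n (Suc k). prod_list (map (\<lambda>(a, b). W a b) (zip (i # xs) (xs @ [j])))) =
    (\<Sum>(xs, l)\<in>walks n k \<times> {..<n}. W i l * prod_list (map (\<lambda>(a, b). W a b) (zip (l # xs) (xs @ [j]))))"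
    by (subst sum.reindex_cong[OF _ _ refl, of "\<lambda>(xs, l). l # xs" "walks n k \<times> {..<n}"])
       (auto simp: inj_on_def intro!: sum.cong)
  also have "\<dots> = (\<Sum>l<n. W i l * mpow n W (Suc k) l j)"
    unfolding Suc.IH sum_distrib_left by (subst sum.swap) (simp add: sum.cartesian_product)
  finally show ?case by simp
qed

lemma trace_pow_walks:
  "trace_pow n W (Suc k) = (\<Sum>u\<in>walks n (Suc k). prod_list (map (\<lambda>(a, b). W a b) (steps u)))"
proof -
  have "walks n (Suc k) = (\<lambda>(xs, l). l # xs) ` (walks n k \<times> {..<n})"
    unfolding walks_def by (rule lists_length_Suc_eq)
  hence "(\<Sum>u\<in>walks n (Suc k). prod_list (map (\<lambda>(a, b). W a b) (steps u))) =
    (\<Sum>(xs, l)\<in>walks n k \<times> {..<n}. prod_list (map (\<lambda>(a, b). W a b) (zip (l # xs) (xs @ [l]))))"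
    by (subst sum.reindex_cong[OF _ _ refl, of "\<lambda>(xs, l). l # xs" "walks n k \<times> {..<n}"])
       (auto simp: inj_on_def steps_def intro!: sum.cong)
  also have "\<dots> = (\<Sum>l<n. mpow n W (Suc k) l l)"
    by (subst sum.cartesian_product[symmetric], subst sum.swap) (simp add: mpow_Suc_walks del: mpow.simps)
  finally show ?thesis by (simp add: trace_pow_def)
qed

lemma length_edges [simp]: "length (edges u) = length u"
  by (simp add: edges_def steps_def)

lemma set_steps: "set (steps u) \<subseteq> set u \<times> set u"
  unfolding steps_def by (auto dest: set_zip_leftD set_zip_rightD)

lemma set_edges_walks:
  assumes "u \<in> walks n k"
  shows "set (edges u) \<subseteq> {(i, j). i \<le> j \<and> j < n}"
  using assms set_steps[of u] by (force simp: edges_def edge_def walks_def)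

lemma prod_list_count:
  fixes f :: "'a \<Rightarrow> real"
  assumes "finite S" "set xs \<subseteq> S"
  shows "prod_list (map f xs) = (\<Prod>s\<in>S. f s ^ count_list xs s)"
  using assms(2)
proof (induction xs)
  case (Cons x xs)
  have "(\<Prod>s\<in>S. f s ^ count_list (x # xs) s) = (\<Prod>s\<in>S. (if s = x then f s else 1) * f s ^ count_list xs s)"
    by (intro prod.cong) auto
  also have "\<dots> = f x * (\<Prod>s\<in>S. f s ^ count_list xs s)"
    using Cons.prems assms(1) by (simp add: prod.distrib)
  finally show ?case using Cons by simp
qed simp

text \<open>A walk traces a connected graph: each vertex not met before brings an edge not met
  before.\<close>

lemma card_open_walk:
  "card (set (x # xs)) \<le> card (edge ` set (zip (x # xs) xs)) + 1"
proof (induction xs arbitrary: x)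
  case (Cons y ys)
  let ?E = "edge ` set (zip (y # ys) ys)"
  show ?case
  proof (cases "x \<in> set (y # ys)")
    case True
    hence "card (set (x # y # ys)) \<le> card ?E + 1" using Cons[of y] by (simp add: insert_absorb)
    also have "card ?E \<le> card (insert (edge (x, y)) ?E)" by (rule card_mono) auto
    finally show ?thesis by simp
  next
    case False
    have "edge (x, y) \<notin> ?E"
    proof
      assume "edge (x, y) \<in> ?E"
      then obtain a b where ab: "(a, b) \<in> set (zip (y # ys) ys)" "edge (x, y) = edge (a, b)" by auto
      have "a \<in> set (y # ys)" "b \<in> set (y # ys)"
        using ab(1) by (auto dest: set_zip_leftD set_zip_rightD)
      with ab(2) False show False by (auto simp: edge_def min_def max_def split: if_splits)
    qed
    hence "card (insert (edge (x, y)) ?E) = card ?E + 1" by simp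
    thus ?thesis using Cons[of y] False by simp
  qed
qed (simp add: edge_def)

lemma card_vertices_le_edges: "card (set u) \<le> card (set (edges u)) + 1"
proof (cases u)
  case (Cons x xs)
  have "set (zip (y # ys) ys) \<subseteq> set (zip (y # ys) (ys @ [z]))" for y z :: nat and ys
    by (induction ys arbitrary: y) auto
  hence "set (zip (x # xs) xs) \<subseteq> set (steps u)" by (simp add: Cons steps_def)
  hence "card (edge ` set (zip (x # xs) xs)) \<le> card (set (edges u))"
    by (intro card_mono) (auto simp: edges_def)
  thus ?thesis using card_open_walk[of x xs] by (simp add: Cons)
qed simp

lemma card_edges_le:
  assumes "no_simple_edge u"
  shows "2 * card (set (edges u)) \<le> length u"
proof -
  have "(\<Sum>e\<in>set (edges u). 2) \<le> (\<Sum>e\<in>set (edges u). count_list (edges u) e)"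
  proof (rule sum_mono)
    fix e assume e: "e \<in> set (edges u)"
    hence "count_list (edges u) e \<noteq> 0" by (simp add: count_list_0_iff)
    moreover have "count_list (edges u) e \<noteq> 1" using assms e by (simp add: no_simple_edge_def)
    ultimately show "2 \<le> count_list (edges u) e" by simp
  qed
  thus ?thesis by (simp add: sum_count_set mult.commute)
qed

section \<open>Relabelling the vertices of a walk\<close>

lemma edge_map_eq_iff:
  assumes "inj_on f A" "p \<in> A \<times> A" "q \<in> A \<times> A"
  shows "edge (map_prod f f p) = edge (map_prod f f q) \<longleftrightarrow> edge p = edge q"
proof -
  have *: "edge (a, b) = edge (c, d) \<longleftrightarrow> (a = c \<and> b = d) \<or> (a = d \<and> b = c)" for a b c d
    by (auto simp: edge_def min_def max_def)
  show ?thesis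
    using assms by (cases p; cases q) (auto simp: * inj_on_eq_iff)
qed

lemma no_simple_edge_map:
  assumes "inj_on f (set u)"
  shows "no_simple_edge (map f u) \<longleftrightarrow> no_simple_edge u"
proof -
  have st: "steps (map f u) = map (map_prod f f) (steps u)"
    by (simp add: steps_def rotate1_map zip_map_map map_prod_def)
  have cnt: "count_list (edges (map f u)) (edge (map_prod f f p)) = count_list (edges u) (edge p)"
    if "p \<in> set (steps u)" for p
  proof -
    have pq: "edge (map_prod f f q) = edge (map_prod f f p) \<longleftrightarrow> edge q = edge p" if "q \<in> set (steps u)" for q
      using edge_map_eq_iff[OF assms, of q p] \<open>p \<in> _\<close> that set_steps[of u] by blast
    have "length (filter (\<lambda>q. edge (map_prod f f p) = edge (map_prod f f q)) (steps u)) =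
      length (filter (\<lambda>q. edge p = edge q) (steps u))"
      by (intro arg_cong[of _ _ length] filter_cong refl) (metis pq)
    thus ?thesis
      unfolding edges_def st count_list_eq_length_filter by (simp add: filter_map o_def)
  qed
  thus ?thesis unfolding no_simple_edge_def by (auto simp: edges_def st)
qed

text \<open>The falling factorial n (n - 1) ... (n - m + 1), the number of injections of an
  m-element set into \<open>{..<n}\<close>. Truncated subtraction makes it 0 for m > n.\<close>

definition falling :: "nat \<Rightarrow> nat \<Rightarrow> nat" where
  "falling n m = (\<Prod>i\<in>{0..<m}. n - i)"

definition relabels :: "nat list \<Rightarrow> nat list \<Rightarrow> bool" where
  "relabels u v \<longleftrightarrow> (\<exists>f. inj_on f (set u) \<and> v = map f u)"

lemma relabels_sym: "relabels u v \<Longrightarrow> relabels v u"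
  unfolding relabels_def
proof (elim exE conjE)
  fix f assume f: "inj_on f (set u)" "v = map f u"
  have "u = map (inv_into (set u) f) v"
    using f by (auto simp: map_idI)
  moreover have "inj_on (inv_into (set u) f) (set v)"
    using f by (simp add: inj_on_inv_into)
  ultimately show "\<exists>f. inj_on f (set v) \<and> u = map f v" by blast
qed

lemma relabels_commute: "relabels u v \<longleftrightarrow> relabels v u"
  using relabels_sym by blast

lemma card_relabels:
  assumes "u \<in> walks n k"
  shows "card {v \<in> walks r k. relabels u v} = falling r (card (set u))"
proof -
  let ?F = "{f \<in> set u \<rightarrow>\<^sub>E {..<r}. inj_on f (set u)}"
  have "{v \<in> walks r k. relabels u v} = (\<lambda>f. map f u) ` ?F"
  proof (intro subset_antisym subsetI)
    fix v assume "v \<in> {v \<in> walks r k. relabels u v}"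
    then obtain f where f: "inj_on f (set u)" "v = map f u" "v \<in> walks r k"
      by (auto simp: relabels_def)
    hence "restrict f (set u) \<in> ?F"
      by (auto simp: walks_def inj_on_def)
    moreover have "v = map (restrict f (set u)) u" using f by simp
    ultimately show "v \<in> (\<lambda>f. map f u) ` ?F" by blast
  next
    fix v assume "v \<in> (\<lambda>f. map f u) ` ?F"
    thus "v \<in> {v \<in> walks r k. relabels u v}"
      using assms by (auto simp: walks_def relabels_def)
  qed
  moreover have "inj_on (\<lambda>f. map f u) ?F"
    by (intro inj_onI PiE_ext[of _ "set u" "\<lambda>_. {..<r}"]) auto
  ultimately show ?thesis
    using card_inj_on_subset_funcset[of "set u" "{..<r}" "set u"]
    by (simp add: card_image falling_def)
qed

text \<open>Double counting of the pairs (u, v) that are relabellings of each other, with u on n and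
  v on r vertices.\<close>

lemma sum_walks_relabel:
  fixes h :: "nat list \<Rightarrow> real"
  assumes "\<And>u v. relabels u v \<Longrightarrow> h u = h v"
  shows "(\<Sum>u\<in>walks n k. h u * falling r (card (set u))) = (\<Sum>v\<in>walks r k. h v * falling n (card (set v)))"
proof -
  have count: "real (falling r (card (set u))) = (\<Sum>v\<in>walks r k. of_bool (relabels u v))"
    if "u \<in> walks n k" for u n r
    using card_relabels[OF that, of r] by (simp add: of_bool_def sum.If_cases Int_def)
  have "(\<Sum>u\<in>walks n k. h u * falling r (card (set u))) =
    (\<Sum>u\<in>walks n k. \<Sum>v\<in>walks r k. h u * of_bool (relabels u v))"
    by (intro sum.cong refl) (simp only: count sum_distrib_left)
  also have "\<dots> = (\<Sum>u\<in>walks n k. \<Sum>v\<in>walks r k. h v * of_bool (relabels v u))"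
    using assms by (intro sum.cong) (auto simp: of_bool_def relabels_commute)
  also have "\<dots> = (\<Sum>v\<in>walks r k. \<Sum>u\<in>walks n k. h v * of_bool (relabels v u))"
    by (rule sum.swap)
  also have "\<dots> = (\<Sum>v\<in>walks r k. h v * falling n (card (set v)))"
    by (intro sum.cong refl) (simp only: count sum_distrib_left)
  finally show ?thesis .
qed

lemma falling_le: "real (falling n m) \<le> real n ^ m"
proof -
  have "falling n m \<le> (\<Prod>i\<in>{0..<m}. n)" unfolding falling_def by (intro prod_mono) auto
  thus ?thesis by (metis (mono_tags) card_atLeastLessThan diff_zero of_nat_le_iff of_nat_power prod_constant)
qed

lemma falling_ge:
  assumes "m \<le> p" "p \<le> r"
  shows "real r * (real r - real p) ^ m \<le> real (falling r (Suc m))"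
proof -
  have "(\<Prod>i\<in>{1..<Suc m}. real r - real p) \<le> (\<Prod>i\<in>{1..<Suc m}. real (r - i))"
    using assms by (intro prod_mono) auto
  hence "real r * (real r - real p) ^ m \<le> real r * (\<Prod>i\<in>{1..<Suc m}. real (r - i))"
    by (intro mult_left_mono) auto
  also have "\<dots> = real (falling r (Suc m))"
    unfolding falling_def by (subst prod.atLeast_Suc_lessThan) auto
  finally show ?thesis .
qed

text \<open>A walk through \<open>m + 1\<close> vertices has about \<open>n ^ (m + 1)\<close> relabellings in \<open>{..<n}\<close>, against
  \<open>r ^ (m + 1)\<close> in \<open>{..<r}\<close>, so a weight \<open>a ^ m\<close> with \<open>a * n \<le> r\<close> makes up for the larger vertex set.\<close>
lemma sum_walks_dimension_reduction:
  fixes a :: real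
  assumes a: "0 < a" and n: "n > 0" and p: "p > 0" and r: "a * n + p \<le> real r"
  shows "(\<Sum>u\<in>walks n (2 * p). of_bool (no_simple_edge u) * a ^ (card (set u) - 1))
    \<le> real n / real r * (\<Sum>v\<in>walks r (2 * p). of_bool (no_simple_edge v))"
proof -
  have an: "a * n > 0" using a n by simp
  have pr: "p \<le> r" using r an by linarith
  have r0: "real r > 0" using r an by linarith
  \<comment> \<open>At most p distinct edges, each passed at least twice, and at most one vertex
    more than edges.\<close>
  have vtx: "card (set u) \<le> p + 1" if "no_simple_edge u" "length u = 2 * p" for u
    using card_edges_le[OF that(1)] card_vertices_le_edges[of u] that(2) by simp
  \<comment> \<open>The weight is divided by the number of relabellings in \<open>{..<r}\<close>,
    which brings the sum into the form that \<open>sum_walks_relabel\<close> transfers to r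
    vertices.\<close>
  define h where "h u = of_bool (no_simple_edge u) * a ^ (card (set u) - 1) / falling r (card (set u))" for u
  have h: "h u = h v" if "relabels u v" for u v
    using that no_simple_edge_map by (auto simp: h_def relabels_def card_image)
  \<comment> \<open>One factor of \<open>falling r m\<close> is r itself and the others are at least
    r - p \<ge> a n, so the powers of a n cancel and n / r remains.\<close>
  have *: "falling r m > 0 \<and> a ^ (m - 1) * falling n m / falling r m \<le> real n / real r"
    if m: "m \<le> p + 1" "m > 0" for m
  proof -
    obtain l where l: "m = Suc l" using m(2) by (cases m) auto
    have "real r * (a * n) ^ l \<le> real r * (real r - real p) ^ l"
      using r an by (intro mult_left_mono power_mono) auto
    also have "\<dots> \<le> falling r m" unfolding l using m l pr by (intro falling_ge) auto
    finally have ge: "real r * (a * n) ^ l \<le> falling r m" .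
    have pos: "real r * (a * n) ^ l > 0" using r0 an by simp
    have "a ^ (m - 1) * falling n m / falling r m \<le> a ^ l * n ^ Suc l / (real r * (a * n) ^ l)"
      unfolding l using ge pos a falling_le[of n "Suc l"] l
      by (intro frac_le mult_mono) (auto intro!: mult_nonneg_nonneg)
    also have "\<dots> = real n / real r" using a n r0 by (simp add: power_mult_distrib field_simps)
    finally show ?thesis using ge pos by (metis of_nat_0_less_iff order_less_le_trans)
  qed
    have pos: "card (set u) > 0" if "u \<in> walks n (2 * p)" for u n
      using that p by (cases u) (auto simp: walks_def card_gt_0_iff)
    have "(\<Sum>u\<in>walks n (2 * p). of_bool (no_simple_edge u) * a ^ (card (set u) - 1)) =
      (\<Sum>u\<in>walks n (2 * p). h u * falling r (card (set u)))"
    proof (rule sum.cong[OF refl])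
      fix u assume u: "u \<in> walks n (2 * p)"
      show "of_bool (no_simple_edge u) * a ^ (card (set u) - 1) = h u * falling r (card (set u))"
        using *[OF vtx[of u] pos[OF u]] u by (auto simp: h_def walks_def)
    qed
    also have "\<dots> = (\<Sum>v\<in>walks r (2 * p). h v * falling n (card (set v)))"
      by (rule sum_walks_relabel) (rule h)
    also have "\<dots> \<le> (\<Sum>v\<in>walks r (2 * p). real n / real r * of_bool (no_simple_edge v))"
    proof (rule sum_mono)
      fix v assume v: "v \<in> walks r (2 * p)"
      show "h v * falling n (card (set v)) \<le> real n / real r * of_bool (no_simple_edge v)"
        using *[OF vtx[of v] pos[OF v]] v by (auto simp: h_def walks_def)
    qed
    finally show ?thesis by (subst sum_distrib_left)
qed

subsection \<open>Products of Bernoulli distributions\<close>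

text \<open>The expectation of f at a random subset of S that contains each s independently with
  probability \<open>p s\<close>. As a finite sum it can be evaluated pointwise for given positions,
  where it represents the conditional law of the graph.\<close>

definition bern :: "'s set \<Rightarrow> ('s \<Rightarrow> real) \<Rightarrow> ('s set \<Rightarrow> real) \<Rightarrow> real" where
  "bern S p f = (\<Sum>E\<in>Pow S. (\<Prod>s\<in>S. if s \<in> E then p s else 1 - p s) * f E)"

definition pairs :: "nat \<Rightarrow> (nat \<times> nat) set" where
  "pairs n = {(i, j). i \<le> j \<and> j < n}"

text \<open>With c = 1 this is the noise of the graph; with c = 3 and p = 1/3 it is the comparison
  matrix with entries 2 and - 1. The k-th moment of an entry is \<open>moment c p k\<close>.\<close>

definition centered :: "real \<Rightarrow> (nat \<times> nat \<Rightarrow> real) \<Rightarrow> (nat \<times> nat) set \<Rightarrow> nat \<Rightarrow> nat \<Rightarrow> real" where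
  "centered c p E a b = c * (of_bool (edge (a, b) \<in> E) - p (edge (a, b)))"

definition moment :: "real \<Rightarrow> real \<Rightarrow> nat \<Rightarrow> real" where
  "moment c p k = p * (c * (1 - p)) ^ k + (1 - p) * (- c * p) ^ k"

lemma finite_pairs [simp]: "finite (pairs n)"
  by (rule finite_subset[of _ "{..<n} \<times> {..<n}"]) (auto simp: pairs_def)

lemma centered_sym: "centered c p E a b = centered c p E b a"
  by (simp add: centered_def edge_def min.commute max.commute)

lemma prod_split_if:
  fixes a b :: "'s \<Rightarrow> real"
  assumes "finite S" "E \<subseteq> S"
  shows "(\<Prod>s\<in>S. if s \<in> E then a s else b s) = (\<Prod>s\<in>E. a s) * (\<Prod>s\<in>S - E. b s)"
proof -
  have "S \<inter> {s. s \<in> E} = E" "S \<inter> - {s. s \<in> E} = S - E" using assms by auto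
  thus ?thesis using assms by (simp add: prod.If_cases)
qed

text \<open>Independence: expanding the product of two-term sums over the subsets of S.\<close>

lemma bern_prod:
  assumes "finite S"
  shows "bern S p (\<lambda>E. \<Prod>s\<in>S. g s (s \<in> E)) = (\<Prod>s\<in>S. p s * g s True + (1 - p s) * g s False)"
proof -
  have "bern S p (\<lambda>E. \<Prod>s\<in>S. g s (s \<in> E)) =
    (\<Sum>E\<in>Pow S. (\<Prod>s\<in>S. if s \<in> E then p s * g s True else (1 - p s) * g s False))"
    unfolding bern_def
    by (intro sum.cong refl, subst prod.distrib[symmetric], intro prod.cong refl) auto
  also have "\<dots> = (\<Sum>E\<in>Pow S. (\<Prod>s\<in>E. p s * g s True) * (\<Prod>s\<in>S - E. (1 - p s) * g s False))"
    using assms by (intro sum.cong refl prod_split_if) auto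
  finally show ?thesis by (simp only: prod_add[OF assms])
qed

lemma bern_sum: "bern S p (\<lambda>E. \<Sum>i\<in>I. f i E) = (\<Sum>i\<in>I. bern S p (f i))"
  unfolding bern_def sum_distrib_left by (rule sum.swap)

lemma bern_cmult: "bern S p (\<lambda>E. c * f E) = c * bern S p f"
  unfolding bern_def sum_distrib_left by (simp add: mult_ac)

lemma bern_mono:
  assumes "\<And>s. s \<in> S \<Longrightarrow> 0 \<le> p s \<and> p s \<le> 1" "\<And>E. E \<subseteq> S \<Longrightarrow> f E \<le> g E"
  shows "bern S p f \<le> bern S p g"
  unfolding bern_def using assms by (intro sum_mono mult_left_mono prod_nonneg) auto

lemma bern_trace_pow:
  "bern (pairs n) p (\<lambda>E. trace_pow n (centered c p E) (Suc k)) =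
     (\<Sum>u\<in>walks n (Suc k). \<Prod>s\<in>pairs n. moment c (p s) (count_list (edges u) s))"
proof -
  have "prod_list (map (\<lambda>(a, b). centered c p E a b) (steps u)) =
      (\<Prod>s\<in>pairs n. (c * (of_bool (s \<in> E) - p s)) ^ count_list (edges u) s)"
    if "u \<in> walks n (Suc k)" for u E
  proof -
    have "map (\<lambda>(a, b). centered c p E a b) (steps u) = map (\<lambda>s. c * (of_bool (s \<in> E) - p s)) (edges u)"
      by (auto simp: edges_def centered_def)
    thus ?thesis
      using prod_list_count[of "pairs n" "edges u"] set_edges_walks[OF that] by (simp add: pairs_def[symmetric])
  qed
  hence "bern (pairs n) p (\<lambda>E. trace_pow n (centered c p E) (Suc k)) =
    (\<Sum>u\<in>walks n (Suc k). bern (pairs n) p (\<lambda>E. \<Prod>s\<in>pairs n. (c * (of_bool (s \<in> E) - p s)) ^ count_list (edges u) s))"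
    unfolding trace_pow_walks by (simp add: bern_sum)
  thus ?thesis
    by (simp add: moment_def bern_prod[OF finite_pairs,
          where g = "\<lambda>s t. (c * (of_bool t - p s)) ^ count_list (edges u) s" for u])
qed

text \<open>The variance p (1 - p) dominates the moments of all orders k \<ge> 2, as both values
  have modulus at most 1. The bound does not improve with k, so the weight of a walk depends only on
  its distinct edges.\<close>

lemma moment_le:
  assumes "0 \<le> p" "p \<le> a" "a \<le> 1" "k \<ge> 2"
  shows "\<bar>moment 1 p k\<bar> \<le> a"
proof -
  have "\<bar>moment 1 p k\<bar> \<le> p * (1 - p) ^ k + (1 - p) * p ^ k"
    unfolding moment_def using assms
    by (intro order.trans[OF abs_triangle_ineq]) (simp add: abs_mult power_abs)
  also have "\<dots> \<le> p * (1 - p) ^ 1 + (1 - p) * p ^ 1"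
    using assms by (intro add_mono mult_left_mono power_decreasing) auto
  also have "\<dots> = 2 * p * (1 - p)" by simp
  finally have *: "\<bar>moment 1 p k\<bar> \<le> 2 * p * (1 - p)" .
  have "\<bar>moment 1 p k\<bar> \<le> p * (1 - p) ^ k + (1 - p) * p ^ k"
    unfolding moment_def using assms
    by (intro order.trans[OF abs_triangle_ineq]) (simp add: abs_mult power_abs)
  also have "\<dots> \<le> p * (1 - p) ^ 2 + (1 - p) * p ^ 2"
    using assms by (intro add_mono mult_left_mono power_decreasing) auto
  also have "\<dots> = p - p\<^sup>2" by (simp add: power2_eq_square algebra_simps)
  finally show ?thesis using assms zero_le_power2[of p] by linarith
qed

text \<open>The moment equals (2^k + 2 (-1)^k) / 3, and an odd k is at least 3 here. A symmetric
  sign would not serve for the comparison: its odd moments vanish, which would lose the walks that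
  pass an edge three times.\<close>

lemma moment_third_ge:
  assumes "k \<ge> 2"
  shows "moment 3 (1 / 3) k \<ge> 1"
proof -
  have "(2::real) ^ 2 \<le> 2 ^ k" using assms by (intro power_increasing) auto
  moreover have "(- 1 :: real) ^ k \<ge> - 1" by (cases "even k") auto
  ultimately show ?thesis
  proof (cases "even k")
    case False
    hence "k \<ge> 3" using assms by (cases "k = 2") auto
    hence "(2::real) ^ 3 \<le> 2 ^ k" by (intro power_increasing) auto
    with False show ?thesis by (simp add: moment_def)
  qed (simp add: moment_def)
qed

lemma moment_0 [simp]: "moment c p 0 = 1"
  by (simp add: moment_def)

lemma moment_1 [simp]: "moment c p (Suc 0) = 0"
  by (simp add: moment_def algebra_simps)

text \<open>A simple edge contributes a first moment, that is 0. Otherwise each distinct edge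
  contributes at most a, and as a \<le> 1 the number of edges may be lowered to the number of
  vertices minus 1.\<close>

lemma prod_moment_upper:
  assumes u: "u \<in> walks n k" and a: "0 < a" "a \<le> 1"
    and p: "\<And>s. s \<in> pairs n \<Longrightarrow> 0 \<le> p s \<and> p s \<le> a"
  shows "(\<Prod>s\<in>pairs n. moment 1 (p s) (count_list (edges u) s))
    \<le> of_bool (no_simple_edge u) * a ^ (card (set u) - 1)"
proof (cases "no_simple_edge u")
  case False
  then obtain e where "e \<in> set (edges u)" "count_list (edges u) e = Suc 0"
    by (auto simp: no_simple_edge_def)
  hence "\<exists>e\<in>pairs n. moment 1 (p e) (count_list (edges u) e) = 0"
    using set_edges_walks[OF u] unfolding pairs_def[symmetric] by (intro bexI[of _ e]) auto
  hence "(\<Prod>s\<in>pairs n. moment 1 (p s) (count_list (edges u) s)) = 0" using prod_zero_iff[OF finite_pairs] by blast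
  thus ?thesis using False by (simp only: of_bool_eq mult_zero_left order.refl)
next
  case True
  have sub: "set (edges u) \<subseteq> pairs n" using set_edges_walks[OF u] unfolding pairs_def .
  have "(\<Prod>s\<in>pairs n. moment 1 (p s) (count_list (edges u) s))
    \<le> (\<Prod>s\<in>pairs n. \<bar>moment 1 (p s) (count_list (edges u) s)\<bar>)"
    unfolding abs_prod[symmetric] by (rule abs_ge_self)
  also have "\<dots> \<le> (\<Prod>s\<in>pairs n. if s \<in> set (edges u) then a else 1)"
  proof (intro prod_mono conjI abs_ge_zero)
    fix s assume s: "s \<in> pairs n"
    have "count_list (edges u) s \<ge> 2" if e: "s \<in> set (edges u)"
    proof -
      have "count_list (edges u) s \<noteq> 0" using e by (simp add: count_list_0_iff)
      moreover have "count_list (edges u) s \<noteq> 1" using True e by (simp add: no_simple_edge_def)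
      ultimately show ?thesis by simp
    qed
    thus "\<bar>moment 1 (p s) (count_list (edges u) s)\<bar> \<le> (if s \<in> set (edges u) then a else 1)"
      using p[OF s] a by (auto intro!: moment_le)
  qed
  also have "\<dots> = a ^ card (set (edges u))"
    using prod_split_if[of "pairs n" "set (edges u)" "\<lambda>_. a" "\<lambda>_. 1"] sub by simp
  also have "\<dots> \<le> a ^ (card (set u) - 1)"
    using card_vertices_le_edges[of u] a by (intro power_decreasing) auto
  finally show ?thesis using True by simp
qed

lemma prod_moment_lower:
  assumes u: "u \<in> walks n k"
  shows "of_bool (no_simple_edge u) \<le> (\<Prod>s\<in>pairs n. moment 3 (1 / 3) (count_list (edges u) s))"
proof (cases "no_simple_edge u")
  case True
  have "moment 3 (1 / 3) (count_list (edges u) s) \<ge> 1" for s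
  proof (cases "s \<in> set (edges u)")
    case e: True
    hence "count_list (edges u) s \<noteq> 0" by (simp add: count_list_0_iff)
    moreover have "count_list (edges u) s \<noteq> 1" using True e by (simp add: no_simple_edge_def)
    ultimately show ?thesis by (intro moment_third_ge) auto
  qed simp
  hence "1 \<le> (\<Prod>s\<in>pairs n. moment 3 (1 / 3) (count_list (edges u) s))"
    by (intro prod_ge_1) auto
  with True show ?thesis by simp
next
  case False
  have "0 \<le> moment 3 (1 / 3) k" for k
    using moment_third_ge[of k] by (cases "k = 0 \<or> k = 1") auto
  with False show ?thesis by (auto intro!: prod_nonneg)
qed

text \<open>The variable with values \<open>2\<close> and \<open>- 1\<close> taken with probabilities \<open>1 / 3\<close> and \<open>2 / 3\<close> is centered
  and has all its other moments at least \<open>1\<close>, so no cancellation occurs on the right-hand side.\<close>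
lemma bern_trace_pow_comparison:
  assumes "0 < a" "a \<le> 1" "n > 0" "q > 0" "a * n + q \<le> real r"
    and p: "\<And>s. s \<in> pairs n \<Longrightarrow> 0 \<le> p s \<and> p s \<le> a"
  shows "bern (pairs n) p (\<lambda>E. trace_pow n (centered 1 p E) (2 * q))
    \<le> real n / real r * bern (pairs r) (\<lambda>_. 1 / 3) (\<lambda>E. trace_pow r (centered 3 (\<lambda>_. 1 / 3) E) (2 * q))"
proof -
  obtain k where k: "2 * q = Suc k" using assms(4) by (cases "2 * q") auto
  have "bern (pairs n) p (\<lambda>E. trace_pow n (centered 1 p E) (2 * q))
    \<le> (\<Sum>u\<in>walks n (2 * q). of_bool (no_simple_edge u) * a ^ (card (set u) - 1))"
    unfolding k bern_trace_pow using assms by (intro sum_mono prod_moment_upper) auto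
  also have "\<dots> \<le> real n / real r * (\<Sum>v\<in>walks r (2 * q). of_bool (no_simple_edge v))"
    using assms by (intro sum_walks_dimension_reduction)
  also have "\<dots> \<le> real n / real r * bern (pairs r) (\<lambda>_. 1 / 3) (\<lambda>E. trace_pow r (centered 3 (\<lambda>_. 1 / 3) E) (2 * q))"
    unfolding k bern_trace_pow by (intro mult_left_mono sum_mono prod_moment_lower) auto
  finally show ?thesis .
qed

subsection \<open>A net of lattice points\<close>

text \<open>Integer vectors k stand for the points k / sqrt r, of norm at most 2. The box places
  them in a finite product, over which the sum in \<open>card_net\<close> factorizes.\<close>

definition net :: "nat \<Rightarrow> (nat \<Rightarrow> int) set" where
  "net r = {k \<in> {..<r} \<rightarrow>\<^sub>E {- int (4 * r)..int (4 * r)}. (\<Sum>i<r. (k i)\<^sup>2) \<le> 4 * int r}"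

lemma finite_net [simp]: "finite (net r)"
  unfolding net_def by (rule finite_subset[OF _ finite_PiE[of "{..<r}" "\<lambda>_. {- int (4 * r)..int (4 * r)}"]]) auto

lemma abs_le_square_int: "\<bar>j\<bar> \<le> j\<^sup>2" for j :: int
proof (cases "j = 0")
  case False
  hence "\<bar>j\<bar> * 1 \<le> \<bar>j\<bar> * \<bar>j\<bar>" by (intro mult_left_mono) auto
  thus ?thesis by (simp add: power2_eq_square)
qed simp

text \<open>As exp (- j^2) \<le> 2^(-|j|), the sum is below the two-sided geometric series, whose
  value is 3.\<close>

lemma sum_exp_neg_square_le: "(\<Sum>j\<in>{- int b..int b}. exp (- (real_of_int j)\<^sup>2)) \<le> 3"
proof -
  have "(\<Sum>j\<in>{- int b..int b}. (1 / 2) ^ nat \<bar>j\<bar>) = 3 - 2 * (1 / 2 :: real) ^ b"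
  proof (induction b)
    case (Suc b)
    have "{- int (Suc b)..int (Suc b)} = insert (int (Suc b)) (insert (- int (Suc b)) {- int b..int b})"
      by auto
    moreover have "nat (1 + int b) = Suc b" "nat (int b + 1) = Suc b" by simp_all
    ultimately show ?case using Suc by simp
  qed simp
  moreover have "exp (- (real_of_int j)\<^sup>2) \<le> (1 / 2) ^ nat \<bar>j\<bar>" for j
  proof -
    have "\<bar>j\<bar> \<le> j\<^sup>2" by (rule abs_le_square_int)
    hence "real (nat \<bar>j\<bar>) \<le> (real_of_int j)\<^sup>2"
      by (metis of_int_abs of_int_le_iff of_int_power of_nat_nat abs_ge_zero of_int_of_nat_eq)
    hence "exp (- (real_of_int j)\<^sup>2) \<le> exp (- real (nat \<bar>j\<bar>))" by simp
    also have "\<dots> = exp (- 1) ^ nat \<bar>j\<bar>" by (simp flip: exp_of_nat_mult)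
    also have "\<dots> \<le> (1 / 2) ^ nat \<bar>j\<bar>"
      using exp_ge_add_one_self[of 1] by (intro power_mono) (auto simp: exp_minus field_simps)
    finally show ?thesis .
  qed
  hence "(\<Sum>j\<in>{- int b..int b}. exp (- (real_of_int j)\<^sup>2)) \<le> (\<Sum>j\<in>{- int b..int b}. (1 / 2) ^ nat \<bar>j\<bar>)"
    by (intro sum_mono) auto
  ultimately show ?thesis by (smt (verit) zero_le_power zero_le_divide_1_iff)
qed

text \<open>Exponential weighting: each point of the net has weight exp (4 r - sum of k_i^2) \<ge>
  1, and the total weight of the box is a product of r factors, each at most 3 exp 4 \<le> exp
  6.\<close>

lemma card_net: "real (card (net r)) \<le> exp (6 * real r)"
proof -
  let ?B = "{- int (4 * r)..int (4 * r)}"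
  have "real (card (net r)) = (\<Sum>k\<in>net r. 1)" by simp
  also have "\<dots> \<le> (\<Sum>k\<in>net r. \<Prod>i\<in>{..<r}. exp (4 - (real_of_int (k i))\<^sup>2))"
  proof (rule sum_mono)
    fix k assume "k \<in> net r"
    hence "real_of_int (\<Sum>i<r. (k i)\<^sup>2) \<le> real_of_int (4 * int r)"
      unfolding net_def of_int_le_iff by simp
    hence "0 \<le> (\<Sum>i<r. 4 - (real_of_int (k i))\<^sup>2)" by (simp add: sum_subtractf)
    thus "1 \<le> (\<Prod>i\<in>{..<r}. exp (4 - (real_of_int (k i))\<^sup>2))" by (simp flip: exp_sum)
  qed
  also have "\<dots> \<le> (\<Sum>k\<in>{..<r} \<rightarrow>\<^sub>E ?B. \<Prod>i\<in>{..<r}. exp (4 - (real_of_int (k i))\<^sup>2))"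
  proof (rule sum_mono2)
    show "finite ({..<r} \<rightarrow>\<^sub>E ?B)" by (intro finite_PiE finite_lessThan finite_atLeastAtMost_int)
    show "net r \<subseteq> {..<r} \<rightarrow>\<^sub>E ?B" unfolding net_def by (rule Collect_subset)
  qed (intro prod_nonneg exp_ge_zero)
  also have "\<dots> = (\<Prod>i\<in>{..<r}. \<Sum>j\<in>?B. exp (4 - (real_of_int j)\<^sup>2))"
    by (rule prod_sum_PiE[symmetric]) auto
  also have "\<dots> = (exp 4 * (\<Sum>j\<in>?B. exp (- (real_of_int j)\<^sup>2))) ^ r"
    by (simp add: sum_distrib_left exp_diff exp_minus divide_inverse)
  also have "\<dots> \<le> (exp 4 * exp 2) ^ r"
  proof -
    have "(3::real) \<le> exp 2" using exp_ge_add_one_self[of "2::real"] by simp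
    thus ?thesis using sum_exp_neg_square_le[of "4 * r"]
      by (intro power_mono mult_left_mono) (auto intro!: mult_nonneg_nonneg sum_nonneg)
  qed
  also have "\<dots> = exp (6 * real r)" by (simp flip: exp_add exp_of_nat2_mult)
  finally show ?thesis .
qed

text \<open>A linear form on a box takes its maximum at a vertex.\<close>
lemma net_linear:
  fixes c v :: "nat \<Rightarrow> real"
  assumes v: "(\<Sum>i<r. (v i)\<^sup>2) \<le> 1"
  shows "\<exists>k\<in>net r. (\<Sum>i<r. c i * v i) \<le> (\<Sum>i<r. c i * (real_of_int (k i) / sqrt r))"
proof -
  \<comment> \<open>Each coordinate of sqrt r * v is rounded in the direction, given by the sign of
    \<open>c i\<close>, that does not lower the form. A move of at most 1 per coordinate raises the
    square norm to at most 2 r + 2 r, which is the radius of \<open>net\<close>.\<close>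
  define k where "k = (\<lambda>i\<in>{..<r}. if c i \<ge> 0 then \<lceil>sqrt r * v i\<rceil> else \<lfloor>sqrt r * v i\<rfloor>)"
  have near: "\<bar>real_of_int (k i) - sqrt r * v i\<bar> \<le> 1" if "i < r" for i
    using that by (simp add: k_def) linarith
  have sq: "(real_of_int (k i))\<^sup>2 \<le> 2 * (real r * (v i)\<^sup>2) + 2" if "i < r" for i
  proof -
    define d where "d = real_of_int (k i) - sqrt r * v i"
    have "d\<^sup>2 \<le> 1" using near[OF that] by (simp add: d_def abs_square_le_1)
    moreover have "real_of_int (k i) = sqrt r * v i + d" by (simp add: d_def)
    moreover have "(sqrt r * v i + d)\<^sup>2 \<le> 2 * (sqrt r * v i)\<^sup>2 + 2 * d\<^sup>2"
      using zero_le_power2[of "sqrt r * v i - d"] by (simp add: power2_sum power2_diff)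
    ultimately show ?thesis by (simp add: power_mult_distrib)
  qed
  have "(\<Sum>i<r. (real_of_int (k i))\<^sup>2) \<le> (\<Sum>i<r. 2 * (real r * (v i)\<^sup>2) + 2)"
    using sq by (intro sum_mono) auto
  also have "\<dots> = 2 * real r * (\<Sum>i<r. (v i)\<^sup>2) + 2 * real r"
    by (simp add: sum.distrib sum_distrib_left mult_ac)
  also have "\<dots> \<le> 2 * real r * 1 + 2 * real r"
    using v by (intro add_mono mult_left_mono) auto
  finally have "real_of_int (\<Sum>i<r. (k i)\<^sup>2) \<le> real_of_int (4 * int r)" by simp
  hence sum4: "(\<Sum>i<r. (k i)\<^sup>2) \<le> 4 * int r" unfolding of_int_le_iff .
  have "\<bar>k i\<bar> \<le> 4 * int r" if "i < r" for i
  proof -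
    have "\<bar>k i\<bar> \<le> (k i)\<^sup>2" by (rule abs_le_square_int)
    also have "\<dots> \<le> (\<Sum>i<r. (k i)\<^sup>2)" using that by (intro member_le_sum) auto
    finally show ?thesis using sum4 by simp
  qed
  hence "k \<in> net r"
    using sum4 by (fastforce simp: net_def k_def abs_le_iff)
  moreover have "(\<Sum>i<r. c i * v i) \<le> (\<Sum>i<r. c i * (real_of_int (k i) / sqrt r))"
  proof (rule sum_mono)
    fix i assume i: "i \<in> {..<r}"
    hence s: "sqrt r > 0" by auto
    show "c i * v i \<le> c i * (real_of_int (k i) / sqrt r)"
    proof (cases "c i \<ge> 0")
      case True
      hence "sqrt r * v i \<le> real_of_int (k i)" using i by (simp add: k_def)
      hence "v i \<le> real_of_int (k i) / sqrt r" using s by (simp add: field_simps)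
      thus ?thesis using True by (rule mult_left_mono)
    next
      case False
      hence "real_of_int (k i) \<le> sqrt r * v i" using i by (simp add: k_def)
      hence "real_of_int (k i) / sqrt r \<le> v i" using s by (simp add: field_simps)
      thus ?thesis using False by (intro mult_left_mono_neg) auto
    qed
  qed
  ultimately show ?thesis by blast
qed

definition bilin :: "nat \<Rightarrow> (nat \<Rightarrow> nat \<Rightarrow> real) \<Rightarrow> (nat \<Rightarrow> real) \<Rightarrow> (nat \<Rightarrow> real) \<Rightarrow> real" where
  "bilin r W x y = (\<Sum>i<r. \<Sum>j<r. W i j * (x i * y j))"

text \<open>Rounding as in \<open>net_linear\<close> applies to linear forms only, so the two
  arguments of the bilinear form are replaced by net points in turn. The form on the ball is
  dominated outright, without the approximation term of an epsilon-net. The factor r comes from the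
  two scalings by sqrt r.\<close>

lemma quad_le_net:
  assumes v: "(\<Sum>i<r. (v i)\<^sup>2) \<le> 1"
  shows "\<exists>k\<in>net r. \<exists>m\<in>net r. real r * quad r W v \<le> bilin r W (\<lambda>i. real_of_int (k i)) (\<lambda>i. real_of_int (m i))"
proof -
  have dv: "w * (a / sqrt r) * (b / sqrt r) = w * (a * b) / real r" for w a b
    by (simp add: mult.assoc)
  obtain k where k: "k \<in> net r"
    "(\<Sum>i<r. (\<Sum>j<r. W i j * v j) * v i) \<le> (\<Sum>i<r. (\<Sum>j<r. W i j * v j) * (real_of_int (k i) / sqrt r))"
    using net_linear[OF v, of "\<lambda>i. \<Sum>j<r. W i j * v j"] by blast
  obtain m where m: "m \<in> net r"
    "(\<Sum>j<r. (\<Sum>i<r. W i j * (real_of_int (k i) / sqrt r)) * v j) \<le>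
     (\<Sum>j<r. (\<Sum>i<r. W i j * (real_of_int (k i) / sqrt r)) * (real_of_int (m j) / sqrt r))"
    using net_linear[OF v, of "\<lambda>j. \<Sum>i<r. W i j * (real_of_int (k i) / sqrt r)"] by blast
  have "quad r W v = (\<Sum>i<r. (\<Sum>j<r. W i j * v j) * v i)"
    unfolding quad_def sum_distrib_right by (simp add: mult_ac)
  also note k(2)
  also have "(\<Sum>i<r. (\<Sum>j<r. W i j * v j) * (real_of_int (k i) / sqrt r)) =
    (\<Sum>j<r. (\<Sum>i<r. W i j * (real_of_int (k i) / sqrt r)) * v j)"
    unfolding sum_distrib_right by (subst sum.swap) (simp add: mult_ac)
  also note m(2)
  also have "(\<Sum>j<r. (\<Sum>i<r. W i j * (real_of_int (k i) / sqrt r)) * (real_of_int (m j) / sqrt r)) =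
    (\<Sum>i<r. \<Sum>j<r. W i j * (real_of_int (k i) * real_of_int (m j)) / real r)"
    unfolding sum_distrib_right by (subst sum.swap) (simp only: dv)
  also have "\<dots> = bilin r W (\<lambda>i. real_of_int (k i)) (\<lambda>i. real_of_int (m i)) / real r"
    by (simp add: bilin_def sum_divide_distrib)
  finally show ?thesis using k(1) m(1)
    by (intro bexI[of _ k] bexI[of _ m]) (cases "r = 0", auto simp: field_simps bilin_def)
qed

section \<open>Exponential moments of bilinear forms and the comparison matrix\<close>

lemma sum_square_fold:
  fixes g :: "nat \<Rightarrow> nat \<Rightarrow> real"
  shows "(\<Sum>i<r. \<Sum>j<r. g i j) = (\<Sum>(i, j)\<in>pairs r. if i = j then g i j else g i j + g j i)"
proof (induction r)
  case (Suc r)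
  have P: "pairs (Suc r) = pairs r \<union> (\<lambda>i. (i, r)) ` {..r}" by (auto simp: pairs_def)
  have "(\<Sum>(i, j)\<in>pairs (Suc r). if i = j then g i j else g i j + g j i) =
    (\<Sum>(i, j)\<in>pairs r. if i = j then g i j else g i j + g j i) +
    (\<Sum>(i, j)\<in>(\<lambda>i. (i, r)) ` {..r}. if i = j then g i j else g i j + g j i)"
    unfolding P by (intro sum.union_disjoint finite_pairs) (auto simp: pairs_def)
  also have "(\<Sum>(i, j)\<in>(\<lambda>i. (i, r)) ` {..r}. if i = j then g i j else g i j + g j i) =
    (\<Sum>i\<le>r. if i = r then g i r else g i r + g r i)"
    by (subst sum.reindex) (auto simp: inj_on_def)
  also have "\<dots> = (\<Sum>i<r. g i r + g r i) + g r r"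
    by (simp add: lessThan_Suc_atMost[symmetric])
  finally show ?case using Suc by (simp add: sum.distrib)
qed (simp add: pairs_def)

text \<open>For a centered variable the linear term averages out, which leaves E exp X \<le> E exp
  (X^2): a sub-Gaussian bound for bounded variables.\<close>

lemma exp_le_self_plus_exp_square: "exp x \<le> x + exp (x\<^sup>2)" for x :: real
proof -
  have e: "1 + x\<^sup>2 \<le> exp (x\<^sup>2)" by (rule exp_ge_add_one_self)
  consider "\<bar>x\<bar> \<le> 1" | "x > 1" | "x < - 1" by linarith
  thus ?thesis
  proof cases
    case 1
    have "exp x \<le> 1 + x + x\<^sup>2"
    proof (cases "x \<ge> 0")
      case True thus ?thesis using 1 exp_bound[of x] by simp
    next
      case False
      have "exp x * (1 - x + x\<^sup>2 / 2) \<le> exp x * exp (- x)"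
        using False exp_lower_Taylor_quadratic[of "- x"] by (intro mult_left_mono) auto
      hence 2: "exp x * (1 - x + x\<^sup>2 / 2) \<le> 1" by (simp flip: exp_add)
      have "1 \<le> (1 + x + x\<^sup>2) * (1 - x + x\<^sup>2 / 2)"
      proof -
        have "(1 + x + x\<^sup>2) * (1 - x + x\<^sup>2 / 2) = 1 + x\<^sup>2 * (1 - x + x\<^sup>2) / 2"
          by (simp add: field_simps power2_eq_square)
        moreover have "x\<^sup>2 * (1 - x + x\<^sup>2) \<ge> 0" using False by (intro mult_nonneg_nonneg) auto
        ultimately show ?thesis by simp
      qed
      with 2 have "exp x * (1 - x + x\<^sup>2 / 2) \<le> (1 + x + x\<^sup>2) * (1 - x + x\<^sup>2 / 2)" by linarith
      moreover have "1 - x + x\<^sup>2 / 2 > 0" using False by (simp add: add_pos_nonneg)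
      ultimately show ?thesis by (simp only: mult_le_cancel_right_pos)
    qed
    with e show ?thesis by linarith
  next
    case 2
    hence "x \<le> x\<^sup>2" by (simp add: power2_eq_square)
    hence "exp x \<le> exp (x\<^sup>2)" by simp
    thus ?thesis using 2 by linarith
  next
    case 3
    have "- x \<le> x\<^sup>2" using 3 mult_left_mono[of 1 "- x" "- x"] by (simp add: power2_eq_square)
    moreover have "exp x \<le> 1" using 3 by simp
    ultimately show ?thesis using e by linarith
  qed
qed

text \<open>Folding the square onto \<open>pairs r\<close> writes the form as a sum of independent
  entries with values 2 and - 1, so that the exponential moment is a product. The factor 4 bounds
  the squared entries, and the folded coefficients have square sum at most 2 s^2.\<close>

lemma bern_exp_bilin:
  assumes x: "(\<Sum>i<r. (x i)\<^sup>2) \<le> s" and y: "(\<Sum>i<r. (y i)\<^sup>2) \<le> s"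
  shows "bern (pairs r) (\<lambda>_. 1 / 3) (\<lambda>E. exp (t * bilin r (centered 3 (\<lambda>_. 1 / 3) E) x y)) \<le> exp (8 * t\<^sup>2 * s\<^sup>2)"
proof -
  define c where "c = (\<lambda>(i, j). if i = j then x i * y j else x i * y j + x j * y i)"
  have "exp (t * bilin r (centered 3 (\<lambda>_. 1 / 3) E) x y) =
    (\<Prod>s\<in>pairs r. exp (t * c s * (3 * of_bool (s \<in> E) - 1)))" for E
  proof -
    have "bilin r (centered 3 (\<lambda>_. 1 / 3) E) x y = (\<Sum>s\<in>pairs r. c s * (3 * of_bool (s \<in> E) - 1))"
      unfolding bilin_def sum_square_fold
      by (intro sum.cong) (auto simp: c_def centered_def edge_def pairs_def algebra_simps)
    thus ?thesis by (simp add: sum_distrib_left mult_ac flip: exp_sum)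
  qed
  hence "bern (pairs r) (\<lambda>_. 1 / 3) (\<lambda>E. exp (t * bilin r (centered 3 (\<lambda>_. 1 / 3) E) x y)) =
    (\<Prod>s\<in>pairs r. 1 / 3 * exp (t * c s * 2) + 2 / 3 * exp (- (t * c s)))"
    by (simp add: bern_prod[OF finite_pairs, where g = "\<lambda>s b. exp (t * c s * (3 * of_bool b - 1))"])
  also have "\<dots> \<le> (\<Prod>s\<in>pairs r. exp (4 * (t * c s)\<^sup>2))"
  proof (intro prod_mono conjI)
    fix s
    have "exp (t * c s * 2) \<le> t * c s * 2 + exp (4 * (t * c s)\<^sup>2)"
      using exp_le_self_plus_exp_square[of "t * c s * 2"] by (simp add: power_mult_distrib mult_ac)
    moreover have "exp (- (t * c s)) \<le> - (t * c s) + exp ((t * c s)\<^sup>2)"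
      using exp_le_self_plus_exp_square[of "- (t * c s)"] by simp
    moreover have "exp ((t * c s)\<^sup>2) \<le> exp (4 * (t * c s)\<^sup>2)" by simp
    ultimately show "1 / 3 * exp (t * c s * 2) + 2 / 3 * exp (- (t * c s)) \<le> exp (4 * (t * c s)\<^sup>2)"
      by linarith
  qed (auto intro!: add_nonneg_nonneg)
  also have "\<dots> = exp (4 * t\<^sup>2 * (\<Sum>s\<in>pairs r. (c s)\<^sup>2))"
    by (simp add: sum_distrib_left power_mult_distrib mult_ac flip: exp_sum)
  also have "\<dots> \<le> exp (4 * t\<^sup>2 * (2 * s\<^sup>2))"
  proof -
    have "(\<Sum>s\<in>pairs r. (c s)\<^sup>2) \<le> (\<Sum>(i, j)\<in>pairs r. 2 * (if i = j then (x i)\<^sup>2 * (y j)\<^sup>2 else (x i)\<^sup>2 * (y j)\<^sup>2 + (x j)\<^sup>2 * (y i)\<^sup>2))"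
    proof (rule sum_mono, clarify)
      fix i j
      have "(x i * y j + x j * y i)\<^sup>2 \<le> 2 * ((x i)\<^sup>2 * (y j)\<^sup>2 + (x j)\<^sup>2 * (y i)\<^sup>2)"
        using zero_le_power2[of "x i * y j - x j * y i"] by (simp add: power2_sum power2_diff power_mult_distrib)
      thus "(c (i, j))\<^sup>2 \<le> 2 * (if i = j then (x i)\<^sup>2 * (y j)\<^sup>2 else (x i)\<^sup>2 * (y j)\<^sup>2 + (x j)\<^sup>2 * (y i)\<^sup>2)"
        by (simp add: c_def power_mult_distrib)
    qed
    also have "\<dots> = 2 * (\<Sum>i<r. \<Sum>j<r. (x i)\<^sup>2 * (y j)\<^sup>2)"
      unfolding sum_square_fold sum_distrib_left by (intro sum.cong) auto
    also have "\<dots> = 2 * ((\<Sum>i<r. (x i)\<^sup>2) * (\<Sum>j<r. (y j)\<^sup>2))" by (simp add: sum_product)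
    also have "\<dots> \<le> 2 * (s * s)"
    proof -
      have "0 \<le> s" using x sum_nonneg[of "{..<r}" "\<lambda>i. (x i)\<^sup>2"] by simp
      thus ?thesis using x y by (intro mult_left_mono mult_mono) (auto intro: sum_nonneg)
    qed
    finally have "(\<Sum>s\<in>pairs r. (c s)\<^sup>2) \<le> 2 * s\<^sup>2" by (simp add: power2_eq_square)
    hence "4 * t\<^sup>2 * (\<Sum>s\<in>pairs r. (c s)\<^sup>2) \<le> 4 * t\<^sup>2 * (2 * s\<^sup>2)" by (intro mult_left_mono) auto
    thus ?thesis by simp
  qed
  finally show ?thesis by (simp add: mult_ac)
qed

lemma power_le_fact_exp:
  fixes x :: real
  assumes "x \<ge> 0"
  shows "x ^ k \<le> fact k * exp x"
proof -
  have "x ^ k / fact k \<le> exp x"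
    unfolding exp_def using assms summable_exp_generic[of x]
    by (intro order.trans[OF _ sum_le_suminf[of _ "{k}"]]) (auto simp: divide_inverse mult.commute)
  thus ?thesis by (simp add: field_simps)
qed

text \<open>In dimension r = 2 q, the exponential of sqrt r times the operator norm has expectation
  exp (O(r)), and (2 q)! times this exponential bounds the power of order 2 q. The constant 281: two
  nets contribute 12 r and the exponential moment 128 r, together 140 r = 280 q; the factor 2 for
  the sign costs one more q.\<close>

lemma bern_trace_pow_third:
  assumes q: "q > 0"
  shows "bern (pairs (2 * q)) (\<lambda>_. 1 / 3) (\<lambda>E. trace_pow (2 * q) (centered 3 (\<lambda>_. 1 / 3) E) (2 * q))
    \<le> real (2 * q) * (2 * exp 281 * real q) ^ q"
proof -
  define r where "r = 2 * q"
  have r: "r > 0" using q by (simp add: r_def)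
  let ?Y = "\<lambda>E. centered 3 (\<lambda>_. 1 / 3) E"
  let ?b = "\<lambda>E k m. bilin r (?Y E) (\<lambda>i. real_of_int (k i)) (\<lambda>i. real_of_int (m i))"
  \<comment> \<open>A sum of exponentials that dominates exp (sqrt r * |quad|) on the unit ball: the
    net points replace the two copies of v and \<sigma> replaces the absolute value.\<close>
  define T where "T E = (\<Sum>\<sigma>\<in>{1, - 1}. \<Sum>k\<in>net r. \<Sum>m\<in>net r. exp (\<sigma> / sqrt r * ?b E k m))" for E
  have tr: "trace_pow r (?Y E) (2 * q) \<le> real r * fact (2 * q) / real r ^ q * T E" for E
  proof -
    \<comment> \<open>The bound on the power of order 2 q is stated as a bound t on the form itself,
      as \<open>trace_pow_le_quad\<close> expects.\<close>
    define t where "t = root (2 * q) (fact (2 * q) / real r ^ q * T E)"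
    have T0: "T E \<ge> 0" unfolding T_def by (intro sum_nonneg) auto
    hence nn: "fact (2 * q) / real r ^ q * T E \<ge> 0" by simp
    have t: "t \<ge> 0" "t ^ (2 * q) = fact (2 * q) / real r ^ q * T E"
      unfolding t_def using nn q by (simp_all add: real_root_pow_pos2)
    have "trace_pow r (?Y E) (2 * q) \<le> real r * t ^ (2 * q)"
    proof (rule trace_pow_le_quad)
      fix v :: "nat \<Rightarrow> real" assume v: "(\<Sum>i<r. (v i)\<^sup>2) \<le> 1"
      have *: "exp (sqrt r * (\<sigma> * quad r (?Y E) v)) \<le> T E" if \<sigma>: "\<sigma> \<in> {1, - 1}" for \<sigma>
      proof -
        obtain k m where km: "k \<in> net r" "m \<in> net r"
          "real r * quad r (\<lambda>i j. \<sigma> * ?Y E i j) v \<le> bilin r (\<lambda>i j. \<sigma> * ?Y E i j) (\<lambda>i. real_of_int (k i)) (\<lambda>i. real_of_int (m i))"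
          using quad_le_net[OF v] by blast
        have "quad r (\<lambda>i j. \<sigma> * ?Y E i j) v = \<sigma> * quad r (?Y E) v"
          by (simp add: quad_def sum_distrib_left mult_ac)
        moreover have "bilin r (\<lambda>i j. \<sigma> * ?Y E i j) (\<lambda>i. real_of_int (k i)) (\<lambda>i. real_of_int (m i)) = \<sigma> * ?b E k m"
          by (simp add: bilin_def sum_distrib_left mult_ac)
        ultimately have "sqrt r * (sqrt r * (\<sigma> * quad r (?Y E) v)) \<le> \<sigma> * ?b E k m"
          using km(3) by (simp flip: mult.assoc)
        hence "sqrt r * (\<sigma> * quad r (?Y E) v) \<le> \<sigma> / sqrt r * ?b E k m"
          using r by (simp add: field_simps)
        hence "exp (sqrt r * (\<sigma> * quad r (?Y E) v)) \<le> exp (\<sigma> / sqrt r * ?b E k m)" by simp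
        also have "\<dots> \<le> (\<Sum>m\<in>net r. exp (\<sigma> / sqrt r * ?b E k m))"
          using km by (intro member_le_sum) auto
        also have "\<dots> \<le> (\<Sum>k\<in>net r. \<Sum>m\<in>net r. exp (\<sigma> / sqrt r * ?b E k m))"
          using km by (intro member_le_sum[of k "net r" "\<lambda>k. \<Sum>m\<in>net r. exp (\<sigma> / sqrt r * ?b E k m)"]) (auto intro!: sum_nonneg)
        also have "\<dots> \<le> T E"
          unfolding T_def using \<sigma>
          by (intro member_le_sum[of \<sigma> "{1, - 1}" "\<lambda>\<sigma>. \<Sum>k\<in>net r. \<Sum>m\<in>net r. exp (\<sigma> / sqrt r * ?b E k m)"]) (auto intro!: sum_nonneg)
        finally show ?thesis .
      qed
      have "exp (sqrt r * \<bar>quad r (?Y E) v\<bar>) \<le> T E"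
        using *[of 1] *[of "- 1"] by (cases "quad r (?Y E) v \<ge> 0") auto
      hence "(sqrt r * \<bar>quad r (?Y E) v\<bar>) ^ (2 * q) \<le> fact (2 * q) * T E"
        by (intro order.trans[OF power_le_fact_exp]) auto
      hence "real r ^ q * \<bar>quad r (?Y E) v\<bar> ^ (2 * q) \<le> fact (2 * q) * T E"
        by (simp add: power_mult_distrib power_mult)
      hence "\<bar>quad r (?Y E) v\<bar> ^ (2 * q) \<le> t ^ (2 * q)"
        unfolding t(2) using r by (simp add: field_simps)
      thus "\<bar>quad r (?Y E) v\<bar> \<le> t" using t(1) q by (simp add: power_mono_iff)
    qed (rule centered_sym)
    thus ?thesis by (simp add: t(2))
  qed
  have bT: "bern (pairs r) (\<lambda>_. 1 / 3) T \<le> 2 * exp (140 * real r)"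
  proof -
    have one: "bern (pairs r) (\<lambda>_. 1 / 3) (\<lambda>E. exp (\<sigma> / sqrt r * ?b E k m)) \<le> exp (128 * real r)"
      if "k \<in> net r" "m \<in> net r" "\<sigma> \<in> {1, - 1}" for k m \<sigma>
    proof -
      have n: "(\<Sum>i<r. (real_of_int (k i))\<^sup>2) \<le> 4 * real r" if "k \<in> net r" for k
      proof -
        have "real_of_int (\<Sum>i<r. (k i)\<^sup>2) \<le> real_of_int (4 * int r)"
          unfolding of_int_le_iff using that by (simp add: net_def)
        thus ?thesis by simp
      qed
      have "bern (pairs r) (\<lambda>_. 1 / 3) (\<lambda>E. exp (\<sigma> / sqrt r * ?b E k m)) \<le> exp (8 * (\<sigma> / sqrt r)\<^sup>2 * (4 * real r)\<^sup>2)"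
        using that by (intro bern_exp_bilin n)
      also have "8 * (\<sigma> / sqrt r)\<^sup>2 * (4 * real r)\<^sup>2 = 128 * real r"
        using that(3) r by (auto simp: power_divide power2_eq_square)
      finally show ?thesis .
    qed
    have "bern (pairs r) (\<lambda>_. 1 / 3) T =
      (\<Sum>\<sigma>\<in>{1, - 1}. \<Sum>k\<in>net r. \<Sum>m\<in>net r. bern (pairs r) (\<lambda>_. 1 / 3) (\<lambda>E. exp (\<sigma> / sqrt r * ?b E k m)))"
      unfolding T_def bern_sum ..
    also have "\<dots> \<le> (\<Sum>\<sigma>\<in>{1, - 1 :: real}. \<Sum>k\<in>net r. \<Sum>m\<in>net r. exp (128 * real r))"
      using one by (intro sum_mono) blast
    also have "\<dots> = 2 * (real (card (net r)) * real (card (net r)) * exp (128 * real r))" by simp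
    also have "\<dots> \<le> 2 * (exp (6 * real r) * exp (6 * real r) * exp (128 * real r))"
      using card_net[of r] by (intro mult_left_mono mult_right_mono mult_mono) auto
    also have "\<dots> = 2 * exp (140 * real r)" by (simp flip: exp_add)
    finally show ?thesis .
  qed
  have "bern (pairs r) (\<lambda>_. 1 / 3) (\<lambda>E. trace_pow r (?Y E) (2 * q))
    \<le> real r * fact (2 * q) / real r ^ q * bern (pairs r) (\<lambda>_. 1 / 3) T"
    unfolding bern_cmult[symmetric] by (intro bern_mono tr) auto
  also have "\<dots> \<le> real r * fact (2 * q) / real r ^ q * (2 * exp (140 * real r))"
    using bT by (intro mult_left_mono) auto
  \<comment> \<open>(2 q)! \<le> r^(2 q), so half of the factorial is absorbed by the denominator
    r^q and (2 q)^q remains.\<close>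
  also have "real r * fact (2 * q) / real r ^ q * (2 * exp (140 * real r)) \<le> real r * (2 * exp 281 * real q) ^ q"
  proof -
    have "fact (2 * q) \<le> real ((2 * q) ^ (2 * q))" by (metis fact_le_power of_nat_fact of_nat_le_iff le_refl of_nat_power)
    hence "fact (2 * q) / real r ^ q \<le> real r ^ q"
      using r by (simp add: r_def field_simps power_mult power2_eq_square power_mult_distrib mult_2 power_add)
    moreover have "2 * exp (140 * real r) \<le> exp 281 ^ q"
    proof -
      have "(2::real) \<le> exp 1" using exp_ge_add_one_self[of "1::real"] by simp
      also have "\<dots> \<le> exp (real q)" using q by simp
      finally have "2 * exp (140 * real r) \<le> exp (real q) * exp (140 * real r)" by (intro mult_right_mono) auto
      also have "\<dots> = exp 281 ^ q" by (simp add: r_def flip: exp_add exp_of_nat_mult)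
      finally show ?thesis .
    qed
    ultimately have "fact (2 * q) / real r ^ q * (2 * exp (140 * real r)) \<le> real r ^ q * exp 281 ^ q"
      by (intro mult_mono) auto
    hence "real r * (fact (2 * q) / real r ^ q * (2 * exp (140 * real r))) \<le> real r * (real r ^ q * exp 281 ^ q)"
      by (intro mult_left_mono) auto
    thus ?thesis by (simp add: r_def power_mult_distrib mult_ac)
  qed
  finally show ?thesis unfolding r_def .
qed

text \<open>The comparison with r = 2 q is admissible since a n + q \<le> 2 q, and its factor n / (2
  q) cancels the dimension 2 q.\<close>

lemma bern_trace_pow_le:
  assumes "0 < a" "a \<le> 1" "n > 0" "q > 0" "a * n \<le> real q"
    and p: "\<And>s. s \<in> pairs n \<Longrightarrow> 0 \<le> p s \<and> p s \<le> a"
  shows "bern (pairs n) p (\<lambda>E. trace_pow n (centered 1 p E) (2 * q)) \<le> real n * (2 * exp 281 * real q) ^ q"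
proof -
  have "bern (pairs n) p (\<lambda>E. trace_pow n (centered 1 p E) (2 * q))
    \<le> real n / real (2 * q) * (real (2 * q) * (2 * exp 281 * real q) ^ q)"
    using assms
    by (intro order.trans[OF bern_trace_pow_comparison[of a n q "2 * q"]] mult_left_mono bern_trace_pow_third) auto
  thus ?thesis using assms(4) by simp
qed

subsection \<open>Positive semidefiniteness of the kernel\<close>

locale kernel_operator =
  fixes X :: "(real ^ 'd) set" and \<mu> :: "(real ^ 'd) measure" and K :: "real ^ 'd \<Rightarrow> real ^ 'd \<Rightarrow> real"
  assumes X: "compact X" and prob: "prob_space \<mu>" and sets_mu: "sets \<mu> = sets (restrict_space borel X)"
    and cont: "continuous_on (X \<times> X) (\<lambda>(y, z). K y z)"
    and K01: "\<forall>y\<in>X. \<forall>z\<in>X. K y z \<in> {0..1}"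
    and K_sym: "\<forall>y\<in>X. \<forall>z\<in>X. K y z = K z y"
begin

sublocale prob_space \<mu> by (rule prob)

abbreviation T :: "(real ^ 'd \<Rightarrow> real) \<Rightarrow> real ^ 'd \<Rightarrow> real" where "T \<equiv> integral_operator \<mu> K"

lemma space_mu [simp]: "space \<mu> = X"
  using sets_eq_imp_space_eq[OF sets_mu] by (simp add: space_restrict_space)

lemma measure_X [simp]: "prob X = 1"
  using prob_space by simp

lemma measurable_mu_borel: "(\<lambda>x. x) \<in> borel_measurable \<mu>"
  unfolding measurable_cong_sets[OF sets_mu refl] by (rule measurable_restrict_space1) simp

lemma measurable_mu_continuous:
  assumes "continuous_on X h"
  shows "h \<in> borel_measurable \<mu>"
  unfolding measurable_cong_sets[OF sets_mu refl] by (rule borel_measurable_continuous_on_restrict[OF assms])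

lemma measurable_K: "(\<lambda>(y, z). K y z) \<in> borel_measurable (\<mu> \<Otimes>\<^sub>M \<mu>)"
proof -
  have "(\<lambda>p. (fst p, snd p)) \<in> borel_measurable (\<mu> \<Otimes>\<^sub>M \<mu>)"
    by (intro borel_measurable_Pair measurable_compose[OF measurable_fst measurable_mu_borel]
        measurable_compose[OF measurable_snd measurable_mu_borel])
  hence "(\<lambda>p. p) \<in> \<mu> \<Otimes>\<^sub>M \<mu> \<rightarrow>\<^sub>M restrict_space borel (X \<times> X)"
    by (intro measurable_restrict_space2) (auto simp: space_pair_measure)
  thus ?thesis
    using measurable_compose borel_measurable_continuous_on_restrict[OF cont] by blast
qed

lemma measurable_K_section: "y \<in> X \<Longrightarrow> K y \<in> borel_measurable \<mu>"
  using measurable_compose[OF measurable_Pair1' measurable_K, of y] by simp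

text \<open>Bounded measurable functions take the place of L^2: every integral is finite, and the
  class contains both the indicators that test positivity and the continuous limit that serves as
  eigenfunction.\<close>

definition bdd :: "(real ^ 'd \<Rightarrow> real) \<Rightarrow> bool" where
  "bdd f \<longleftrightarrow> f \<in> borel_measurable \<mu> \<and> (\<exists>B. \<forall>x\<in>X. \<bar>f x\<bar> \<le> B)"

lemma bdd_integrable: "bdd f \<Longrightarrow> integrable \<mu> f"
  unfolding bdd_def by (auto intro!: integrable_const_bound AE_I2)

lemma bdd_mult: "bdd f \<Longrightarrow> bdd g \<Longrightarrow> bdd (\<lambda>x. f x * g x)"
  unfolding bdd_def
proof (elim conjE exE, intro conjI)
  fix B C assume *: "\<forall>x\<in>X. \<bar>f x\<bar> \<le> B" "\<forall>x\<in>X. \<bar>g x\<bar> \<le> C"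
  show "\<exists>B. \<forall>x\<in>X. \<bar>f x * g x\<bar> \<le> B"
    using * by (intro exI[of _ "B * C"]) (auto simp: abs_mult intro!: mult_mono intro: order.trans[OF abs_ge_zero])
qed auto

lemma bdd_add: "bdd f \<Longrightarrow> bdd g \<Longrightarrow> bdd (\<lambda>x. f x + g x)"
  unfolding bdd_def
proof (elim conjE exE, intro conjI)
  fix B C assume *: "\<forall>x\<in>X. \<bar>f x\<bar> \<le> B" "\<forall>x\<in>X. \<bar>g x\<bar> \<le> C"
  show "\<exists>B. \<forall>x\<in>X. \<bar>f x + g x\<bar> \<le> B"
    using * by (intro exI[of _ "B + C"]) (auto intro!: order.trans[OF abs_triangle_ineq] add_mono)
qed auto

lemma bdd_const: "bdd (\<lambda>_. c)"
  by (auto simp: bdd_def)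

lemma bdd_cmult: "bdd f \<Longrightarrow> bdd (\<lambda>x. c * f x)"
  by (intro bdd_mult bdd_const)

lemma bdd_diff: "bdd f \<Longrightarrow> bdd g \<Longrightarrow> bdd (\<lambda>x. f x - g x)"
  using bdd_add[OF _ bdd_cmult[of g "- 1"], of f] by simp

lemma bdd_abs: "bdd f \<Longrightarrow> bdd (\<lambda>x. \<bar>f x\<bar>)"
  by (auto simp: bdd_def)

lemma bdd_power2: "bdd f \<Longrightarrow> bdd (\<lambda>x. (f x)\<^sup>2)"
  unfolding power2_eq_square by (rule bdd_mult)

lemma bdd_continuous: "continuous_on X h \<Longrightarrow> bdd h"
proof -
  assume h: "continuous_on X h"
  hence "bounded (h ` X)" by (intro compact_imp_bounded compact_continuous_image X)
  thus ?thesis unfolding bdd_def bounded_iff using measurable_mu_continuous[OF h] by auto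
qed

lemma bdd_K: "y \<in> X \<Longrightarrow> bdd (K y)"
  using measurable_K_section K01 unfolding bdd_def by (auto intro!: exI[of _ 1] simp: abs_le_iff)

lemma bdd_indicator: "A \<in> sets \<mu> \<Longrightarrow> bdd (indicat_real A)"
  by (auto simp: bdd_def indicator_def intro!: exI[of _ 1])

lemma bdd_sum: "(\<And>i. i \<in> I \<Longrightarrow> bdd (f i)) \<Longrightarrow> bdd (\<lambda>x. \<Sum>i\<in>I. f i x)"
  by (induction I rule: infinite_finite_induct) (auto intro: bdd_const bdd_add)

lemmas bdd_intros = bdd_mult bdd_add bdd_const bdd_cmult bdd_diff bdd_abs bdd_power2 bdd_K bdd_indicator bdd_sum

lemma integral_mono_X:
  assumes "bdd f" "bdd g" "\<And>x. x \<in> X \<Longrightarrow> f x \<le> g x"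
  shows "(\<integral>x. f x \<partial>\<mu>) \<le> (\<integral>x. g x \<partial>\<mu>)"
  using assms by (intro integral_mono bdd_integrable) auto

lemma abs_integral_le:
  assumes "bdd f"
  shows "\<bar>\<integral>x. f x \<partial>\<mu>\<bar> \<le> (\<integral>x. \<bar>f x\<bar> \<partial>\<mu>)"
  using integral_norm_bound[of \<mu> f] by simp

lemma integral_abs_power2_le:
  assumes "bdd f"
  shows "(\<integral>x. \<bar>f x\<bar> \<partial>\<mu>)\<^sup>2 \<le> (\<integral>x. (f x)\<^sup>2 \<partial>\<mu>)"
proof -
  define a where "a = (\<integral>x. \<bar>f x\<bar> \<partial>\<mu>)"
  have "0 \<le> (\<integral>x. (\<bar>f x\<bar> - a)\<^sup>2 \<partial>\<mu>)" by (intro Bochner_Integration.integral_nonneg) simp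
  also have "\<dots> = (\<integral>x. (f x)\<^sup>2 + a\<^sup>2 - 2 * a * \<bar>f x\<bar> \<partial>\<mu>)"
    by (intro Bochner_Integration.integral_cong) (auto simp: power2_diff)
  also have "\<dots> = (\<integral>x. (f x)\<^sup>2 \<partial>\<mu>) + a\<^sup>2 - 2 * a * a"
    using assms by (simp add: a_def bdd_integrable bdd_intros prob_space)
  finally show ?thesis by (simp add: a_def power2_eq_square)
qed

text \<open>As 0 \<le> K \<le> 1, the operator maps L^1 to bounded functions with norm at most 1.
  Smallness in the mean thus becomes uniform after one application of \<open>T\<close>.\<close>

lemma abs_T_le:
  assumes f: "bdd f" and x: "x \<in> X"
  shows "\<bar>T f x\<bar> \<le> (\<integral>y. \<bar>f y\<bar> \<partial>\<mu>)"
proof -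
  have "\<bar>T f x\<bar> \<le> (\<integral>y. \<bar>K x y * f y\<bar> \<partial>\<mu>)"
    unfolding integral_operator_def using f x by (intro abs_integral_le bdd_intros)
  also have "\<dots> \<le> (\<integral>y. \<bar>f y\<bar> \<partial>\<mu>)"
    using f x K01 by (intro integral_mono_X bdd_intros) (auto simp: abs_mult intro!: mult_left_le_one_le)
  finally show ?thesis .
qed

lemma T_add_cmult:
  assumes "bdd f" "bdd g" "x \<in> X"
  shows "T (\<lambda>y. f y + c * g y) x = T f x + c * T g x"
proof -
  have "T (\<lambda>y. f y + c * g y) x = (\<integral>y. K x y * f y + c * (K x y * g y) \<partial>\<mu>)"
    unfolding integral_operator_def by (intro Bochner_Integration.integral_cong) (auto simp: algebra_simps)
  thus ?thesis using assms by (simp add: integral_operator_def bdd_integrable bdd_intros)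
qed

lemma bdd_T:
  assumes "bdd f"
  shows "bdd (T f)"
proof -
  have "(\<lambda>(x, y). K x y * f y) \<in> borel_measurable (\<mu> \<Otimes>\<^sub>M \<mu>)"
    using measurable_K assms measurable_compose[OF measurable_snd, of f \<mu> borel \<mu>] unfolding bdd_def
    by (auto simp: case_prod_beta' intro!: borel_measurable_times)
  hence "T f \<in> borel_measurable \<mu>"
    unfolding integral_operator_def[abs_def] by (rule borel_measurable_lebesgue_integral)
  thus ?thesis using abs_T_le[OF assms] by (auto simp: bdd_def)
qed

lemma T_selfadjoint:
  assumes f: "bdd f" and g: "bdd g"
  shows "(\<integral>x. f x * T g x \<partial>\<mu>) = (\<integral>x. g x * T f x \<partial>\<mu>)"
proof -
  interpret P: pair_prob_space \<mu> \<mu> ..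
  have [measurable]: "f \<in> borel_measurable \<mu>" "g \<in> borel_measurable \<mu>" using f g by (auto simp: bdd_def)
  note measurable_K[measurable]
  obtain B where B: "\<And>x. x \<in> X \<Longrightarrow> \<bar>f x\<bar> \<le> B" using f by (auto simp: bdd_def)
  obtain C where C: "\<And>x. x \<in> X \<Longrightarrow> \<bar>g x\<bar> \<le> C" using g by (auto simp: bdd_def)
  have int: "integrable (\<mu> \<Otimes>\<^sub>M \<mu>) (\<lambda>(x, y). f x * (K x y * g y))"
  proof (rule P.integrable_const_bound)
    show "AE p in \<mu> \<Otimes>\<^sub>M \<mu>. norm ((\<lambda>(x, y). f x * (K x y * g y)) p) \<le> B * (1 * C)"
    proof (rule AE_I2, clarsimp simp: space_pair_measure abs_mult)
      fix a b assume ab: "a \<in> X" "b \<in> X"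
      have "\<bar>f a\<bar> * (\<bar>K a b\<bar> * \<bar>g b\<bar>) \<le> B * (1 * C)"
        using B[OF ab(1)] C[OF ab(2)] K01 ab by (intro mult_mono mult_nonneg_nonneg) (auto simp: abs_le_iff intro: order.trans[OF abs_ge_zero] order.trans)
      thus "\<bar>f a\<bar> * (\<bar>K a b\<bar> * \<bar>g b\<bar>) \<le> B * C" by simp
    qed
  qed measurable
  have "(\<integral>x. f x * T g x \<partial>\<mu>) = (\<integral>x. (\<integral>y. f x * (K x y * g y) \<partial>\<mu>) \<partial>\<mu>)"
    by (simp add: integral_operator_def)
  also have "\<dots> = (\<integral>y. (\<integral>x. f x * (K x y * g y) \<partial>\<mu>) \<partial>\<mu>)"
    by (rule P.Fubini_integral[OF int, symmetric])
  also have "\<dots> = (\<integral>y. g y * T f y \<partial>\<mu>)"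
  proof (rule Bochner_Integration.integral_cong[OF refl])
    fix y assume "y \<in> space \<mu>"
    hence y: "y \<in> X" by simp
    have "(\<integral>x. f x * (K x y * g y) \<partial>\<mu>) = (\<integral>x. g y * (K y x * f x) \<partial>\<mu>)"
      using K_sym y by (intro Bochner_Integration.integral_cong) auto
    thus "(\<integral>x. f x * (K x y * g y) \<partial>\<mu>) = g y * T f y" by (simp add: integral_operator_def)
  qed
  finally show ?thesis .
qed

lemma abs_form_le:
  assumes f: "bdd f"
  shows "\<bar>\<integral>x. f x * T f x \<partial>\<mu>\<bar> \<le> (\<integral>x. (f x)\<^sup>2 \<partial>\<mu>)"
proof -
  define a where "a = (\<integral>y. \<bar>f y\<bar> \<partial>\<mu>)"
  have "\<bar>\<integral>x. f x * T f x \<partial>\<mu>\<bar> \<le> (\<integral>x. \<bar>f x * T f x\<bar> \<partial>\<mu>)"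
    using f by (intro abs_integral_le bdd_intros bdd_T)
  also have "\<dots> \<le> (\<integral>x. \<bar>f x\<bar> * a \<partial>\<mu>)"
    using f abs_T_le[OF f] by (intro integral_mono_X bdd_intros bdd_T) (auto simp: abs_mult a_def intro!: mult_left_mono)
  also have "\<dots> = a\<^sup>2" by (simp add: a_def power2_eq_square)
  also have "\<dots> \<le> (\<integral>x. (f x)\<^sup>2 \<partial>\<mu>)" unfolding a_def by (rule integral_abs_power2_le[OF f])
  finally show ?thesis .
qed

section \<open>Minimizing the form of the integral operator\<close>

lemma K_equicontinuous:
  assumes "e > 0"
  shows "\<exists>d>0. \<forall>x\<in>X. \<forall>y\<in>X. \<forall>u\<in>X. \<forall>v\<in>X. dist x u < d \<longrightarrow> dist y v < d \<longrightarrow> \<bar>K x y - K u v\<bar> < e"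
proof -
  have "uniformly_continuous_on (X \<times> X) (\<lambda>(y, z). K y z)"
    by (intro compact_uniformly_continuous cont compact_Times X)
  then obtain d where d: "d > 0" "\<And>p q. p \<in> X \<times> X \<Longrightarrow> q \<in> X \<times> X \<Longrightarrow> dist q p < d \<Longrightarrow>
    dist ((\<lambda>(y, z). K y z) q) ((\<lambda>(y, z). K y z) p) < e"
    using assms unfolding uniformly_continuous_on_def by metis
  show ?thesis
  proof (intro exI[of _ "d / 2"] conjI ballI impI)
    fix x y u v assume *: "x \<in> X" "y \<in> X" "u \<in> X" "v \<in> X" "dist x u < d / 2" "dist y v < d / 2"
    have "dist (x, y) (u, v) \<le> dist x u + dist y v"
      unfolding dist_prod_def by (simp add: sqrt_sum_squares_le_sum)
    hence "dist (x, y) (u, v) < d" using * by linarith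
    thus "\<bar>K x y - K u v\<bar> < e" using d(2)[of "(u, v)" "(x, y)"] * by (simp add: dist_real_def)
  qed (use d in auto)
qed

lemma abs_T_diff_le:
  assumes f: "bdd f" and xy: "x \<in> X" "y \<in> X" and e: "\<And>z. z \<in> X \<Longrightarrow> \<bar>K x z - K y z\<bar> \<le> e"
  shows "\<bar>T f x - T f y\<bar> \<le> e * (\<integral>z. \<bar>f z\<bar> \<partial>\<mu>)"
proof -
  have "T f x - T f y = (\<integral>z. (K x z - K y z) * f z \<partial>\<mu>)"
    using f xy by (simp add: integral_operator_def left_diff_distrib bdd_integrable bdd_intros)
  also have "\<bar>\<dots>\<bar> \<le> (\<integral>z. \<bar>(K x z - K y z) * f z\<bar> \<partial>\<mu>)"
    using f xy by (intro abs_integral_le bdd_intros)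
  also have "\<dots> \<le> (\<integral>z. e * \<bar>f z\<bar> \<partial>\<mu>)"
    using f xy e by (intro integral_mono_X bdd_intros) (auto simp: abs_mult intro!: mult_right_mono)
  finally show ?thesis by simp
qed

text \<open>The residual of an almost minimizer of the form is small: test the form, shifted by its lower
  bound, on \<open>f + t g\<close> where \<open>g\<close> is the residual.\<close>
lemma residual_le:
  assumes f: "bdd f" and m: "- 1 \<le> m" "m \<le> 0"
    and form: "\<And>f. bdd f \<Longrightarrow> m * (\<integral>x. (f x)\<^sup>2 \<partial>\<mu>) \<le> (\<integral>x. f x * T f x \<partial>\<mu>)"
  shows "(\<integral>x. (T f x - m * f x)\<^sup>2 \<partial>\<mu>) \<le> 2 * ((\<integral>x. f x * T f x \<partial>\<mu>) - m * (\<integral>x. (f x)\<^sup>2 \<partial>\<mu>))"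
proof -
  define g where "g x = T f x - m * f x" for x
  have g: "bdd g" unfolding g_def by (intro bdd_intros bdd_T f)
  define N where "N = (\<integral>x. (g x)\<^sup>2 \<partial>\<mu>)"
  define Q where "Q = (\<integral>x. f x * T f x \<partial>\<mu>) - m * (\<integral>x. (f x)\<^sup>2 \<partial>\<mu>)"
  \<comment> \<open>The shifted form at f + t g is Q + 2 t N + t^2 R with R \<le> 2 N, and it is
    nonnegative. The best choice t = - 1/2 gives N \<le> 2 Q.\<close>
  let ?t = "- (1 / 2) :: real"
  let ?h = "\<lambda>x. f x + ?t * g x"
  have ints: "integrable \<mu> (\<lambda>x. f x * T f x)" "integrable \<mu> (\<lambda>x. g x * T f x)" "integrable \<mu> (\<lambda>x. f x * T g x)"
    "integrable \<mu> (\<lambda>x. g x * T g x)" "integrable \<mu> (\<lambda>x. (f x)\<^sup>2)" "integrable \<mu> (\<lambda>x. f x * g x)" "integrable \<mu> (\<lambda>x. (g x)\<^sup>2)"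
    using f g by (auto intro!: bdd_integrable bdd_intros bdd_T)
  have h: "bdd ?h" by (intro bdd_intros f g)
  have 1: "(\<integral>x. ?h x * T ?h x \<partial>\<mu>) = (\<integral>x. f x * T f x \<partial>\<mu>) + ?t * (\<integral>x. f x * T g x \<partial>\<mu>) + ?t * (\<integral>x. g x * T f x \<partial>\<mu>)
      + ?t * ?t * (\<integral>x. g x * T g x \<partial>\<mu>)"
  proof -
    have "(\<integral>x. ?h x * T ?h x \<partial>\<mu>) =
      (\<integral>x. f x * T f x + ?t * (f x * T g x) + ?t * (g x * T f x) + ?t * ?t * (g x * T g x) \<partial>\<mu>)"
      by (intro Bochner_Integration.integral_cong refl, subst T_add_cmult[OF f g]) (auto simp: field_simps)
    thus ?thesis using ints by simp
  qed
  have 2: "(\<integral>x. (?h x)\<^sup>2 \<partial>\<mu>) = (\<integral>x. (f x)\<^sup>2 \<partial>\<mu>) + 2 * ?t * (\<integral>x. f x * g x \<partial>\<mu>) + ?t * ?t * N"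
  proof -
    have "(\<integral>x. (?h x)\<^sup>2 \<partial>\<mu>) = (\<integral>x. (f x)\<^sup>2 + 2 * ?t * (f x * g x) + ?t * ?t * (g x)\<^sup>2 \<partial>\<mu>)"
      by (intro Bochner_Integration.integral_cong refl) (simp add: power2_eq_square algebra_simps)
    thus ?thesis using ints by (simp add: N_def)
  qed
  have 3: "(\<integral>x. g x * T f x \<partial>\<mu>) = N + m * (\<integral>x. f x * g x \<partial>\<mu>)"
  proof -
    have "(\<integral>x. g x * T f x \<partial>\<mu>) = (\<integral>x. (g x)\<^sup>2 + m * (f x * g x) \<partial>\<mu>)"
      by (intro Bochner_Integration.integral_cong refl) (simp add: g_def power2_eq_square algebra_simps)
    thus ?thesis using ints by (simp add: N_def)
  qed
  have 4: "(\<integral>x. g x * T g x \<partial>\<mu>) \<le> N" using abs_form_le[OF g] by (simp add: N_def)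
  have N0: "N \<ge> 0" unfolding N_def by (intro Bochner_Integration.integral_nonneg) simp
  define R where "R = (\<integral>x. g x * T g x \<partial>\<mu>) - m * N"
  have "m * (\<integral>x. (?h x)\<^sup>2 \<partial>\<mu>) \<le> (\<integral>x. ?h x * T ?h x \<partial>\<mu>)" by (rule form[OF h])
  hence "0 \<le> Q - N + (1 / 4) * R"
    unfolding R_def 1 2 T_selfadjoint[OF f g] 3 Q_def by (simp add: algebra_simps)
  moreover have "- (m * N) \<le> N" using m N0 mult_right_mono[of "- m" 1 N] by simp
  hence "R \<le> 2 * N" using 4 unfolding R_def by linarith
  ultimately have "N \<le> 2 * Q" by linarith
  thus ?thesis by (simp add: N_def Q_def g_def)
qed

text \<open>Only the images T F_k converge, uniformly along a subsequence by Arzela-Ascoli; the F_k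
  themselves need not. The limit h is an eigenfunction because T (T F_k) tends to T h and also, the
  residuals being small, to m h.\<close>

lemma form_nonneg:
  assumes eig: "\<And>k. integral_operator_eigenvalue \<mu> K k \<Longrightarrow> 0 \<le> k" and f: "bdd f"
  shows "0 \<le> (\<integral>x. f x * T f x \<partial>\<mu>)"
proof (rule ccontr)
  assume neg: "\<not> ?thesis"
  \<comment> \<open>Norm at most 1 instead of equal to 1 puts 0 into V, so V is nonempty and m \<le>
    0.\<close>
  define V where "V = {(\<integral>x. f x * T f x \<partial>\<mu>) | f. bdd f \<and> (\<integral>x. (f x)\<^sup>2 \<partial>\<mu>) \<le> 1}"
  define m where "m = Inf V"
  have V1: "v \<ge> - 1" if "v \<in> V" for v
    using that abs_form_le unfolding V_def by fastforce
  have V0: "0 \<in> V" unfolding V_def by (auto intro!: exI[of _ "\<lambda>_. 0"] bdd_const)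
  have bV: "bdd_below V" using V1 by (auto intro!: bdd_belowI)
  have m1: "- 1 \<le> m" unfolding m_def using V0 V1 by (intro cInf_greatest) auto
  have m0: "m \<le> 0" unfolding m_def by (rule cInf_lower[OF V0 bV])
  have form: "m * (\<integral>x. (f x)\<^sup>2 \<partial>\<mu>) \<le> (\<integral>x. f x * T f x \<partial>\<mu>)" if f: "bdd f" for f
  proof (cases "(\<integral>x. (f x)\<^sup>2 \<partial>\<mu>) = 0")
    case True
    thus ?thesis using abs_form_le[OF f] by simp
  next
    case False
    define s where "s = (\<integral>x. (f x)\<^sup>2 \<partial>\<mu>)"
    have s: "s > 0" using False by (auto simp: s_def less_le intro!: Bochner_Integration.integral_nonneg)
    define g where "g x = f x / sqrt s" for x
    have "T g x = T f x / sqrt s" for x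
      by (simp add: g_def integral_operator_def)
    hence "(\<integral>x. g x * T g x \<partial>\<mu>) = (\<integral>x. f x * T f x / s \<partial>\<mu>)"
      using s by (simp add: g_def)
    moreover have "(\<integral>x. (g x)\<^sup>2 \<partial>\<mu>) = 1" using s by (simp add: g_def power_divide s_def[symmetric])
    moreover have "bdd g" using bdd_cmult[OF f, of "1 / sqrt s"] by (simp add: g_def[abs_def])
    ultimately have "(\<integral>x. f x * T f x \<partial>\<mu>) / s \<in> V" by (auto simp: V_def intro!: exI[of _ g])
    hence "m \<le> (\<integral>x. f x * T f x \<partial>\<mu>) / s" unfolding m_def using bV by (rule cInf_lower)
    thus ?thesis using s by (simp add: s_def field_simps)
  qed
  have "m \<noteq> 0" using form[OF f] neg by auto
  with m0 have mneg: "m < 0" by simp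
  have "\<forall>k. \<exists>f. bdd f \<and> (\<integral>x. (f x)\<^sup>2 \<partial>\<mu>) \<le> 1 \<and> (\<integral>x. f x * T f x \<partial>\<mu>) < m + 1 / (real k + 1)"
  proof
    fix k :: nat
    have "Inf V < m + 1 / (real k + 1)" by (simp add: m_def)
    then obtain v where "v \<in> V" "v < m + 1 / (real k + 1)"
      using cInf_lessD[of V] V0 by blast
    thus "\<exists>f. bdd f \<and> (\<integral>x. (f x)\<^sup>2 \<partial>\<mu>) \<le> 1 \<and> (\<integral>x. f x * T f x \<partial>\<mu>) < m + 1 / (real k + 1)"
      by (auto simp: V_def)
  qed
  from choice[OF this] obtain F where F: "\<And>k. bdd (F k)" "\<And>k. (\<integral>x. (F k x)\<^sup>2 \<partial>\<mu>) \<le> 1"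
    "\<And>k. (\<integral>x. F k x * T (F k) x \<partial>\<mu>) < m + 1 / (real k + 1)"
    by blast
  have F1: "(\<integral>x. \<bar>F k x\<bar> \<partial>\<mu>) \<le> 1" for k
    using order.trans[OF integral_abs_power2_le[OF F(1)[of k]] F(2)[of k]]
    by (simp add: abs_square_le_1 abs_le_iff)
  obtain h r where hr: "continuous_on X h" "strict_mono (r :: nat \<Rightarrow> nat)"
    "\<And>e. 0 < e \<Longrightarrow> \<exists>N. \<forall>k x. k \<ge> N \<and> x \<in> X \<longrightarrow> norm (T (F (r k)) x - h x) < e"
  proof (rule Arzela_Ascoli[OF X, of "\<lambda>k. T (F k)" 1])
    show "norm (T (F k) x) \<le> 1" if "x \<in> X" for k x
      using abs_T_le[OF F(1) that, of k] F1[of k] by simp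
    show "\<exists>d>0. \<forall>k y. y \<in> X \<and> norm (x - y) < d \<longrightarrow> norm (T (F k) x - T (F k) y) < e"
      if x: "x \<in> X" and e: "e > 0" for x e
    proof -
      obtain d where d: "d > 0" "\<And>x y u v. x \<in> X \<Longrightarrow> y \<in> X \<Longrightarrow> u \<in> X \<Longrightarrow> v \<in> X \<Longrightarrow> dist x u < d \<Longrightarrow> dist y v < d
        \<Longrightarrow> \<bar>K x y - K u v\<bar> < e / 2"
        using K_equicontinuous[of "e / 2"] e by (meson half_gt_zero)
      have "norm (T (F k) x - T (F k) y) < e" if y: "y \<in> X" "norm (x - y) < d" for k y
      proof -
        have "\<bar>K x z - K y z\<bar> \<le> e / 2" if "z \<in> X" for z
          using d(2)[of x z y z] that y x d(1) by (simp add: dist_norm less_imp_le)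
        hence "\<bar>T (F k) x - T (F k) y\<bar> \<le> e / 2 * (\<integral>z. \<bar>F k z\<bar> \<partial>\<mu>)"
          using y x by (intro abs_T_diff_le F(1))
        also have "\<dots> \<le> e / 2 * 1" using F1[of k] e by (intro mult_left_mono) auto
        finally show ?thesis using e by simp
      qed
      thus ?thesis using d(1) by blast
    qed
  qed blast
  have h: "bdd h" by (rule bdd_continuous[OF hr(1)])
  define G where "G k x = T (F k) x - m * F k x" for k x
  have G: "bdd (G k)" for k unfolding G_def by (intro bdd_intros bdd_T F)
  have rk: "real k \<le> real (r k)" for k using seq_suble[OF hr(2)] by simp
  have G1: "(\<integral>x. \<bar>G (r k) x\<bar> \<partial>\<mu>) \<le> sqrt (2 / (real k + 1))" for k
  proof -
    have "(\<integral>x. (G (r k) x)\<^sup>2 \<partial>\<mu>) \<le> 2 * ((\<integral>x. F (r k) x * T (F (r k)) x \<partial>\<mu>) - m * (\<integral>x. (F (r k) x)\<^sup>2 \<partial>\<mu>))"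
      unfolding G_def by (rule residual_le[OF F(1) m1 m0 form])
    also have "\<dots> \<le> 2 * (m + 1 / (real (r k) + 1) - m)"
      using F(3)[of "r k"] mult_left_mono_neg[OF F(2)[of "r k"] m0] by simp
    also have "\<dots> \<le> 2 / (real k + 1)" using rk[of k] by (simp add: frac_le)
    finally have "(\<integral>x. \<bar>G (r k) x\<bar> \<partial>\<mu>)\<^sup>2 \<le> 2 / (real k + 1)"
      using integral_abs_power2_le[OF G] by (rule order.trans[rotated])
    thus ?thesis by (rule real_le_rsqrt)
  qed
  have conv: "(\<lambda>k. T (F (r k)) x) \<longlonglongrightarrow> h x" if "x \<in> X" for x
    using hr(3) that unfolding LIMSEQ_iff by blast
  have Th: "T h x = m * h x" if x: "x \<in> X" for x
  proof -
    have "(\<lambda>k. T (G (r k)) x) \<longlonglongrightarrow> 0"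
    proof (rule Lim_null_comparison[of _ "\<lambda>k. sqrt (2 / (real k + 1))"])
      show "\<forall>\<^sub>F k in sequentially. norm (T (G (r k)) x) \<le> sqrt (2 / (real k + 1))"
        using order.trans[OF abs_T_le[OF G x] G1] by simp
      have "(\<lambda>k. 2 / (real k + 1)) \<longlonglongrightarrow> 0"
        using tendsto_mult[OF tendsto_const[of "2::real"] LIMSEQ_inverse_real_of_nat]
        by (simp add: divide_inverse add.commute)
      thus "(\<lambda>k. sqrt (2 / (real k + 1))) \<longlonglongrightarrow> 0"
        using tendsto_real_sqrt by fastforce
    qed
    hence "(\<lambda>k. T (G (r k)) x + m * T (F (r k)) x) \<longlonglongrightarrow> 0 + m * h x"
      by (intro tendsto_intros conv x)
    moreover have "T (G (r k)) x + m * T (F (r k)) x = T (T (F (r k))) x" for k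
      using T_add_cmult[OF bdd_T[OF F(1)] F(1) x, of "r k" "- m" "r k"] by (simp add: G_def[abs_def])
    ultimately have lim1: "(\<lambda>k. T (T (F (r k))) x) \<longlonglongrightarrow> m * h x" by simp
    have "(\<lambda>k. T (T (F (r k))) x) \<longlonglongrightarrow> T h x"
      unfolding LIMSEQ_iff
    proof (intro allI impI)
      fix e :: real assume e: "e > 0"
      obtain N where N: "\<And>k y. k \<ge> N \<Longrightarrow> y \<in> X \<Longrightarrow> norm (T (F (r k)) y - h y) < e / 2"
        using hr(3)[of "e / 2"] e by (meson half_gt_zero)
      have "norm (T (T (F (r k))) x - T h x) < e" if k: "k \<ge> N" for k
      proof -
        have "T (T (F (r k))) x - T h x = T (\<lambda>y. T (F (r k)) y + (- 1) * h y) x"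
          by (subst T_add_cmult[OF bdd_T[OF F(1)] h x]) simp
        also have "\<bar>\<dots>\<bar> \<le> (\<integral>y. \<bar>T (F (r k)) y + (- 1) * h y\<bar> \<partial>\<mu>)"
          by (intro abs_T_le bdd_intros bdd_T F h x)
        also have "\<dots> \<le> (\<integral>y. e / 2 \<partial>\<mu>)"
          using N[OF k] by (intro integral_mono_X bdd_intros bdd_T F h) (simp add: less_imp_le)
        also have "\<dots> < e" using e by (simp add: prob_space)
        finally show ?thesis by simp
      qed
      thus "\<exists>N. \<forall>k\<ge>N. norm (T (T (F (r k))) x - T h x) < e" by blast
    qed
    with lim1 show ?thesis using LIMSEQ_unique by blast
  qed
  \<comment> \<open>If h vanished almost everywhere, T F would be below - m / 2 in modulus almost
    everywhere for a late F of norm at most 1, and its form would be at least m / 2. But the form of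
    a late F is below m - m / 2.\<close>
  have "\<not> (AE x in \<mu>. h x = 0)"
  proof
    assume ae: "AE x in \<mu>. h x = 0"
    obtain N where N: "\<And>k y. k \<ge> N \<Longrightarrow> y \<in> X \<Longrightarrow> norm (T (F (r k)) y - h y) < - m / 2"
      using hr(3)[of "- m / 2"] mneg by (metis divide_pos_pos neg_0_less_iff_less zero_less_numeral)
    obtain k0 where k0: "1 / (real k0 + 1) < - m / 2"
      using reals_Archimedean[of "- m / 2"] mneg by (auto simp: inverse_eq_divide add.commute)
    define k where "k = max N k0"
    let ?f = "F (r k)"
    have "- (\<integral>x. ?f x * T ?f x \<partial>\<mu>) \<le> \<bar>\<integral>x. ?f x * T ?f x \<partial>\<mu>\<bar>" by simp
    also have "\<dots> \<le> (\<integral>x. \<bar>?f x * T ?f x\<bar> \<partial>\<mu>)"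
      by (intro abs_integral_le bdd_intros bdd_T F)
    also have "\<dots> \<le> (\<integral>x. (- m / 2) * \<bar>?f x\<bar> + \<bar>h x\<bar> * \<bar>?f x\<bar> \<partial>\<mu>)"
    proof (intro integral_mono_X bdd_intros bdd_T F h)
      fix x assume "x \<in> X"
      hence "\<bar>T ?f x\<bar> \<le> - m / 2 + \<bar>h x\<bar>" using N[of k x] by (simp add: k_def)
      hence "\<bar>?f x\<bar> * \<bar>T ?f x\<bar> \<le> \<bar>?f x\<bar> * (- m / 2 + \<bar>h x\<bar>)" by (intro mult_left_mono) auto
      thus "\<bar>?f x * T ?f x\<bar> \<le> (- m / 2) * \<bar>?f x\<bar> + \<bar>h x\<bar> * \<bar>?f x\<bar>"
        by (simp add: abs_mult algebra_simps)
    qed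
    also have "\<dots> = (- m / 2) * (\<integral>x. \<bar>?f x\<bar> \<partial>\<mu>) + (\<integral>x. \<bar>h x\<bar> * \<bar>?f x\<bar> \<partial>\<mu>)"
      using F(1) h by (simp add: bdd_integrable bdd_intros)
    also have "(\<integral>x. \<bar>h x\<bar> * \<bar>?f x\<bar> \<partial>\<mu>) = 0"
      using ae by (intro integral_eq_zero_AE) auto
    also have "(- m / 2) * (\<integral>x. \<bar>?f x\<bar> \<partial>\<mu>) + 0 \<le> (- m / 2) * 1"
      using F1 mneg by (simp add: mult_left_le)
    finally have "m / 2 \<le> (\<integral>x. ?f x * T ?f x \<partial>\<mu>)" by simp
    also have "\<dots> < m + 1 / (real (r k) + 1)" by (rule F(3))
    also have "1 / (real (r k) + 1) \<le> 1 / (real k0 + 1)"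
      using rk[of k] by (intro divide_left_mono) (auto simp: k_def)
    finally show False using k0 by simp
  qed
  moreover have "square_integrable \<mu> h"
    using h bdd_integrable[OF bdd_power2[OF h]] by (simp add: square_integrable_def bdd_def)
  ultimately have "integral_operator_eigenvalue \<mu> K m"
    unfolding integral_operator_eigenvalue_def using Th by (intro exI[of _ h]) (auto intro!: AE_I2)
  with eig mneg show False by fastforce
qed

text \<open>At points of the support of \<mu> every ball has positive measure, so the matrix is the
  limit of the form at combinations of normalized indicators of small balls. One null set serves for
  all n, all points and all vectors.\<close>

lemma kernel_psd_ae:
  assumes eig: "\<And>k. integral_operator_eigenvalue \<mu> K k \<Longrightarrow> 0 \<le> k"
  shows "\<exists>N\<in>null_sets \<mu>. \<forall>(x :: nat \<Rightarrow> real ^ 'd) n v. (\<forall>i<n. x i \<in> X - N) \<longrightarrow> 0 \<le> (\<Sum>i<n. \<Sum>j<n. K (x i) (x j) * (v i * v j))"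
proof -
  obtain B :: "(real ^ 'd) set set" where B: "countable B" "topological_basis B"
    using ex_countable_basis by blast
  have BX: "b \<inter> X \<in> sets \<mu>" if "open b" for b
    unfolding sets_mu sets_restrict_space using that by (auto simp: image_iff intro!: bexI[of _ b])
  \<comment> \<open>The complement of the support in X; a countable base makes it a null
    set.\<close>
  define N where "N = (\<Union>b\<in>{b\<in>B. emeasure \<mu> (b \<inter> X) = 0}. b \<inter> X)"
  have "N \<in> null_sets \<mu>"
    unfolding N_def using B BX topological_basis_open[OF B(2)]
    by (intro null_sets_UN') (auto intro: countable_subset[OF _ B(1)])
  moreover have "\<forall>(x :: nat \<Rightarrow> real ^ 'd) n v. (\<forall>i<n. x i \<in> X - N) \<longrightarrow> 0 \<le> (\<Sum>i<n. \<Sum>j<n. K (x i) (x j) * (v i * v j))"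
  proof (intro allI impI)
    fix x :: "nat \<Rightarrow> real ^ 'd" and n :: nat and v :: "nat \<Rightarrow> real"
    assume x: "\<forall>i<n. x i \<in> X - N"
    define M where "M = (\<Sum>i<n. \<Sum>j<n. \<bar>v i * v j\<bar>)"
    have M: "M \<ge> 0" unfolding M_def by (intro sum_nonneg) auto
    have "- e \<le> (\<Sum>i<n. \<Sum>j<n. K (x i) (x j) * (v i * v j))" if e: "e > 0" for e
    proof -
      define e' where "e' = e / (M + 1)"
      have e': "e' > 0" using e M by (simp add: e'_def)
      obtain d where d: "d > 0" "\<And>x y u v. x \<in> X \<Longrightarrow> y \<in> X \<Longrightarrow> u \<in> X \<Longrightarrow> v \<in> X \<Longrightarrow> dist x u < d \<Longrightarrow> dist y v < d
        \<Longrightarrow> \<bar>K x y - K u v\<bar> < e'"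
        using K_equicontinuous[OF e'] by meson
      define b where "b i = ball (x i) d \<inter> X" for i
      define w where "w i = measure \<mu> (b i)" for i
      have b: "b i \<in> sets \<mu>" for i unfolding b_def by (intro BX open_ball)
      have w: "w i > 0" if i: "i < n" for i
      proof -
        obtain c where c: "c \<in> B" "x i \<in> c" "c \<subseteq> ball (x i) d"
          using topological_basisE[OF B(2) open_ball, of "x i" "x i" d] d(1) by auto
        have "emeasure \<mu> (c \<inter> X) \<noteq> 0" using x i c by (auto simp: N_def)
        moreover have "emeasure \<mu> (c \<inter> X) \<le> emeasure \<mu> (b i)"
          using c b by (intro emeasure_mono) (auto simp: b_def)
        ultimately have "measure \<mu> (c \<inter> X) \<noteq> 0" "measure \<mu> (c \<inter> X) \<le> w i"
          by (auto simp: emeasure_eq_measure w_def)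
        thus ?thesis using measure_nonneg[of \<mu> "c \<inter> X"] by linarith
      qed
      let ?I = "\<lambda>i. indicat_real (b i)"
      \<comment> \<open>A smoothed version of the point masses \<open>v i\<close> at
        \<open>x i\<close>. By uniform continuity its form differs from the matrix form by at most
        e' M \<le> e.\<close>
      define f where "f y = (\<Sum>i<n. v i / w i * ?I i y)" for y
      have f: "bdd f" unfolding f_def by (intro bdd_intros b)
      have Tf: "T f y = (\<Sum>j<n. v j / w j * T (?I j) y)" if "y \<in> X" for y
      proof -
        have "T f y = (\<integral>z. (\<Sum>j<n. v j / w j * (K y z * ?I j z)) \<partial>\<mu>)"
          unfolding integral_operator_def f_def sum_distrib_left by (simp add: mult_ac)
        also have "\<dots> = (\<Sum>j<n. \<integral>z. v j / w j * (K y z * ?I j z) \<partial>\<mu>)"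
          using that b by (intro Bochner_Integration.integral_sum bdd_integrable bdd_intros)
        finally show ?thesis by (simp add: integral_operator_def)
      qed
      have "0 \<le> (\<integral>y. f y * T f y \<partial>\<mu>)" by (rule form_nonneg[OF eig f])
      also have "\<dots> = (\<integral>y. (\<Sum>i<n. \<Sum>j<n. (v i / w i) * (v j / w j) * (?I i y * T (?I j) y)) \<partial>\<mu>)"
        by (intro Bochner_Integration.integral_cong refl) (simp add: Tf f_def sum_product mult_ac)
      also have "\<dots> = (\<Sum>i<n. \<integral>y. (\<Sum>j<n. (v i / w i) * (v j / w j) * (?I i y * T (?I j) y)) \<partial>\<mu>)"
        using b by (intro Bochner_Integration.integral_sum bdd_integrable bdd_intros bdd_T)
      also have "\<dots> = (\<Sum>i<n. \<Sum>j<n. \<integral>y. (v i / w i) * (v j / w j) * (?I i y * T (?I j) y) \<partial>\<mu>)"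
        using b by (intro sum.cong refl Bochner_Integration.integral_sum bdd_integrable bdd_intros bdd_T)
      also have "\<dots> = (\<Sum>i<n. \<Sum>j<n. v i * v j * ((\<integral>y. ?I i y * T (?I j) y \<partial>\<mu>) / (w i * w j)))"
        by (intro sum.cong refl) simp
      also have "\<dots> \<le> (\<Sum>i<n. \<Sum>j<n. K (x i) (x j) * (v i * v j) + e' * \<bar>v i * v j\<bar>)"
      proof (intro sum_mono)
        fix i j assume "i \<in> {..<n}" "j \<in> {..<n}"
        hence ij: "i < n" "j < n" by auto
        hence xX: "x i \<in> X" "x j \<in> X" using x by auto
        have "b i \<inter> X = b i" for i by (auto simp: b_def)
        hence Iw: "measure \<mu> (b i \<inter> X) = w i" for i by (simp add: w_def)
        have avg: "\<bar>K y z - K (x i) (x j)\<bar> \<le> e'" if "y \<in> b i" "z \<in> b j" for y z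
          using d(2)[of y z "x i" "x j"] that xX by (auto simp: b_def dist_commute less_imp_le)
        have Tup: "\<bar>T (?I j) y - K (x i) (x j) * w j\<bar> \<le> e' * w j" if y: "y \<in> b i" for y
        proof -
          have yX: "y \<in> X" using y by (simp add: b_def)
          have "T (?I j) y - K (x i) (x j) * w j = (\<integral>z. (K y z - K (x i) (x j)) * ?I j z \<partial>\<mu>)"
            using yX b by (simp add: integral_operator_def left_diff_distrib bdd_integrable bdd_intros Iw)
          also have "\<bar>\<dots>\<bar> \<le> (\<integral>z. \<bar>(K y z - K (x i) (x j)) * ?I j z\<bar> \<partial>\<mu>)"
            using yX b by (intro abs_integral_le bdd_intros)
          also have "\<dots> \<le> (\<integral>z. e' * ?I j z \<partial>\<mu>)"
            using yX b avg[OF y] by (intro integral_mono_X bdd_intros) (auto simp: indicator_def)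
          finally show ?thesis using b by (simp add: Iw)
        qed
        define a where "a = (\<integral>y. ?I i y * T (?I j) y \<partial>\<mu>)"
        have "a - K (x i) (x j) * w j * w i = (\<integral>y. ?I i y * (T (?I j) y - K (x i) (x j) * w j) \<partial>\<mu>)"
          using b by (simp add: a_def right_diff_distrib bdd_integrable bdd_intros bdd_T Iw)
        also have "\<bar>\<dots>\<bar> \<le> (\<integral>y. \<bar>?I i y * (T (?I j) y - K (x i) (x j) * w j)\<bar> \<partial>\<mu>)"
          using b by (intro abs_integral_le bdd_intros bdd_T)
        also have "\<dots> \<le> (\<integral>y. e' * w j * ?I i y \<partial>\<mu>)"
          using b Tup by (intro integral_mono_X bdd_intros bdd_T) (auto simp: indicator_def)
        finally have "\<bar>a - K (x i) (x j) * w j * w i\<bar> \<le> e' * w j * w i" using b by (simp add: Iw)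
        hence "\<bar>a / (w i * w j) - K (x i) (x j)\<bar> \<le> e'"
          using w[OF ij(1)] w[OF ij(2)] by (simp add: abs_le_iff field_simps)
        hence "\<bar>v i * v j\<bar> * \<bar>a / (w i * w j) - K (x i) (x j)\<bar> \<le> \<bar>v i * v j\<bar> * e'"
          by (intro mult_left_mono) auto
        hence "\<bar>v i * v j * (a / (w i * w j) - K (x i) (x j))\<bar> \<le> e' * \<bar>v i * v j\<bar>"
          by (simp add: abs_mult mult_ac)
        thus "v i * v j * ((\<integral>y. ?I i y * T (?I j) y \<partial>\<mu>) / (w i * w j)) \<le> K (x i) (x j) * (v i * v j) + e' * \<bar>v i * v j\<bar>"
          unfolding a_def[symmetric] by (simp add: algebra_simps abs_le_iff)
      qed
      also have "\<dots> = (\<Sum>i<n. \<Sum>j<n. K (x i) (x j) * (v i * v j)) + e' * M"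
        by (simp add: sum.distrib M_def sum_distrib_left)
      finally have "- (e' * M) \<le> (\<Sum>i<n. \<Sum>j<n. K (x i) (x j) * (v i * v j))" by simp
      moreover have "e' * M \<le> e" using e M by (simp add: e'_def field_simps)
      ultimately show ?thesis by linarith
    qed
    note approx = this
    show "0 \<le> (\<Sum>i<n. \<Sum>j<n. K (x i) (x j) * (v i * v j))"
    proof (rule field_le_epsilon)
      fix e :: real assume "e > 0"
      thus "0 \<le> (\<Sum>i<n. \<Sum>j<n. K (x i) (x j) * (v i * v j)) + e" using approx[of e] by linarith
    qed
  qed
  ultimately show ?thesis by blast
qed

end

subsection \<open>Thresholding a perturbed matrix\<close>

definition ent :: "real mat \<Rightarrow> nat \<Rightarrow> nat \<Rightarrow> real" where
  "ent M r s = M $$ (r, s)"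

text \<open>Expressed through \<open>L2_set\<close>, from which the triangle inequality is
  inherited.\<close>

definition fro :: "nat \<Rightarrow> (nat \<Rightarrow> nat \<Rightarrow> real) \<Rightarrow> real" where
  "fro n W = L2_set (\<lambda>(r, s). W r s) ({..<n} \<times> {..<n})"

lemma frobenius_norm_eq_fro: "M \<in> carrier_mat n n \<Longrightarrow> frobenius_norm M = fro n (ent M)"
  by (simp add: frobenius_norm_def fro_def L2_set_def ent_def sum.cartesian_product case_prod_beta')

lemma fro_power2: "(fro n W)\<^sup>2 = (\<Sum>r<n. \<Sum>s<n. (W r s)\<^sup>2)"
  by (simp add: fro_def L2_set_def sum.cartesian_product case_prod_beta' sum_nonneg)

lemma fro_nonneg: "0 \<le> fro n W"
  by (simp add: fro_def L2_set_nonneg)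

lemma fro_cong: "(\<And>r s. r < n \<Longrightarrow> s < n \<Longrightarrow> V r s = W r s) \<Longrightarrow> fro n V = fro n W"
  unfolding fro_def by (intro L2_set_cong) auto

lemma fro_triangle: "fro n (\<lambda>r s. V r s + W r s) \<le> fro n V + fro n W"
  using L2_set_triangle_ineq[of "\<lambda>(r, s). V r s" "\<lambda>(r, s). W r s" "{..<n} \<times> {..<n}"]
  by (simp add: fro_def case_prod_beta')

lemma fro_cmult: "fro n (\<lambda>r s. c * W r s) = \<bar>c\<bar> * fro n W"
  unfolding fro_def L2_set_def
  by (simp add: case_prod_beta' power_mult_distrib real_sqrt_mult flip: sum_distrib_left)

text \<open>The Frobenius inner product in an eigenbasis of W: D enters only through its quadratic
  form, so an operator norm bound on D applies.\<close>

lemma spectral_inner: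
  assumes "spectral n W l u"
  shows "(\<Sum>r<n. \<Sum>s<n. D r s * W r s) = (\<Sum>i<n. l i * quad n D (u i))"
proof -
  have "(\<Sum>r<n. \<Sum>s<n. D r s * W r s) = (\<Sum>r<n. \<Sum>s<n. \<Sum>i<n. D r s * (l i * (u i r * u i s)))"
    using assms by (simp add: spectral_def sum_distrib_left)
  also have "\<dots> = (\<Sum>r<n. \<Sum>i<n. \<Sum>s<n. D r s * (l i * (u i r * u i s)))"
    by (intro sum.cong refl sum.swap)
  also have "\<dots> = (\<Sum>i<n. \<Sum>r<n. \<Sum>s<n. D r s * (l i * (u i r * u i s)))"
    by (rule sum.swap)
  finally show ?thesis by (simp add: quad_def sum_distrib_left mult_ac)
qed

lemma spectral_id:
  assumes "spectral n W l u"
  shows "spectral n (\<lambda>r s. of_bool (r = s)) (\<lambda>_. 1) u"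
  using assms by (simp add: spectral_def)

lemma sum_diag: "(\<Sum>r<n. \<Sum>s<n. D r s * of_bool (r = s)) = (\<Sum>r<n. D r r)" for D :: "nat \<Rightarrow> nat \<Rightarrow> real"
  by (intro sum.cong refl) (simp add: of_bool_def if_distrib cong: if_cong)

lemma spectral_sum_quad:
  assumes "spectral n W l u"
  shows "(\<Sum>i<n. quad n D (u i)) = (\<Sum>r<n. D r r)"
  using spectral_inner[OF spectral_id[OF assms], of D] by (simp add: sum_diag)

lemma spectral_trace:
  assumes "spectral n W l u"
  shows "(\<Sum>r<n. W r r) = (\<Sum>i<n. l i)"
  using spectral_sum_quad[OF assms, of W] spectral_quad_eigenvector[OF assms] by simp

lemma spectral_affine:
  assumes "spectral n W l u"
  shows "spectral n (\<lambda>r s. a * W r s + b * of_bool (r = s)) (\<lambda>i. a * l i + b) u"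
proof -
  have "a * W r s + b * of_bool (r = s) = (\<Sum>i<n. (a * l i + b) * (u i r * u i s))" if "r < n" "s < n" for r s
  proof -
    have "W r s = (\<Sum>i<n. l i * (u i r * u i s))" "of_bool (r = s) = (\<Sum>i<n. u i r * u i s)"
      using assms that by (auto simp: spectral_def)
    thus ?thesis by (simp only: sum_distrib_left distrib_right sum.distrib mult.assoc)
  qed
  thus ?thesis using assms by (simp add: spectral_def)
qed

text \<open>Links \<open>lambda_max\<close> with the family l. The coordinates of an eigenvector
  satisfy k c_i = l_i c_i, and by Parseval they do not all vanish.\<close>

lemma spectral_eigenvalues:
  assumes sp: "spectral n (ent M) l u" and M: "M \<in> carrier_mat n n"
  shows "{k. eigenvalue M k} = l ` {..<n}"
proof (intro subset_antisym subsetI)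
  fix k assume "k \<in> {k. eigenvalue M k}"
  then obtain v where v: "v \<in> carrier_vec n" "v \<noteq> 0\<^sub>v n" "M *\<^sub>v v = k \<cdot>\<^sub>v v"
    using M by (auto simp: eigenvalue_def eigenvector_def)
  let ?v = "vec_index v"
  have row: "(\<Sum>s<n. ent M r s * ?v s) = k * ?v r" if "r < n" for r
  proof -
    have "vec_index (M *\<^sub>v v) r = (\<Sum>s<n. ent M r s * ?v s)"
      using that v(1) M by (auto simp: scalar_prod_def lessThan_atLeast0 ent_def intro!: sum.cong)
    thus ?thesis using v(1,3) that by simp
  qed
  define c where "c i = (\<Sum>r<n. u i r * ?v r)" for i
  have eq: "k * c i = l i * c i" if i: "i < n" for i
  proof -
    have uW: "(\<Sum>r<n. u i r * ent M r s) = l i * u i s" if s: "s < n" for s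
    proof -
      have "(\<Sum>r<n. u i r * ent M r s) = (\<Sum>r<n. \<Sum>j<n. u i r * (l j * (u j r * u j s)))"
        using sp s by (simp add: spectral_def sum_distrib_left)
      also have "\<dots> = (\<Sum>j<n. \<Sum>r<n. u i r * (l j * (u j r * u j s)))" by (rule sum.swap)
      also have "\<dots> = (\<Sum>j<n. l j * u j s * (\<Sum>r<n. u i r * u j r))"
        by (simp add: sum_distrib_left mult_ac)
      also have "\<dots> = (\<Sum>j<n. l j * u j s * of_bool (i = j))"
        using sp i by (simp add: spectral_def)
      also have "\<dots> = l i * u i s" using i by (simp add: of_bool_def if_distrib cong: if_cong)
      finally show ?thesis .
    qed
    have "k * c i = (\<Sum>r<n. u i r * (k * ?v r))" by (simp add: c_def sum_distrib_left mult_ac)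
    also have "\<dots> = (\<Sum>r<n. \<Sum>s<n. u i r * (ent M r s * ?v s))"
      using row by (simp add: sum_distrib_left[symmetric])
    also have "\<dots> = (\<Sum>s<n. \<Sum>r<n. u i r * (ent M r s * ?v s))" by (rule sum.swap)
    also have "\<dots> = (\<Sum>s<n. (\<Sum>r<n. u i r * ent M r s) * ?v s)" unfolding sum_distrib_right by (simp add: mult_ac)
    also have "\<dots> = l i * c i" by (simp add: uW c_def sum_distrib_left mult_ac)
    finally show ?thesis .
  qed
  show "k \<in> l ` {..<n}"
  proof (rule ccontr)
    assume "k \<notin> l ` {..<n}"
    hence "c i = 0" if "i < n" for i using eq[OF that] that by auto
    hence "(\<Sum>r<n. (?v r)\<^sup>2) = 0" using spectral_parseval[OF sp, of ?v] by (simp add: c_def)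
    hence "?v r = 0" if "r < n" for r using that by (subst (asm) sum_nonneg_eq_0_iff) auto
    hence "v = 0\<^sub>v n" using v(1) by (intro eq_vecI) auto
    thus False using v(2) by simp
  qed
next
  fix k assume "k \<in> l ` {..<n}"
  then obtain i where i: "i < n" "k = l i" by auto
  let ?v = "vec n (u i)"
  have "?v \<noteq> 0\<^sub>v n"
  proof
    assume "?v = 0\<^sub>v n"
    hence "u i r = 0" if "r < n" for r using that by (metis index_vec index_zero_vec(1))
    thus False using spectral_norm_eigenvector[OF sp i(1)] by simp
  qed
  moreover have "M *\<^sub>v ?v = k \<cdot>\<^sub>v ?v"
  proof (rule eq_vecI)
    fix r assume "r < dim_vec (k \<cdot>\<^sub>v ?v)"
    hence r: "r < n" by simp
    have "vec_index (M *\<^sub>v ?v) r = (\<Sum>s<n. ent M r s * u i s)"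
      using r M by (auto simp: scalar_prod_def lessThan_atLeast0 ent_def intro!: sum.cong)
    also have "\<dots> = (\<Sum>s<n. \<Sum>j<n. l j * (u j r * u j s) * u i s)"
      using sp r by (simp add: spectral_def sum_distrib_right)
    also have "\<dots> = (\<Sum>j<n. \<Sum>s<n. l j * (u j r * u j s) * u i s)" by (rule sum.swap)
    also have "\<dots> = (\<Sum>j<n. l j * u j r * (\<Sum>s<n. u j s * u i s))"
      by (simp add: sum_distrib_left mult_ac)
    also have "\<dots> = (\<Sum>j<n. l j * u j r * of_bool (j = i))"
      using sp i by (simp add: spectral_def)
    also have "\<dots> = k * u i r" using i by (simp add: of_bool_def if_distrib cong: if_cong)
    finally show "vec_index (M *\<^sub>v ?v) r = vec_index (k \<cdot>\<^sub>v ?v) r" using r by simp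
  qed (use M in auto)
  ultimately show "k \<in> {k. eigenvalue M k}"
    using M by (auto simp: eigenvalue_def eigenvector_def intro!: exI[of _ ?v])
qed

lemma eigendecomposition_spectral:
  assumes A: "A \<in> carrier_mat n n" and e: "eigendecomposition A l u"
  shows "spectral n (ent A) l (\<lambda>i. vec_index (u i))"
proof -
  have u: "\<And>i. i < n \<Longrightarrow> u i \<in> carrier_vec n"
    "\<And>i j. i < n \<Longrightarrow> j < n \<Longrightarrow> scalar_prod (u i) (u j) = (if i = j then 1 else 0)"
    "A = rank_one_sum n {..<n} l u"
    using e A by (auto simp: eigendecomposition_def Let_def)
  have row: "(\<Sum>r<n. vec_index (u i) r * vec_index (u j) r) = of_bool (i = j)" if "i < n" "j < n" for i j
    using u(2)[OF that] u(1)[OF that(2)] by (simp add: scalar_prod_def lessThan_atLeast0)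
  define Q where "Q = mat n n (\<lambda>(i, r). vec_index (u i) r)"
  have "Q * Q\<^sup>T = 1\<^sub>m n"
    using row by (intro eq_matI) (auto simp: Q_def scalar_prod_def lessThan_atLeast0)
  hence Q: "Q\<^sup>T * Q = 1\<^sub>m n"
    by (intro mat_mult_left_right_inverse[of Q n "Q\<^sup>T"]) (auto simp: Q_def)
  have "(\<Sum>i<n. vec_index (u i) r * vec_index (u i) s) = of_bool (r = s)" if "r < n" "s < n" for r s
    using arg_cong[OF Q, of "\<lambda>X. X $$ (r, s)"] that by (simp add: Q_def scalar_prod_def lessThan_atLeast0)
  thus ?thesis using row unfolding spectral_def by (subst ent_def, subst u(3)) (simp add: rank_one_sum_def)
qed

lemma eigendecomposition_exists:
  assumes A: "A \<in> carrier_mat n n" and sym: "\<And>i j. i < n \<Longrightarrow> j < n \<Longrightarrow> ent A i j = ent A j i"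
  shows "\<exists>l u. eigendecomposition A l u"
proof -
  obtain l u where sp: "spectral n (ent A) l u" using spectral_exists[of n "ent A"] sym by blast
  have "eigendecomposition A l (\<lambda>i. vec n (u i))"
    unfolding eigendecomposition_def Let_def
  proof (intro conjI allI impI)
    show "A = rank_one_sum (dim_row A) {..<dim_row A} l (\<lambda>i. vec n (u i))"
      using A sp by (intro eq_matI) (auto simp: rank_one_sum_def spectral_def ent_def)
  qed (use A sp in \<open>auto simp: spectral_def scalar_prod_def lessThan_atLeast0\<close>)
  thus ?thesis by blast
qed

text \<open>Whichever eigendecomposition the choice operator returns, the matrix and its
  thresholding are diagonal in the same basis.\<close>

lemma usvt_tilde_spectral:
  assumes A: "A \<in> carrier_mat n n" and sym: "\<And>i j. i < n \<Longrightarrow> j < n \<Longrightarrow> ent A i j = ent A j i"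
  shows "usvt_tilde \<alpha> \<gamma> A \<in> carrier_mat n n \<and> (\<exists>l u. spectral n (ent A) l u \<and>
    spectral n (ent (usvt_tilde \<alpha> \<gamma> A)) (\<lambda>i. if \<gamma> \<le> l i then l i / \<alpha> else 0) u)"
proof -
  obtain l u where lu: "(SOME (l, u). eigendecomposition A l u) = (l, u)" by fastforce
  have "\<exists>p. (\<lambda>(l, u). eigendecomposition A l u) p"
    using eigendecomposition_exists[OF A sym] by auto
  from someI_ex[OF this] have e: "eigendecomposition A l u" unfolding lu by simp
  note sp = eigendecomposition_spectral[OF A e]
  have T: "usvt_tilde \<alpha> \<gamma> A = (1 / \<alpha>) \<cdot>\<^sub>m rank_one_sum n {i. i < n \<and> \<gamma> \<le> l i} l u"
    using A by (simp add: usvt_tilde_def lu)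
  have "spectral n (ent (usvt_tilde \<alpha> \<gamma> A)) (\<lambda>i. if \<gamma> \<le> l i then l i / \<alpha> else 0) (\<lambda>i. vec_index (u i))"
  proof -
    have "ent (usvt_tilde \<alpha> \<gamma> A) r s = (\<Sum>i<n. (if \<gamma> \<le> l i then l i / \<alpha> else 0) * (vec_index (u i) r * vec_index (u i) s))"
      if "r < n" "s < n" for r s
    proof -
      have "ent (usvt_tilde \<alpha> \<gamma> A) r s =
        (\<Sum>i\<in>{i. i < n \<and> \<gamma> \<le> l i}. l i / \<alpha> * (vec_index (u i) r * vec_index (u i) s))"
        using that by (simp add: T ent_def rank_one_sum_def sum_divide_distrib)
      also have "\<dots> = (\<Sum>i<n. (if \<gamma> \<le> l i then l i / \<alpha> else 0) * (vec_index (u i) r * vec_index (u i) s))"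
        by (rule sum.mono_neutral_cong_left) auto
      finally show ?thesis .
    qed
    thus ?thesis using sp by (simp add: spectral_def)
  qed
  moreover have "usvt_tilde \<alpha> \<gamma> A \<in> carrier_mat n n" by (simp add: T rank_one_sum_def)
  ultimately show ?thesis using sp by blast
qed

lemma quad_cmult: "quad n (\<lambda>r s. c * W r s) v = c * quad n W v"
  by (simp add: quad_def sum_distrib_left mult_ac)

lemma quad_diff: "quad n (\<lambda>r s. V r s - W r s) v = quad n V v - quad n W v"
  by (simp add: quad_def sum_subtractf left_diff_distrib)

text \<open>All matrices built from \<open>A\<close> share its eigenvectors, so that everything reduces to scalar
  estimates for the eigenvalues \<open>t i\<close> of the thresholded matrix.\<close>
lemma usvt_kernel_error:
  fixes G :: "nat \<Rightarrow> nat \<Rightarrow> real" and \<alpha> \<gamma> \<kappa> c \<delta> :: real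
  assumes n: "n > 0" and \<alpha>: "0 < \<alpha>" and c: "0 \<le> c" "c \<le> 1" and \<kappa>: "0 \<le> \<kappa>" "2 * \<kappa> \<le> \<gamma>" "0 < \<gamma>"
    and A: "A \<in> carrier_mat n n" "\<And>i j. i < n \<Longrightarrow> j < n \<Longrightarrow> ent A i j = ent A j i"
    and G: "\<And>i j. i < n \<Longrightarrow> j < n \<Longrightarrow> G i j = G j i" "\<And>i j. i < n \<Longrightarrow> j < n \<Longrightarrow> G i j \<in> {0..1}"
      "\<And>i. i < n \<Longrightarrow> G i i = c" "\<And>v. 0 \<le> quad n G v"
    and near: "\<And>v. \<bar>quad n (\<lambda>r s. ent A r s - \<alpha> * G r s) v\<bar> \<le> \<kappa> * (\<Sum>r<n. (v r)\<^sup>2)"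
    and \<delta>: "\<kappa> / (\<alpha> * n) + 1 / n \<le> \<delta>" "1 / (\<alpha> * n) powr (1 / 4) \<le> \<delta>"
    and \<Phi>: "\<Phi> = sqrt (5 * \<gamma> / (\<alpha> * n)) + 1 / sqrt n"
  defines "Kn \<equiv> usvt_kernel c \<alpha> \<gamma> A"
  shows "Kn \<in> carrier_mat n n" "fro n (\<lambda>r s. ent Kn r s - G r s) / n \<le> \<delta> * (\<Phi> + 1) + \<Phi>"
    "\<bar>mat_trace Kn / n - c\<bar> \<le> 2 * \<kappa> / \<gamma> + 2 * \<delta>"
proof -
  define T where "T = usvt_tilde \<alpha> \<gamma> A"
  obtain l u where T: "T \<in> carrier_mat n n" and spA: "spectral n (ent A) l u"
    and spT: "spectral n (ent T) (\<lambda>i. if \<gamma> \<le> l i then l i / \<alpha> else 0) u"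
    using usvt_tilde_spectral[OF A] unfolding T_def by blast
  define t where "t i = (if \<gamma> \<le> l i then l i / \<alpha> else 0)" for i
  note spT = spT[folded t_def]
  define k where "k i = quad n G (u i)" for i
  have unit: "(\<Sum>r<n. (u i r)\<^sup>2) = 1" if "i < n" for i by (rule spectral_norm_eigenvector[OF spA that])
  have k0: "0 \<le> k i" for i unfolding k_def by (rule G(4))
  have trG: "(\<Sum>r<n. G r r) = n * c" using G(3) by simp
  have ksum: "(\<Sum>i<n. k i) = n * c" unfolding k_def spectral_sum_quad[OF spA] trG ..
  have lk: "\<bar>l i - \<alpha> * k i\<bar> \<le> \<kappa>" if "i < n" for i
    using near[of "u i"] unit[OF that] spectral_quad_eigenvector[OF spA that]
    by (simp add: quad_diff quad_cmult k_def)
  have t0: "0 \<le> t i" for i using \<kappa> \<alpha> by (simp add: t_def)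
  \<comment> \<open>For an eigenvalue that is kept, the noise is at most x l_i with x = \<kappa> /
    \<gamma> \<le> 1/2, and 1 / (1 - x) \<le> 1 + 2 x. The bound has to be relative: it is summed to
    control the trace, where n additive errors \<kappa> / \<alpha> would be far too large.\<close>
  have tk: "t i \<le> (1 + 2 * \<kappa> / \<gamma>) * k i" if i: "i < n" for i
  proof (cases "\<gamma> \<le> l i")
    case True
    define x where "x = \<kappa> / \<gamma>"
    have x: "0 \<le> x" "x \<le> 1 / 2" using \<kappa> by (auto simp: x_def field_simps)
    have "\<kappa> \<le> x * l i" using True \<kappa> mult_left_mono[OF True, of \<kappa>] by (simp add: x_def field_simps)
    hence "l i * (1 - x) \<le> \<alpha> * k i" using lk[OF i] by (simp add: algebra_simps abs_le_iff)
    moreover have "1 \<le> (1 - x) * (1 + 2 * x)"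
      using x mult_left_mono[of x "1/2" x] by (simp add: algebra_simps)
    hence "l i * 1 \<le> l i * ((1 - x) * (1 + 2 * x))" using True \<kappa> by (intro mult_left_mono) auto
    moreover have "(l i * (1 - x)) * (1 + 2 * x) \<le> (\<alpha> * k i) * (1 + 2 * x)"
      using \<open>l i * (1 - x) \<le> \<alpha> * k i\<close> x by (intro mult_right_mono) auto
    ultimately have "l i \<le> \<alpha> * k i * (1 + 2 * x)" by (simp add: mult.assoc)
    thus ?thesis using True \<alpha> by (simp add: t_def x_def field_simps)
  qed (use k0 \<kappa> in \<open>simp add: t_def\<close>)
  \<comment> \<open>The additive form serves for the largest eigenvalue, where \<kappa> / \<alpha>
    is compared with n.\<close>
  have tk': "t i \<le> k i + \<kappa> / \<alpha>" if i: "i < n" for i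
    using lk[OF i] k0[of i] \<alpha> \<kappa> by (auto simp: t_def field_simps abs_le_iff)
  define \<tau> where "\<tau> = (\<Sum>i<n. t i) / n"
  have \<tau>0: "0 \<le> \<tau>" using t0 by (simp add: \<tau>_def sum_nonneg)
  have \<tau>1: "\<tau> \<le> c + 2 * \<kappa> / \<gamma>"
  proof -
    have "(\<Sum>i<n. t i) \<le> (1 + 2 * \<kappa> / \<gamma>) * (n * c)"
      unfolding ksum[symmetric] sum_distrib_left using tk by (intro sum_mono) auto
    hence "\<tau> \<le> (1 + 2 * \<kappa> / \<gamma>) * c" using n by (simp add: \<tau>_def field_simps)
    also have "\<dots> = c + 2 * \<kappa> / \<gamma> * c" by (simp add: algebra_simps)
    also have "2 * \<kappa> / \<gamma> * c \<le> 2 * \<kappa> / \<gamma> * 1" using c \<kappa> by (intro mult_left_mono) auto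
    finally show ?thesis by simp
  qed
  have \<kappa>\<gamma>: "2 * \<kappa> / \<gamma> \<le> 1" using \<kappa> by simp
  let ?D = "\<lambda>r s. ent T r s - G r s"
  define \<eta> where "\<eta> = (\<gamma> + \<kappa>) / \<alpha>"
  have \<eta>0: "0 \<le> \<eta>" using \<kappa> \<alpha> by (simp add: \<eta>_def)
  \<comment> \<open>The discarded eigenvalues lie below \<gamma> by the threshold and above -
    \<kappa> because G is positive semidefinite, so dropping them costs at most \<gamma>.\<close>
  have op: "\<bar>quad n ?D v\<bar> \<le> \<eta> * (\<Sum>r<n. (v r)\<^sup>2)" for v
  proof -
    have "\<bar>\<alpha> * quad n (ent T) v - quad n (ent A) v\<bar> \<le> \<gamma> * (\<Sum>r<n. (v r)\<^sup>2)"
    proof -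
      have "\<alpha> * quad n (ent T) v - quad n (ent A) v = (\<Sum>i<n. (\<alpha> * t i - l i) * (\<Sum>r<n. u i r * v r)\<^sup>2)"
        unfolding spectral_quad[OF spT] spectral_quad[OF spA]
        by (simp add: sum_distrib_left sum_subtractf left_diff_distrib mult.assoc)
      also have "\<bar>\<dots>\<bar> \<le> (\<Sum>i<n. \<bar>\<alpha> * t i - l i\<bar> * (\<Sum>r<n. u i r * v r)\<^sup>2)"
        by (rule order.trans[OF sum_abs]) (simp add: abs_mult)
      also have "\<dots> \<le> (\<Sum>i<n. \<gamma> * (\<Sum>r<n. u i r * v r)\<^sup>2)"
      proof (intro sum_mono mult_right_mono)
        fix i assume "i \<in> {..<n}"
        moreover have "0 \<le> \<alpha> * k i" using k0[of i] \<alpha> by simp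
        ultimately have "- \<kappa> \<le> l i" using lk[of i] by (simp add: abs_le_iff)
        thus "\<bar>\<alpha> * t i - l i\<bar> \<le> \<gamma>" using \<alpha> \<kappa> by (auto simp: t_def)
      qed auto
      also have "\<dots> = \<gamma> * (\<Sum>r<n. (v r)\<^sup>2)"
        by (simp add: spectral_parseval[OF spA] flip: sum_distrib_left)
      finally show ?thesis .
    qed
    moreover have "\<bar>quad n (ent A) v - \<alpha> * quad n G v\<bar> \<le> \<kappa> * (\<Sum>r<n. (v r)\<^sup>2)"
      using near[of v] by (simp add: quad_diff quad_cmult)
    ultimately have "\<bar>\<alpha> * (quad n (ent T) v - quad n G v)\<bar> \<le> (\<gamma> + \<kappa>) * (\<Sum>r<n. (v r)\<^sup>2)"
      by (simp add: algebra_simps abs_le_iff)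
    hence "\<alpha> * \<bar>quad n ?D v\<bar> \<le> (\<gamma> + \<kappa>) * (\<Sum>r<n. (v r)\<^sup>2)"
      using \<alpha> by (simp add: quad_diff abs_mult)
    thus ?thesis using \<alpha> by (simp add: \<eta>_def field_simps)
  qed
  \<comment> \<open>The square norm of D = T - G is the difference of the inner products of D with T
    and with G, each expanded in its own eigenbasis with nonnegative eigenvalues. The bounds 3/2
    \<gamma> / \<alpha> for the operator norm and 3 n for the two traces give 9/2, rounded up to
    5.\<close>
  have froD: "fro n ?D / n \<le> sqrt (5 * \<gamma> / (\<alpha> * n))"
  proof -
    obtain m w where spG: "spectral n G m w" using spectral_exists[of n G] G(1) by blast
    have m: "0 \<le> m j" if "j < n" for j using spectral_quad_eigenvector[OF spG that] G(4)[of "w j"] by simp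
    have opu: "quad n ?D (u i) \<le> \<eta>" if "i < n" for i
      using op[of "u i"] unit[OF that] by (simp add: abs_le_iff)
    have opw: "- quad n ?D (w j) \<le> \<eta>" if "j < n" for j
      using op[of "w j"] spectral_norm_eigenvector[OF spG that] by (simp add: abs_le_iff)
    have "(fro n ?D)\<^sup>2 = (\<Sum>r<n. \<Sum>s<n. ?D r s * ent T r s) - (\<Sum>r<n. \<Sum>s<n. ?D r s * G r s)"
      unfolding fro_power2 sum_subtractf[symmetric]
      by (simp add: power2_eq_square algebra_simps)
    also have "\<dots> = (\<Sum>i<n. t i * quad n ?D (u i)) - (\<Sum>j<n. m j * quad n ?D (w j))"
      unfolding spectral_inner[OF spT] spectral_inner[OF spG] ..
    also have "\<dots> \<le> (\<Sum>i<n. t i * \<eta>) + (\<Sum>j<n. m j * \<eta>)"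
    proof -
      have "(\<Sum>i<n. t i * quad n ?D (u i)) \<le> (\<Sum>i<n. t i * \<eta>)"
        using opu t0 by (intro sum_mono mult_left_mono) auto
      moreover have "(\<Sum>j<n. m j * - quad n ?D (w j)) \<le> (\<Sum>j<n. m j * \<eta>)"
        using opw m by (intro sum_mono mult_left_mono) auto
      ultimately show ?thesis by (simp add: sum_negf)
    qed
    also have "\<dots> = \<eta> * (n * \<tau> + n * c)"
      using spectral_trace[OF spG] trG n by (simp add: \<tau>_def algebra_simps flip: sum_distrib_left sum_distrib_right)
    also have "\<dots> \<le> (3 / 2 * \<gamma> / \<alpha>) * (n * 3)"
    proof (intro mult_mono)
      show "\<eta> \<le> 3 / 2 * \<gamma> / \<alpha>" using \<kappa> \<alpha> by (simp add: \<eta>_def field_simps)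
      have "\<tau> + c \<le> 3" using \<tau>1 \<kappa>\<gamma> c by simp
      hence "real n * (\<tau> + c) \<le> real n * 3" by (intro mult_left_mono) auto
      thus "n * \<tau> + n * c \<le> n * 3" by (simp add: algebra_simps)
    qed (use \<kappa> \<alpha> \<tau>0 c in auto)
    finally have "(fro n ?D)\<^sup>2 \<le> 9 / 2 * (\<gamma> * n / \<alpha>)" by simp
    hence "(fro n ?D / n)\<^sup>2 \<le> 9 / 2 * (\<gamma> * n / \<alpha>) / (real n)\<^sup>2"
      unfolding power_divide by (intro divide_right_mono) auto
    also have "\<dots> = 9 / 2 * (\<gamma> / (\<alpha> * n))" using n \<alpha> by (simp add: power2_eq_square field_simps)
    also have "\<dots> \<le> 5 * \<gamma> / (\<alpha> * n)" using \<kappa> \<alpha> n by (simp add: field_simps)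
    finally show ?thesis by (rule real_le_rsqrt)
  qed
  define s where "s = max (c - \<tau>) 0"
  have s: "0 \<le> s" "s \<le> 1" using c \<tau>0 by (auto simp: s_def)
  have trT: "mat_trace T = n * \<tau>"
    using spectral_trace[OF spT] T n by (simp add: mat_trace_def ent_def \<tau>_def)
  define Ab where "Ab = usvt_bar c \<alpha> \<gamma> A"
  have Ab: "Ab = T + s \<cdot>\<^sub>m 1\<^sub>m n"
    using A(1) n by (simp add: Ab_def usvt_bar_def Let_def T_def[symmetric] trT s_def)
  have AbC: "Ab \<in> carrier_mat n n" using T by (simp add: Ab)
  have entAb: "ent Ab r q = ent T r q + s * of_bool (r = q)" if "r < n" "q < n" for r q
    using that T by (simp add: ent_def Ab)
  have spAb: "spectral n (ent Ab) (\<lambda>i. t i + s) u"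
    using spectral_affine[OF spT, of 1 s] entAb by (simp add: spectral_def)
  define \<beta> where "\<beta> = (\<Sum>i<n. t i + s) / n"
  have \<beta>: "\<beta> = max c \<tau>" using n by (simp add: \<beta>_def sum.distrib add_divide_distrib s_def \<tau>_def[symmetric])
  have Phi: "fro n (\<lambda>r q. ent Ab r q - G r q) / n \<le> \<Phi>"
  proof -
    have "fro n (\<lambda>r q. ent Ab r q - G r q) = fro n (\<lambda>r q. ?D r q + s * of_bool (r = q))"
      using entAb by (intro fro_cong) simp
    also have "\<dots> \<le> fro n ?D + fro n (\<lambda>r q. s * of_bool (r = q))" by (rule fro_triangle)
    also have "fro n (\<lambda>r q. s * of_bool (r = q)) = s * sqrt n"
    proof -
      have "(fro n (\<lambda>r q. of_bool (r = q)))\<^sup>2 = n"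
        unfolding fro_power2 using sum_diag[of "\<lambda>r q. of_bool (r = q)" n]
        by (simp only: power2_eq_square) simp
      hence "fro n (\<lambda>r q. of_bool (r = q)) = sqrt n" using fro_nonneg by (metis real_sqrt_unique)
      thus ?thesis using s by (simp add: fro_cmult)
    qed
    also have "s * sqrt n \<le> 1 * sqrt n" using s by (intro mult_right_mono) auto
    finally have "fro n (\<lambda>r q. ent Ab r q - G r q) / n \<le> (fro n ?D + sqrt n) / n"
      by (simp add: divide_right_mono)
    also have "\<dots> = fro n ?D / n + 1 / sqrt n" using n by (simp add: add_divide_distrib frac_eq_eq)
    finally show ?thesis using froD by (simp add: \<Phi>)
  qed
  have \<Phi>0: "0 \<le> \<Phi>" using \<kappa> \<alpha> by (simp add: \<Phi>)
  define lam where "lam = lambda_max Ab"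
  have lam: "lam = Max ((\<lambda>i. t i + s) ` {..<n})"
    unfolding lam_def lambda_max_def spectral_eigenvalues[OF spAb AbC] ..
  have lam_ge: "t i + s \<le> lam" if "i < n" for i unfolding lam using that by (intro Max_ge) auto
  have "lam \<in> (\<lambda>i. t i + s) ` {..<n}" unfolding lam using n by (intro Max_in) auto
  then obtain i0 where i0: "i0 < n" "lam = t i0 + s" by auto
  have lam0: "0 \<le> lam" using i0 t0 s by simp
  have lam_le: "lam / n \<le> 1 + \<delta>"
  proof -
    have "k i0 \<le> n * c" unfolding ksum[symmetric] using i0 k0 by (intro member_le_sum) auto
    also have "\<dots> \<le> n" using c by (simp add: mult_left_le)
    finally have "lam \<le> n + \<kappa> / \<alpha> + 1" using tk'[OF i0(1)] i0(2) s by simp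
    hence "lam / n \<le> (n + \<kappa> / \<alpha> + 1) / n" by (simp add: divide_right_mono)
    also have "\<dots> = 1 + (\<kappa> / (\<alpha> * n) + 1 / n)" using n by (simp add: field_simps)
    finally show ?thesis using \<delta>(1) by simp
  qed
  define C where "C = min (real n / lam) (inverse (1 + 1 / (\<alpha> * n) powr (1 / 4)))"
  have Kn: "Kn = C \<cdot>\<^sub>m Ab"
    using A(1) by (simp add: Kn_def usvt_kernel_def Let_def Ab_def[symmetric] lam_def[symmetric] C_def)
  show KnC: "Kn \<in> carrier_mat n n" using AbC by (simp add: Kn)
  have C0: "0 \<le> C" using lam0 by (simp add: C_def)
  have \<delta>0: "0 \<le> \<delta>" by (rule order.trans[OF _ \<delta>(2)]) simp
  have C1: "C \<le> 1" unfolding C_def by (intro min.coboundedI2) (simp add: inverse_le_1_iff)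
  \<comment> \<open>If lam = 0, division by zero makes C = 0 and this fails for small \<delta>; but
    then all eigenvalues of \<open>Ab\<close> vanish, and \<open>froAb\<close> and
    \<open>\<beta>C\<close> hold trivially.\<close>
  have Cd: "1 - C \<le> \<delta>" if "lam \<noteq> 0"
  proof -
    define x where "x = lam / n"
    have x: "0 < x" "x \<le> 1 + \<delta>" using that lam0 n lam_le by (auto simp: x_def)
    have inv: "1 - inverse y \<le> \<delta>" if y: "0 < y" "y \<le> 1 + \<delta>" for y :: real
    proof -
      have "1 - inverse y = (y - 1) / y" using y by (simp add: field_simps)
      show ?thesis
      proof (cases "y \<le> 1")
        case True
        thus ?thesis using y \<delta>0 one_le_inverse[of y] by simp
      next
        case False
        hence "(y - 1) / y \<le> (y - 1) / 1" by (intro divide_left_mono) auto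
        thus ?thesis using y \<open>1 - inverse y = (y - 1) / y\<close> by simp
      qed
    qed
    have "1 - real n / lam \<le> \<delta>" using inv[OF x] by (simp add: x_def)
    moreover have "1 - inverse (1 + 1 / (\<alpha> * n) powr (1 / 4)) \<le> \<delta>"
      using \<delta>(2) by (intro inv) (auto simp: add_pos_nonneg)
    ultimately show ?thesis by (simp add: C_def min_def)
  qed
  have zero: "t i + s = 0" if "lam = 0" "i < n" for i
    using lam_ge[OF that(2)] t0[of i] s that(1) by linarith
  have froAb: "(1 - C) * fro n (ent Ab) \<le> \<delta> * fro n (ent Ab)"
  proof (cases "lam = 0")
    case True
    have "ent Ab r q = 0" if "r < n" "q < n" for r q
      using spAb that zero[OF True] by (simp add: spectral_def)
    hence "fro n (ent Ab) = fro n (\<lambda>r q. 0 * 0)" by (intro fro_cong) simp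
    thus ?thesis unfolding fro_cmult by simp
  qed (use Cd fro_nonneg in \<open>auto intro!: mult_right_mono\<close>)
  have \<beta>C: "(1 - C) * \<beta> \<le> \<delta> * \<beta>"
  proof (cases "lam = 0")
    case True
    thus ?thesis using zero by (simp add: \<beta>_def)
  qed (use Cd \<beta> c in \<open>auto intro!: mult_right_mono\<close>)
  have froG: "fro n G \<le> n"
  proof -
    have "(fro n G)\<^sup>2 \<le> (\<Sum>r<n. \<Sum>q<n. 1)"
      unfolding fro_power2 using G(2) by (intro sum_mono) (auto simp: power_le_one_iff abs_square_le_1)
    also have "\<dots> = (real n)\<^sup>2" by (simp add: power2_eq_square)
    finally show ?thesis by (rule power2_le_imp_le) simp
  qed
  show "fro n (\<lambda>r q. ent Kn r q - G r q) / n \<le> \<delta> * (\<Phi> + 1) + \<Phi>"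
  proof -
    have "fro n (\<lambda>r q. ent Kn r q - G r q) = fro n (\<lambda>r q. (C - 1) * ent Ab r q + (ent Ab r q - G r q))"
      using AbC by (intro fro_cong) (simp add: Kn ent_def algebra_simps)
    also have "\<dots> \<le> (1 - C) * fro n (ent Ab) + fro n (\<lambda>r q. ent Ab r q - G r q)"
      using C1 by (intro order.trans[OF fro_triangle]) (simp add: fro_cmult)
    also have "\<dots> \<le> \<delta> * fro n (ent Ab) + fro n (\<lambda>r q. ent Ab r q - G r q)"
      using froAb by simp
    also have "fro n (ent Ab) \<le> fro n (\<lambda>r q. ent Ab r q - G r q) + fro n G"
      using fro_triangle[of n "\<lambda>r q. ent Ab r q - G r q" G] by simp
    finally have "fro n (\<lambda>r q. ent Kn r q - G r q) \<le>
      \<delta> * (fro n (\<lambda>r q. ent Ab r q - G r q) + fro n G) + fro n (\<lambda>r q. ent Ab r q - G r q)"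
      using \<delta>0 by (simp add: mult_left_mono)
    also have "\<dots> \<le> \<delta> * (n * \<Phi> + n) + n * \<Phi>"
      using Phi froG n \<delta>0 by (intro add_mono mult_left_mono) (auto simp: field_simps)
    also have "\<dots> = n * (\<delta> * (\<Phi> + 1) + \<Phi>)" by (simp add: algebra_simps)
    finally show ?thesis using n by (simp add: field_simps)
  qed
  have "mat_trace Kn = C * (n * \<beta>)"
    using spectral_trace[OF spAb] AbC n
    by (simp add: mat_trace_def Kn ent_def \<beta>_def sum_distrib_left[symmetric])
  hence trK: "mat_trace Kn / n = C * \<beta>" using n by simp
  show "\<bar>mat_trace Kn / n - c\<bar> \<le> 2 * \<kappa> / \<gamma> + 2 * \<delta>"
  proof -
    have "\<tau> \<le> 2" using \<tau>1 \<kappa>\<gamma> c by linarith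
    hence \<beta>2: "\<beta> \<le> 2" unfolding \<beta> using c by linarith
    have "0 \<le> 2 * \<kappa> / \<gamma>" using \<kappa> by simp
    hence \<beta>1: "\<beta> \<le> c + 2 * \<kappa> / \<gamma>" "c \<le> \<beta>" unfolding \<beta> using \<tau>1 by linarith+
    have "C * \<beta> \<le> 1 * \<beta>" using C1 \<beta>1 c by (intro mult_right_mono) auto
    moreover have "\<beta> - C * \<beta> \<le> \<delta> * 2"
      using \<beta>C \<delta>0 \<beta>2 mult_left_mono[of \<beta> 2 \<delta>] by (simp add: algebra_simps)
    ultimately show ?thesis unfolding trK using \<beta>1 \<delta>0 \<open>0 \<le> 2 * \<kappa> / \<gamma>\<close> by (simp only: abs_le_iff) linarith
  qed
qed

subsection \<open>Concentration of the adjacency matrix\<close>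

lemma mpow_cong:
  assumes "\<And>i j. i < n \<Longrightarrow> j < n \<Longrightarrow> V i j = W i j" "i < n"
  shows "mpow n V k i j = mpow n W k i j"
  using assms(2)
proof (induction k arbitrary: i)
  case (Suc k)
  thus ?case using assms(1) by (auto intro!: sum.cong)
qed simp

lemma trace_pow_cong:
  assumes "\<And>i j. i < n \<Longrightarrow> j < n \<Longrightarrow> V i j = W i j"
  shows "trace_pow n V k = trace_pow n W k"
  unfolding trace_pow_def by (intro sum.cong refl mpow_cong assms) auto

lemma abs_mpow_le:
  assumes "\<And>i j. i < n \<Longrightarrow> j < n \<Longrightarrow> \<bar>W i j\<bar> \<le> 1" "i < n"
  shows "\<bar>mpow n W k i j\<bar> \<le> real n ^ k"
  using assms(2)
proof (induction k arbitrary: i)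
  case (Suc k)
  have "\<bar>mpow n W (Suc k) i j\<bar> \<le> (\<Sum>l<n. \<bar>W i l * mpow n W k l j\<bar>)"
    unfolding mpow.simps by (rule sum_abs)
  also have "\<dots> \<le> (\<Sum>l<n. 1 * real n ^ k)"
    unfolding abs_mult using Suc assms(1) by (intro sum_mono mult_mono) auto
  finally show ?case by simp
qed simp

lemma abs_trace_pow_le:
  assumes "\<And>i j. i < n \<Longrightarrow> j < n \<Longrightarrow> \<bar>W i j\<bar> \<le> 1"
  shows "\<bar>trace_pow n W k\<bar> \<le> real n * real n ^ k"
proof -
  have "\<bar>trace_pow n W k\<bar> \<le> (\<Sum>i<n. \<bar>mpow n W k i i\<bar>)" unfolding trace_pow_def by (rule sum_abs)
  also have "\<dots> \<le> (\<Sum>i<n. real n ^ k)" using abs_mpow_le[OF assms] by (intro sum_mono) auto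
  finally show ?thesis by simp
qed

lemma trace_pow_measurable:
  assumes "\<And>i j. i < n \<Longrightarrow> j < n \<Longrightarrow> (\<lambda>\<omega>. W \<omega> i j) \<in> borel_measurable M"
  shows "(\<lambda>\<omega>. trace_pow n (W \<omega>) k) \<in> borel_measurable M"
proof -
  have "(\<lambda>\<omega>. mpow n (W \<omega>) k i j) \<in> borel_measurable M" if "i < n" for i j
    using that
  proof (induction k arbitrary: i)
    case (Suc k)
    thus ?case using assms by (auto intro!: borel_measurable_sum borel_measurable_times)
  qed simp
  thus ?thesis unfolding trace_pow_def by (intro borel_measurable_sum) auto
qed

context kernel_operator
begin

section \<open>Conditioning on the positions\<close>

context
  fixes M :: "'w measure" and \<alpha> :: real and n :: nat and x :: "nat \<Rightarrow> 'w \<Rightarrow> real ^ 'd" and A :: "'w \<Rightarrow> real mat"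
  assumes graph: "latent_position_graph M \<mu> K \<alpha> n x A" and \<alpha>: "0 < \<alpha>" "\<alpha> \<le> 1" and n: "n > 0"
begin

interpretation M: prob_space M
  using graph by (simp add: latent_position_graph_def)

definition noise :: "'w \<Rightarrow> nat \<Rightarrow> nat \<Rightarrow> real" where
  "noise \<omega> r s = ent (A \<omega>) r s - \<alpha> * K (x r \<omega>) (x s \<omega>)"

lemma measurable_positions: "i < n \<Longrightarrow> x i \<in> M \<rightarrow>\<^sub>M \<mu>"
  using graph by (auto simp: latent_position_graph_def M.indep_vars_def)

lemma positions_X: "i < n \<Longrightarrow> \<omega> \<in> space M \<Longrightarrow> x i \<omega> \<in> X"
  using measurable_space[OF measurable_positions] by simp

lemma adjacency:
  assumes "\<omega> \<in> space M"
  shows "A \<omega> \<in> carrier_mat n n" "\<And>i j. i < n \<Longrightarrow> j < n \<Longrightarrow> ent (A \<omega>) i j \<in> {0, 1}"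
    "\<And>i j. i < n \<Longrightarrow> j < n \<Longrightarrow> ent (A \<omega>) i j = ent (A \<omega>) j i"
  using graph assms by (auto simp: latent_position_graph_def ent_def)

lemma noise_sym: "\<omega> \<in> space M \<Longrightarrow> i < n \<Longrightarrow> j < n \<Longrightarrow> noise \<omega> i j = noise \<omega> j i"
  using adjacency(3) K_sym positions_X by (simp add: noise_def)

lemma measurable_noise_trace: "(\<lambda>\<omega>. trace_pow n (noise \<omega>) k) \<in> borel_measurable M"
proof (rule trace_pow_measurable)
  fix i j assume ij: "i < n" "j < n"
  have "(\<lambda>\<omega>. (x i \<omega>, x j \<omega>)) \<in> M \<rightarrow>\<^sub>M \<mu> \<Otimes>\<^sub>M \<mu>"
    using ij by (intro measurable_Pair measurable_positions)
  from measurable_compose[OF this measurable_K] have "(\<lambda>\<omega>. K (x i \<omega>) (x j \<omega>)) \<in> borel_measurable M" by simp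
  thus "(\<lambda>\<omega>. noise \<omega> i j) \<in> borel_measurable M"
    unfolding noise_def ent_def using graph ij
    by (intro borel_measurable_diff borel_measurable_times) (auto simp: latent_position_graph_def)
qed

text \<open>The expectation is split over all possible graphs E. For fixed E the trace depends on
  the positions only, so the indicator of E may be replaced by its conditional probability, a
  product of Bernoulli weights. The sum over E is then, at every \<omega>, an expectation
  \<open>bern\<close> with probabilities at most \<alpha>.\<close>

lemma expectation_noise_trace:
  assumes q: "q > 0" "\<alpha> * n \<le> real q"
  shows "M.expectation (\<lambda>\<omega>. trace_pow n (noise \<omega>) (2 * q)) \<le> real n * (2 * exp 281 * real q) ^ q"
proof -
  define P where "P \<omega> = (\<lambda>(i, j). \<alpha> * K (x i \<omega>) (x j \<omega>))" for \<omega>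
  define F where "F E \<omega> = trace_pow n (centered 1 (P \<omega>) E) (2 * q)" for E \<omega>
  define ev where "ev E = {\<omega> \<in> space M. \<forall>j<n. \<forall>i\<le>j. A \<omega> $$ (i, j) = of_bool ((i, j) \<in> E)}" for E
  define wt where "wt E \<omega> = (\<Prod>s\<in>pairs n. if s \<in> E then P \<omega> s else 1 - P \<omega> s)" for E \<omega>
  let ?V = "vimage_algebra (space M) (\<lambda>\<omega>. \<lambda>i\<in>{..<n}. x i \<omega>) (PiM {..<n} (\<lambda>_. \<mu>))"
  have xv: "(\<lambda>\<omega>. \<lambda>i\<in>{..<n}. x i \<omega>) \<in> M \<rightarrow>\<^sub>M PiM {..<n} (\<lambda>_. \<mu>)"
    by (intro measurable_restrict measurable_positions) auto
  have sub: "subalgebra M ?V"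
    unfolding subalgebra_def
  proof (intro conjI)
    have "(\<lambda>\<omega>. \<lambda>i\<in>{..<n}. x i \<omega>) \<in> space M \<rightarrow> space (PiM {..<n} (\<lambda>_. \<mu>))"
      using measurable_space[OF xv] by auto
    thus "sets ?V \<subseteq> sets M"
      using measurable_sets[OF xv] by (auto simp: sets_vimage_algebra2)
  qed simp
  interpret V: finite_measure_subalgebra M ?V
    using sub by unfold_locales
  have xvV: "(\<lambda>\<omega>. x i \<omega>) \<in> ?V \<rightarrow>\<^sub>M \<mu>" if i: "i < n" for i
  proof -
    have "(\<lambda>\<omega>. \<lambda>i\<in>{..<n}. x i \<omega>) \<in> ?V \<rightarrow>\<^sub>M PiM {..<n} (\<lambda>_. \<mu>)"
      using measurable_space[OF xv] by (intro measurable_vimage_algebra1) auto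
    from measurable_compose[OF this measurable_component_singleton[of i]] i show ?thesis by simp
  qed
  have KV: "(\<lambda>\<omega>. K (x i \<omega>) (x j \<omega>)) \<in> borel_measurable ?V" if "i < n" "j < n" for i j
    using measurable_compose[OF measurable_Pair[OF xvV[OF that(1)] xvV[OF that(2)]] measurable_K] by simp
  have P01: "0 \<le> P \<omega> s \<and> P \<omega> s \<le> \<alpha>" if \<omega>: "\<omega> \<in> space M" and s: "s \<in> pairs n" for \<omega> s
  proof -
    have "fst s < n" "snd s < n" using s by (auto simp: pairs_def)
    hence "K (x (fst s) \<omega>) (x (snd s) \<omega>) \<in> {0..1}" using K01 positions_X \<omega> by blast
    thus ?thesis using \<alpha> by (auto simp: P_def case_prod_beta' mult_left_le)
  qed
  have edge_pairs: "edge (i, j) \<in> pairs n" if "i < n" "j < n" for i j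
    using that by (auto simp: edge_def pairs_def)
  have FV: "F E \<in> borel_measurable ?V" for E
    unfolding F_def centered_def
  proof (intro trace_pow_measurable borel_measurable_times borel_measurable_diff borel_measurable_const)
    fix i j assume "i < n" "j < n"
    hence "fst (edge (i, j)) < n" "snd (edge (i, j)) < n" by (auto simp: edge_def)
    thus "(\<lambda>\<omega>. P \<omega> (edge (i, j))) \<in> borel_measurable ?V"
      unfolding P_def case_prod_beta' by (intro borel_measurable_times borel_measurable_const KV)
  qed
  have FM: "F E \<in> borel_measurable M" for E by (rule measurable_from_subalg[OF sub FV])
  have Fb: "\<bar>F E \<omega>\<bar> \<le> real n * real n ^ (2 * q)" if "\<omega> \<in> space M" for E \<omega>
    unfolding F_def
  proof (rule abs_trace_pow_le)
    fix i j assume "i < n" "j < n"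
    from P01[OF that edge_pairs[OF this]] \<alpha> show "\<bar>centered 1 (P \<omega>) E i j\<bar> \<le> 1"
      by (auto simp: centered_def of_bool_def)
  qed
  have evM: "ev E \<in> sets M" for E
  proof -
    have "(\<lambda>\<omega>. A \<omega> $$ (i, j)) \<in> borel_measurable M" if "j < n" "i \<le> j" for i j
      using graph that by (auto simp: latent_position_graph_def)
    hence "{\<omega> \<in> space M. A \<omega> $$ (i, j) = of_bool ((i, j) \<in> E)} \<in> sets M" if "j < n" "i \<le> j" for i j
      using that measurable_sets[of "\<lambda>\<omega>. A \<omega> $$ (i, j)" M borel "{of_bool ((i, j) \<in> E)}"]
      by (simp add: vimage_def Int_def conj_commute)
    hence "{\<omega> \<in> space M. \<forall>j\<in>{..<n}. \<forall>i\<in>{..j}. A \<omega> $$ (i, j) = of_bool ((i, j) \<in> E)} \<in> sets M"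
      by (intro sets.sets_Collect_finite_All) auto
    moreover have "ev E = {\<omega> \<in> space M. \<forall>j\<in>{..<n}. \<forall>i\<in>{..j}. A \<omega> $$ (i, j) = of_bool ((i, j) \<in> E)}"
      unfolding ev_def by (simp only: Ball_def lessThan_iff atMost_iff)
    ultimately show ?thesis by (simp only:)
  qed
  have wt_cond: "AE \<omega> in M. real_cond_exp M ?V (indicat_real (ev E)) \<omega> = wt E \<omega>" for E
  proof -
    have "AE \<omega> in M. real_cond_exp M ?V (indicat_real (ev E)) \<omega> =
      (\<Prod>(i, j)\<in>pairs n. pmf (bernoulli_pmf (\<alpha> * K (x i \<omega>) (x j \<omega>))) ((i, j) \<in> E))"
      using graph unfolding latent_position_graph_def ev_def pairs_def
      by (elim conjE allE[of _ "\<lambda>i j. (i, j) \<in> E"])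
    thus ?thesis
    proof (rule AE_mp, intro AE_I2 impI)
      fix \<omega> assume \<omega>: "\<omega> \<in> space M"
        and eq: "real_cond_exp M ?V (indicat_real (ev E)) \<omega> =
          (\<Prod>(i, j)\<in>pairs n. pmf (bernoulli_pmf (\<alpha> * K (x i \<omega>) (x j \<omega>))) ((i, j) \<in> E))"
      have "(\<Prod>(i, j)\<in>pairs n. pmf (bernoulli_pmf (\<alpha> * K (x i \<omega>) (x j \<omega>))) ((i, j) \<in> E)) = wt E \<omega>"
        unfolding wt_def
      proof (intro prod.cong refl, clarify)
        fix i j assume ij: "(i, j) \<in> pairs n"
        from P01[OF \<omega> ij] \<alpha> have "0 \<le> P \<omega> (i, j)" "P \<omega> (i, j) \<le> 1" by auto
        thus "pmf (bernoulli_pmf (\<alpha> * K (x i \<omega>) (x j \<omega>))) ((i, j) \<in> E) = (if (i, j) \<in> E then P \<omega> (i, j) else 1 - P \<omega> (i, j))"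
          by (simp add: P_def)
      qed
      with eq show "real_cond_exp M ?V (indicat_real (ev E)) \<omega> = wt E \<omega>" by simp
    qed
  qed
  have int1: "integrable M (\<lambda>\<omega>. F E \<omega> * indicat_real (ev E) \<omega>)" for E
  proof (rule M.integrable_const_bound[of _ "real n * real n ^ (2 * q)"])
    show "AE \<omega> in M. norm (F E \<omega> * indicat_real (ev E) \<omega>) \<le> real n * real n ^ (2 * q)"
      using Fb by (intro AE_I2) (auto simp: indicator_def)
  qed (use FM evM in auto)
  have intw: "integrable M (\<lambda>\<omega>. F E \<omega> * wt E \<omega>)"
    and eqw: "M.expectation (\<lambda>\<omega>. F E \<omega> * indicat_real (ev E) \<omega>) = M.expectation (\<lambda>\<omega>. F E \<omega> * wt E \<omega>)" for E
  proof -
    have wtM: "wt E \<in> borel_measurable M"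
      unfolding wt_def P_def case_prod_beta'
      using measurable_from_subalg[OF sub KV] by (auto simp: pairs_def intro!: borel_measurable_prod)
    note ce = V.real_cond_exp_intg[OF int1 FV]
    have ind: "indicat_real (ev E) \<in> borel_measurable M" using evM by simp
    have ae: "AE \<omega> in M. F E \<omega> * real_cond_exp M ?V (indicat_real (ev E)) \<omega> = F E \<omega> * wt E \<omega>"
      using wt_cond[of E] by eventually_elim simp
    have m1: "(\<lambda>\<omega>. F E \<omega> * real_cond_exp M ?V (indicat_real (ev E)) \<omega>) \<in> borel_measurable M"
      by (intro borel_measurable_times FM borel_measurable_cond_exp2)
    have m2: "(\<lambda>\<omega>. F E \<omega> * wt E \<omega>) \<in> borel_measurable M" by (intro borel_measurable_times FM wtM)
    show "integrable M (\<lambda>\<omega>. F E \<omega> * wt E \<omega>)"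
      using ce(1)[OF ind] integrable_cong_AE[OF m1 m2 ae] by simp
    show "M.expectation (\<lambda>\<omega>. F E \<omega> * indicat_real (ev E) \<omega>) = M.expectation (\<lambda>\<omega>. F E \<omega> * wt E \<omega>)"
      using ce(2)[OF ind] integral_cong_AE[OF m1 m2 ae] by simp
  qed
  \<comment> \<open>Exactly one of the events \<open>ev E\<close> with E inside
    \<open>pairs n\<close> contains \<omega>, namely that of the graph E0 read off from A.\<close>
  have split: "trace_pow n (noise \<omega>) (2 * q) = (\<Sum>E\<in>Pow (pairs n). F E \<omega> * indicat_real (ev E) \<omega>)"
    if \<omega>: "\<omega> \<in> space M" for \<omega>
  proof -
    define E0 where "E0 = {(i, j) \<in> pairs n. A \<omega> $$ (i, j) = 1}"
    have E0: "E0 \<subseteq> pairs n" by (auto simp: E0_def)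
    have ev_iff: "\<omega> \<in> ev E \<longleftrightarrow> E = E0" if "E \<subseteq> pairs n" for E
    proof
      assume "\<omega> \<in> ev E"
      hence eq: "A \<omega> $$ (i, j) = of_bool ((i, j) \<in> E)" if "(i, j) \<in> pairs n" for i j
        using that unfolding ev_def pairs_def by blast
      have "(i, j) \<in> E \<longleftrightarrow> (i, j) \<in> E0" for i j
        using eq[of i j] \<open>E \<subseteq> pairs n\<close> by (cases "(i, j) \<in> pairs n") (auto simp: E0_def)
      thus "E = E0" by auto
    next
      assume E: "E = E0"
      have "A \<omega> $$ (i, j) = of_bool ((i, j) \<in> E0)" if "j < n" "i \<le> j" for i j
        using adjacency(2)[OF \<omega>, of i j] that by (auto simp: E0_def pairs_def ent_def)
      thus "\<omega> \<in> ev E" unfolding E ev_def using \<omega> by blast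
    qed
    have "trace_pow n (noise \<omega>) (2 * q) = F E0 \<omega>"
      unfolding F_def
    proof (rule trace_pow_cong)
      fix i j assume ij: "i < n" "j < n"
      show "noise \<omega> i j = centered 1 (P \<omega>) E0 i j"
      proof (cases "i \<le> j")
        case True
        thus ?thesis using ij adjacency(2)[OF \<omega> ij]
          by (auto simp: noise_def centered_def edge_def P_def E0_def pairs_def ent_def)
      next
        case False
        thus ?thesis using ij adjacency(2)[OF \<omega> ij(2,1)] unfolding noise_sym[OF \<omega> ij]
          by (auto simp: noise_def centered_def edge_def P_def E0_def pairs_def ent_def)
      qed
    qed
    also have "\<dots> = (\<Sum>E\<in>Pow (pairs n). if E = E0 then F E \<omega> else 0)" using E0 by simp
    also have "\<dots> = (\<Sum>E\<in>Pow (pairs n). F E \<omega> * indicat_real (ev E) \<omega>)"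
      using ev_iff by (intro sum.cong) (auto simp: indicator_def)
    finally show ?thesis .
  qed
  have "M.expectation (\<lambda>\<omega>. trace_pow n (noise \<omega>) (2 * q)) =
    M.expectation (\<lambda>\<omega>. \<Sum>E\<in>Pow (pairs n). F E \<omega> * indicat_real (ev E) \<omega>)"
    by (intro Bochner_Integration.integral_cong refl split)
  also have "\<dots> = (\<Sum>E\<in>Pow (pairs n). M.expectation (\<lambda>\<omega>. F E \<omega> * indicat_real (ev E) \<omega>))"
    by (intro Bochner_Integration.integral_sum int1)
  also have "\<dots> = M.expectation (\<lambda>\<omega>. \<Sum>E\<in>Pow (pairs n). F E \<omega> * wt E \<omega>)"
    unfolding eqw by (intro Bochner_Integration.integral_sum[symmetric] intw)
  also have "\<dots> \<le> M.expectation (\<lambda>\<omega>. real n * (2 * exp 281 * real q) ^ q)"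
  proof (intro integral_mono Bochner_Integration.integrable_sum intw M.integrable_const)
    fix \<omega> assume \<omega>: "\<omega> \<in> space M"
    have "(\<Sum>E\<in>Pow (pairs n). F E \<omega> * wt E \<omega>) = bern (pairs n) (P \<omega>) (\<lambda>E. trace_pow n (centered 1 (P \<omega>) E) (2 * q))"
      by (simp add: bern_def wt_def F_def mult.commute)
    also have "\<dots> \<le> real n * (2 * exp 281 * real q) ^ q"
      using \<alpha> n q P01[OF \<omega>] by (intro bern_trace_pow_le[of \<alpha>]) auto
    finally show "(\<Sum>E\<in>Pow (pairs n). F E \<omega> * wt E \<omega>) \<le> real n * (2 * exp 281 * real q) ^ q" .
  qed
  finally show ?thesis by (simp add: M.prob_space)
qed

text \<open>Markov's inequality for the trace moment of order 2 q, where q is \<theta> \<alpha> n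
  rounded up. The summand 1 of \<theta> gives q \<ge> \<alpha> n, as the moment bound requires; the
  summand (1 + 1/p) / C0 gives q \<ge> (1 + 1/p) ln n.\<close>

lemma noise_concentration:
  fixes C0 p :: real
  assumes C0: "C0 > 0" and p: "p > 0" and n2: "n \<ge> 2" and d: "C0 * ln n \<le> \<alpha> * n"
  defines "\<kappa> \<equiv> sqrt (2 * exp 282 * (1 + (1 + 1 / p) / C0 + 1 / (C0 * ln 2)))"
  shows "\<exists>S\<in>sets M. measure M S \<le> real n powr (- 1 / p) \<and>
    (\<forall>\<omega>\<in>space M - S. \<forall>v. \<bar>quad n (noise \<omega>) v\<bar> \<le> \<kappa> * sqrt (\<alpha> * n) * (\<Sum>r<n. (v r)\<^sup>2))"
proof -
  define D where "D = \<alpha> * n"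
  define \<theta> where "\<theta> = 1 + (1 + 1 / p) / C0"
  have \<theta>: "\<theta> \<ge> 1" using C0 p by (simp add: \<theta>_def)
  have l2: "ln 2 > (0::real)" by simp
  have ln: "ln 2 \<le> ln (real n)" using n2 by simp
  have D0: "C0 * ln 2 \<le> D" using d C0 ln mult_left_mono[OF ln, of C0] unfolding D_def by linarith
  have Dpos: "D > 0" using D0 C0 l2 mult_pos_pos[OF C0 l2] by linarith
  define q where "q = nat \<lceil>\<theta> * D\<rceil>"
  have \<theta>D: "\<theta> * D > 0" using \<theta> Dpos by simp
  have q1: "\<theta> * D \<le> real q" unfolding q_def by linarith
  have q2: "real q \<le> \<theta> * D + 1" unfolding q_def using \<theta>D by linarith
  have q0: "q > 0" using q1 \<theta>D by (cases "q = 0") auto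
  have "1 * D \<le> \<theta> * D" using \<theta> Dpos by (intro mult_right_mono) auto
  hence Dq: "\<alpha> * n \<le> real q" using q1 by (simp add: D_def)
  have lnq: "(1 + 1 / p) * ln n \<le> real q"
  proof -
    have "(1 + 1 / p) * ln n = ((1 + 1 / p) / C0) * (C0 * ln n)" using C0 by simp
    also have "\<dots> \<le> ((1 + 1 / p) / C0) * D" using d C0 p by (intro mult_left_mono) (auto simp: D_def)
    also have "\<dots> \<le> \<theta> * D" using Dpos by (intro mult_right_mono) (auto simp: \<theta>_def)
    finally show ?thesis using q1 by simp
  qed
  \<comment> \<open>The exponent is one more than the 281 of the moment bound, so Markov's quotient
    is n exp (- q) \<le> n^(-1/p).\<close>
  define t where "t = sqrt (2 * exp 282 * real q)"
  have t: "t > 0" "t\<^sup>2 = 2 * exp 282 * real q" using q0 by (auto simp: t_def)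
  have tk: "t \<le> \<kappa> * sqrt (\<alpha> * n)"
  proof -
    \<comment> \<open>Rounding q up costs at most 1, which is absorbed because \<alpha> n is at
      least C0 ln 2; this is the last summand in \<kappa>.\<close>
    have "1 \<le> D / (C0 * ln 2)" using D0 C0 l2 by simp
    hence "real q \<le> \<theta> * D + D / (C0 * ln 2)" using q2 by linarith
    also have "\<dots> = (\<theta> + 1 / (C0 * ln 2)) * D" by (simp add: distrib_right)
    finally have "2 * exp 282 * real q \<le> 2 * exp 282 * ((\<theta> + 1 / (C0 * ln 2)) * D)" by (intro mult_left_mono) auto
    hence "t \<le> sqrt (2 * exp 282 * ((\<theta> + 1 / (C0 * ln 2)) * D))" unfolding t_def by simp
    also have "\<dots> = \<kappa> * sqrt (\<alpha> * n)" unfolding \<kappa>_def \<theta>_def D_def real_sqrt_mult[symmetric] by (simp add: mult.assoc)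
    finally show ?thesis .
  qed
  define Y where "Y \<omega> = trace_pow n (noise \<omega>) (2 * q)" for \<omega>
  have Y0: "0 \<le> Y \<omega>" if \<omega>: "\<omega> \<in> space M" for \<omega>
  proof -
    obtain l u where "spectral n (noise \<omega>) l u" using spectral_exists[of n "noise \<omega>"] noise_sym[OF \<omega>] by blast
    thus ?thesis by (simp add: Y_def spectral_trace_pow sum_nonneg)
  qed
  have YM: "Y \<in> borel_measurable M" unfolding Y_def by (rule measurable_noise_trace)
  have Yint: "integrable M Y"
  proof (rule M.integrable_const_bound[of _ "real n * real n ^ (2 * q)"])
    show "AE \<omega> in M. norm (Y \<omega>) \<le> real n * real n ^ (2 * q)"
    proof (intro AE_I2)
      fix \<omega> assume \<omega>: "\<omega> \<in> space M"
      have "\<bar>noise \<omega> i j\<bar> \<le> 1" if ij: "i < n" "j < n" for i j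
      proof -
        have "K (x i \<omega>) (x j \<omega>) \<in> {0..1}" using K01 positions_X[OF ij(1) \<omega>] positions_X[OF ij(2) \<omega>] by blast
        hence "0 \<le> \<alpha> * K (x i \<omega>) (x j \<omega>)" "\<alpha> * K (x i \<omega>) (x j \<omega>) \<le> 1"
          using \<alpha> by (auto intro: mult_le_one)
        thus ?thesis using adjacency(2)[OF \<omega> ij] by (auto simp: noise_def)
      qed
      thus "norm (Y \<omega>) \<le> real n * real n ^ (2 * q)" using abs_trace_pow_le by (simp add: Y_def)
    qed
  qed (rule YM)
  define S where "S = {\<omega> \<in> space M. Y \<omega> \<ge> t ^ (2 * q)}"
  have "measure M S \<le> M.expectation Y / t ^ (2 * q)"
    unfolding S_def
    using integral_Markov_inequality_measure[OF Yint sets.top, of "t ^ (2 * q)"] Y0 t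
    by (simp add: AE_I2)
  also have "\<dots> \<le> real n * (2 * exp 281 * real q) ^ q / t ^ (2 * q)"
    using expectation_noise_trace[OF q0 Dq] t by (intro divide_right_mono) (auto simp: Y_def[abs_def])
  also have "\<dots> = real n * exp (- real q)"
  proof -
    have "t ^ (2 * q) = (2 * exp 281 * real q) ^ q * exp (real q)"
      unfolding power_mult t(2) by (simp add: power_mult_distrib flip: exp_of_nat_mult exp_add)
    thus ?thesis using q0 by (simp add: exp_minus field_simps)
  qed
  also have "\<dots> \<le> real n * exp (- ((1 + 1 / p) * ln n))" using lnq by (intro mult_left_mono) auto
  also have "\<dots> = real n powr (- 1 / p)"
    using n by (simp add: powr_def exp_diff exp_minus field_simps flip: exp_add)
  finally have mS: "measure M S \<le> real n powr (- 1 / p)" .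
  have "\<bar>quad n (noise \<omega>) v\<bar> \<le> \<kappa> * sqrt (\<alpha> * n) * (\<Sum>r<n. (v r)\<^sup>2)" if \<omega>: "\<omega> \<in> space M - S" for \<omega> v
  proof -
    have "\<bar>quad n (noise \<omega>) v\<bar> \<le> t * (\<Sum>r<n. (v r)\<^sup>2)"
      using \<omega> noise_sym t q0 by (intro quad_le_trace_pow[where p = q]) (auto simp: S_def Y_def)
    also have "\<dots> \<le> \<kappa> * sqrt (\<alpha> * n) * (\<Sum>r<n. (v r)\<^sup>2)" using tk by (intro mult_right_mono sum_nonneg) auto
    finally show ?thesis .
  qed
  moreover have "S \<in> sets M" unfolding S_def using YM by measurable
  ultimately show ?thesis using mS by blast
qed

end

end

subsection \<open>Rates\<close>

text \<open>Every quantity is a power of z = d^(-1/8), and z \<le> z0 turns all powers but one into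
  constants. The choice \<rho> = 2 \<kappa> z0^2 makes the threshold at least twice the noise for
  all d \<ge> d0, as their ratio decays like d^(-1/4).\<close>

lemma usvt_rates:
  fixes d d0 \<kappa> \<rho> m :: real
  assumes d0: "0 < d0" "d0 \<le> d" "d \<le> m" and \<kappa>: "0 < \<kappa>"
  defines "z0 \<equiv> 1 / d0 powr (1 / 8)" and "z \<equiv> 1 / d powr (1 / 8)"
  defines "\<rho> \<equiv> 2 * \<kappa> * z0\<^sup>2"
  defines "D1 \<equiv> \<kappa> * z0 ^ 3 + z0 ^ 7 + z0" and "D2 \<equiv> sqrt (5 * \<rho>) + z0 ^ 3"
  shows "2 * (\<kappa> * sqrt d) \<le> \<rho> * d powr (3 / 4)"
    and "\<kappa> * sqrt d / d + 1 / m \<le> D1 * z" and "1 / d powr (1 / 4) \<le> D1 * z"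
    and "sqrt (5 * (\<rho> * d powr (3 / 4)) / d) + 1 / sqrt m \<le> D2 * z"
    and "2 * (\<kappa> * sqrt d) / (\<rho> * d powr (3 / 4)) \<le> 1 / z0 * z"
    and "1 / d = z ^ 8" and "0 < z" and "z \<le> z0"
proof -
  define w where "w = d powr (1 / 8)"
  define w0 where "w0 = d0 powr (1 / 8)"
  have d: "d > 0" using d0 by simp
  have w: "w > 0" "w0 > 0" "w0 \<le> w" using d0 d by (auto simp: w_def w0_def intro!: powr_mono2)
  have wp: "d = w ^ 8" "sqrt d = w ^ 4" "d powr (3 / 4) = w ^ 6" "d powr (1 / 4) = w ^ 2"
    using d by (simp_all add: w_def powr_power powr_half_sqrt[symmetric])
  have z: "z = 1 / w" "z0 = 1 / w0" by (simp_all add: z_def z0_def w_def w0_def)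
  have zz: "0 < z" "z \<le> z0" "0 < z0" using w by (auto simp: z frac_le)
  have zk: "z ^ Suc k \<le> z0 ^ k * z" for k
    using zz by (simp add: mult.commute mult_left_mono power_mono)
  have \<rho>: "\<rho> > 0" using \<kappa> zz by (simp add: \<rho>_def)
  have wz: "w = 1 / z" using w by (simp add: z)
  show 1: "2 * (\<kappa> * sqrt d) \<le> \<rho> * d powr (3 / 4)"
  proof -
    have "w0\<^sup>2 * w ^ 4 \<le> w\<^sup>2 * w ^ 4" using w by (intro mult_right_mono power_mono) auto
    hence "w ^ 4 \<le> z0\<^sup>2 * w ^ 6" using w by (simp add: z field_simps flip: power_add)
    thus ?thesis using \<kappa> unfolding wp(2-4) \<rho>_def by (simp add: mult.assoc)
  qed
  have D: "\<kappa> * (z0 ^ 3 * z) \<le> D1 * z" "z0 ^ 7 * z \<le> D1 * z" "z0 * z \<le> D1 * z"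
    "\<kappa> * (z0 ^ 3 * z) + z0 ^ 7 * z \<le> D1 * z"
  proof -
    have "D1 * z = \<kappa> * (z0 ^ 3 * z) + z0 ^ 7 * z + z0 * z" by (simp add: D1_def algebra_simps)
    moreover have "0 \<le> \<kappa> * (z0 ^ 3 * z)" "0 \<le> z0 ^ 7 * z" "0 \<le> z0 * z" using zz \<kappa> by simp_all
    ultimately show "\<kappa> * (z0 ^ 3 * z) \<le> D1 * z" "z0 ^ 7 * z \<le> D1 * z" "z0 * z \<le> D1 * z"
      "\<kappa> * (z0 ^ 3 * z) + z0 ^ 7 * z \<le> D1 * z" by linarith+
  qed
  have m: "1 / m \<le> z ^ 8" using d0 d w by (simp add: z power_divide wp(1)[symmetric] frac_le)
  have "\<kappa> * sqrt d / d = \<kappa> * z ^ 4" using w unfolding wp(2-4) unfolding wp(1) z by (simp add: field_simps flip: power_add)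
  moreover have "\<kappa> * z ^ 4 \<le> \<kappa> * (z0 ^ 3 * z)" using zk[of 3] \<kappa> by (intro mult_left_mono) (auto simp: numeral_eq_Suc)
  moreover have "z ^ 8 \<le> z0 ^ 7 * z" using zk[of 7] by (simp add: numeral_eq_Suc)
  ultimately show "\<kappa> * sqrt d / d + 1 / m \<le> D1 * z" using m D(4) by linarith
  have "1 / d powr (1 / 4) = z ^ 2" using w unfolding wp(2-4) unfolding wp(1) z by (simp add: power_divide)
  also have "\<dots> \<le> z0 * z" using zk[of 1] by (simp add: numeral_eq_Suc)
  finally show "1 / d powr (1 / 4) \<le> D1 * z" using D(3) by linarith
  have "5 * (\<rho> * d powr (3 / 4)) / d = 5 * \<rho> * z\<^sup>2" using w unfolding wp(2-4) unfolding wp(1) z by (simp add: field_simps flip: power_add)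
  hence "sqrt (5 * (\<rho> * d powr (3 / 4)) / d) = sqrt (5 * \<rho>) * z" using zz by (simp add: real_sqrt_mult)
  moreover have "1 / sqrt m \<le> z0 ^ 3 * z"
  proof -
    have "1 / sqrt m \<le> 1 / sqrt d" using d0 d by (intro divide_left_mono) auto
    also have "\<dots> = z ^ 4" using w unfolding wp(2-4) unfolding wp(1) z by (simp add: power_divide)
    also have "\<dots> \<le> z0 ^ 3 * z" using zk[of 3] by (simp add: numeral_eq_Suc)
    finally show ?thesis .
  qed
  ultimately show "sqrt (5 * (\<rho> * d powr (3 / 4)) / d) + 1 / sqrt m \<le> D2 * z"
    by (simp add: D2_def distrib_right)
  have "2 * (\<kappa> * sqrt d) / (\<rho> * d powr (3 / 4)) = z\<^sup>2 / z0\<^sup>2"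
    using w \<kappa> unfolding wp(2-4) unfolding wp(1) \<rho>_def z by (simp add: field_simps flip: power_add)
  also have "\<dots> \<le> z * z0 / z0\<^sup>2" using zz by (intro divide_right_mono) (auto simp: power2_eq_square)
  also have "\<dots> = 1 / z0 * z" using zz by (simp add: power2_eq_square)
  finally show "2 * (\<kappa> * sqrt d) / (\<rho> * d powr (3 / 4)) \<le> 1 / z0 * z" .
  show "1 / d = z ^ 8" "0 < z" "z \<le> z0" using zz by (simp_all add: wp(1) z power_divide)
qed

section \<open>The deviation bound for the modified kernel\<close>

theorem proposition7p1:
  fixes X :: "(real ^ 'd) set"
    and \<mu> :: "(real ^ 'd) measure"
    and K :: "real ^ 'd \<Rightarrow> real ^ 'd \<Rightarrow> real"
    and c C0 q :: real
    and \<alpha> :: "nat \<Rightarrow> real"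
    and M :: "nat \<Rightarrow> 'w measure"
    and x :: "nat \<Rightarrow> nat \<Rightarrow> 'w \<Rightarrow> real ^ 'd"
    and A :: "nat \<Rightarrow> 'w \<Rightarrow> real mat"
  assumes "compact X"
    and "prob_space \<mu>" and "sets \<mu> = sets (restrict_space borel X)"
    and "continuous_on (X \<times> X) (\<lambda>(y, z). K y z)"
    and "\<forall>y\<in>X. \<forall>z\<in>X. K y z \<in> {0..1}"
    and "\<forall>y\<in>X. \<forall>z\<in>X. K y z = K z y"
    and "\<forall>k. integral_operator_eigenvalue \<mu> K k \<longrightarrow> k \<in> {0..1}"
    and "\<forall>y\<in>X. K y y = c" and "c \<le> 1"
    and "\<forall>n\<ge>1. \<alpha> n \<le> 1"
    and "C0 > 0" and "\<forall>n\<ge>1. \<alpha> n \<ge> C0 * ln (real n) / real n"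
    and "\<forall>n\<ge>1. latent_position_graph (M n) \<mu> K (\<alpha> n) n (x n) (A n)"
    and "q > 0"
  shows "\<exists>\<rho> b B :: real. \<rho> > 0 \<and> b > 0 \<and> B > 0 \<and>
    (\<forall>\<delta> \<epsilon> :: real. 0 < \<delta> \<and> \<delta> < 1 \<and> \<epsilon> > 0 \<longrightarrow>
      (\<forall>n\<ge>1. real n \<ge> N_K q b B (\<alpha> n) \<delta> \<epsilon> \<longrightarrow>
        measure (M n)
          {\<omega> \<in> space (M n).
             (let Kn = usvt_kernel c (\<alpha> n) (\<rho> * (\<alpha> n * real n) powr (3 / 4)) (A n \<omega>);
                  KX = kernel_matrix n K (\<lambda>i. x n i \<omega>)
              in max (frobenius_norm ((1 / real n) \<cdot>\<^sub>m (Kn - KX)))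
                     \<bar>mat_trace ((1 / real n) \<cdot>\<^sub>m Kn) - mat_trace ((1 / real n) \<cdot>\<^sub>m KX)\<bar> \<ge> \<epsilon>)}
        \<le> \<delta>))"
proof -
  interpret kernel_operator X \<mu> K by (intro kernel_operator.intro assms)
  have eig: "0 \<le> k" if "integral_operator_eigenvalue \<mu> K k" for k using assms(7) that by auto
  have "\<exists>N\<in>null_sets \<mu>. \<forall>(x :: nat \<Rightarrow> real ^ 'd) n v. (\<forall>i<n. x i \<in> X - N) \<longrightarrow>
      0 \<le> (\<Sum>i<n. \<Sum>j<n. K (x i) (x j) * (v i * v j))"
    by (rule kernel_psd_ae) (rule eig)
  then obtain N where N: "N \<in> null_sets \<mu>"
    and psd: "\<forall>(x :: nat \<Rightarrow> real ^ 'd) n v. (\<forall>i<n. x i \<in> X - N) \<longrightarrow>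
      0 \<le> (\<Sum>i<n. \<Sum>j<n. K (x i) (x j) * (v i * v j))"
    by (elim bexE)
  define \<kappa> where "\<kappa> = sqrt (2 * exp 282 * (1 + (1 + 1 / q) / C0 + 1 / (C0 * ln 2)))"
  define d0 where "d0 = C0 * ln 2"
  define z0 where "z0 = 1 / d0 powr (1 / 8)"
  define \<rho> where "\<rho> = 2 * \<kappa> * z0\<^sup>2"
  define D1 where "D1 = \<kappa> * z0 ^ 3 + z0 ^ 7 + z0"
  define D2 where "D2 = sqrt (5 * \<rho>) + z0 ^ 3"
  \<comment> \<open>A common constant for both errors: the first two summands bound the Frobenius
    error in units of z, the last two the trace error.\<close>
  define D where "D = D1 * (D2 * z0 + 1) + D2 + 1 / z0 + 2 * D1"
  have d0: "d0 > 0" using \<open>C0 > 0\<close> by (simp add: d0_def)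
  have z0: "z0 > 0" using d0 by (simp add: z0_def)
  have \<kappa>: "\<kappa> > 0"
    using \<open>C0 > 0\<close> \<open>q > 0\<close> unfolding \<kappa>_def by (auto intro!: mult_pos_pos add_pos_nonneg)
  have \<rho>: "\<rho> > 0" using \<kappa> z0 by (simp add: \<rho>_def)
  have D12: "D1 > 0" "D2 > 0" using \<kappa> z0 \<rho> by (auto simp: D1_def D2_def add_pos_pos)
  have D: "D > 0" unfolding D_def using D12 z0 by (intro add_pos_pos mult_pos_pos) auto
  show ?thesis
  \<comment> \<open>The condition n \<ge> (D + 1)^8 / (\<alpha> \<epsilon>^8) says that (D + 1) z
    \<le> \<epsilon>. The extra 1 makes the error bound D z strictly smaller than \<epsilon>, as the
    event contains the case of equality.\<close>
  proof (rule exI[of _ \<rho>], rule exI[of _ "(D + 1) ^ 8"], rule exI[of _ 1], intro conjI allI impI)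
    fix \<delta> \<epsilon> :: real and n :: nat
    assume "0 < \<delta> \<and> \<delta> < 1 \<and> \<epsilon> > 0" and n1: "1 \<le> n" and large: "N_K q ((D + 1) ^ 8) 1 (\<alpha> n) \<delta> \<epsilon> \<le> real n"
    hence \<delta>: "0 < \<delta>" "\<delta> < 1" and \<epsilon>: "0 < \<epsilon>" by auto
    have large1: "1 / \<delta> powr q \<le> real n" and large2: "(D + 1) ^ 8 / (\<alpha> n * \<epsilon> ^ 8) \<le> real n"
      using large by (auto simp: N_K_def)
    \<comment> \<open>\<delta> < 1 excludes n = 1, where ln n = 0 would leave no lower bound on
      \<alpha> n; from n = 2 on, d \<ge> C0 ln 2 = d0.\<close>
    have "\<delta> powr q < 1 powr q" using \<delta> \<open>q > 0\<close> by (intro powr_less_mono2) auto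
    hence "1 < 1 / \<delta> powr q" using \<delta> by (simp add: less_divide_eq)
    hence "1 < real n" using large1 by linarith
    hence n2: "2 \<le> n" by simp
    have n0: "n > 0" using n2 by simp
    define d where "d = \<alpha> n * real n"
    have dln: "C0 * ln (real n) \<le> d"
      using assms(12) n1 n0 by (simp add: d_def divide_le_eq)
    have "ln 2 \<le> ln (real n)" using n2 by simp
    hence "d0 \<le> C0 * ln (real n)" unfolding d0_def using \<open>C0 > 0\<close> by (intro mult_left_mono) auto
    hence dd: "d0 \<le> d" using dln by linarith
    have dpos: "d > 0" using dd d0 by linarith
    have \<alpha>: "0 < \<alpha> n" "\<alpha> n \<le> 1" using dpos n0 assms(10) n1 by (auto simp: d_def zero_less_mult_iff)
    have dn: "d \<le> real n" unfolding d_def using \<alpha> by (simp add: mult_left_le_one_le)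
    define z where "z = 1 / d powr (1 / 8)"
    note rates = usvt_rates[OF d0 dd dn \<kappa>, folded z0_def z_def, folded \<rho>_def, folded D1_def D2_def]
    have graph: "latent_position_graph (M n) \<mu> K (\<alpha> n) n (x n) (A n)" using assms(13) n1 by blast
    interpret M: prob_space "M n" using graph by (simp add: latent_position_graph_def)
    let ?noise = "noise (\<alpha> n) (x n) (A n)"
    obtain S where S: "S \<in> sets (M n)" "measure (M n) S \<le> real n powr (- 1 / q)"
      "\<And>\<omega> v. \<omega> \<in> space (M n) - S \<Longrightarrow> \<bar>quad n (?noise \<omega>) v\<bar> \<le> \<kappa> * sqrt d * (\<Sum>r<n. (v r)\<^sup>2)"
      using noise_concentration[OF graph \<alpha> n0 \<open>C0 > 0\<close> \<open>q > 0\<close> n2] dln unfolding \<kappa>_def d_def by blast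
    \<comment> \<open>Some sample point falls into the exceptional set of
      \<open>kernel_psd_ae\<close>; a null event, since each point has law \<mu>.\<close>
    define R where "R = (\<Union>i<n. x n i -` N \<inter> space (M n))"
    have xm: "x n i \<in> M n \<rightarrow>\<^sub>M \<mu>" "distr (M n) \<mu> (x n i) = \<mu>" if "i < n" for i
      using measurable_positions[OF graph \<alpha> n0 that] graph that by (auto simp: latent_position_graph_def)
    have "x n i -` N \<inter> space (M n) \<in> null_sets (M n)" if "i < n" for i
    proof (rule null_setsI)
      have NS: "N \<in> sets \<mu>" using N by auto
      show "x n i -` N \<inter> space (M n) \<in> sets (M n)" by (rule measurable_sets[OF xm(1)[OF that] NS])
      show "emeasure (M n) (x n i -` N \<inter> space (M n)) = 0"
        using emeasure_distr[OF xm(1)[OF that] NS] xm(2)[OF that] N by auto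
    qed
    hence R: "R \<in> null_sets (M n)" unfolding R_def by (intro null_sets_UN') auto
    let ?Kn = "\<lambda>\<omega>. usvt_kernel c (\<alpha> n) (\<rho> * (\<alpha> n * real n) powr (3 / 4)) (A n \<omega>)"
    let ?KX = "\<lambda>\<omega>. kernel_matrix n K (\<lambda>i. x n i \<omega>)"
    let ?bad = "{\<omega> \<in> space (M n). max (frobenius_norm ((1 / real n) \<cdot>\<^sub>m (?Kn \<omega> - ?KX \<omega>)))
      \<bar>mat_trace ((1 / real n) \<cdot>\<^sub>m ?Kn \<omega>) - mat_trace ((1 / real n) \<cdot>\<^sub>m ?KX \<omega>)\<bar> \<ge> \<epsilon>}"
    have "?bad \<subseteq> S \<union> R"
    proof
      fix \<omega> assume bad: "\<omega> \<in> ?bad"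
      hence \<omega>: "\<omega> \<in> space (M n)" by simp
      show "\<omega> \<in> S \<union> R"
      proof (rule ccontr)
        assume good: "\<omega> \<notin> S \<union> R"
        have xX: "x n i \<omega> \<in> X" if "i < n" for i by (rule positions_X[OF graph \<alpha> n0 that \<omega>])
        have xN: "x n i \<omega> \<in> X - N" if "i < n" for i using good xX[OF that] that \<omega> by (auto simp: R_def)
        define G where "G i j = K (x n i \<omega>) (x n j \<omega>)" for i j
        have "K (x n 0 \<omega>) (x n 0 \<omega>) \<in> {0..1}" using assms(5) xX[OF n0] by blast
        hence c: "0 \<le> c" "c \<le> 1" using assms(8) xX[OF n0] by auto
        note adj = adjacency[OF graph \<alpha> n0 \<omega>]
        define \<gamma> where "\<gamma> = \<rho> * (\<alpha> n * real n) powr (3 / 4)"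
        have \<gamma>: "\<gamma> > 0" using \<rho> dpos by (simp add: \<gamma>_def d_def[symmetric])
        have near: "\<bar>quad n (\<lambda>r s. ent (A n \<omega>) r s - \<alpha> n * G r s) v\<bar> \<le> \<kappa> * sqrt d * (\<Sum>r<n. (v r)\<^sup>2)" for v
        proof -
          have "?noise \<omega> = (\<lambda>r s. ent (A n \<omega>) r s - \<alpha> n * G r s)"
            by (intro ext) (simp add: noise_def[OF graph \<alpha> n0] G_def)
          thus ?thesis using S(3)[of \<omega> v] good \<omega> by simp
        qed
        have G: "\<And>i j. i < n \<Longrightarrow> j < n \<Longrightarrow> G i j = G j i" "\<And>i j. i < n \<Longrightarrow> j < n \<Longrightarrow> G i j \<in> {0..1}"
          "\<And>i. i < n \<Longrightarrow> G i i = c" "\<And>v. 0 \<le> quad n G v"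
          using assms(5,6,8) xX psd[rule_format, of n "\<lambda>i. x n i \<omega>"] xN by (simp_all add: G_def quad_def)
        define \<Phi> where "\<Phi> = sqrt (5 * \<gamma> / (\<alpha> n * real n)) + 1 / sqrt (real n)"
        have "0 \<le> \<kappa> * sqrt d" using \<kappa> dpos by simp
        have r1: "2 * (\<kappa> * sqrt d) \<le> \<gamma>" using rates(1) by (simp add: \<gamma>_def d_def)
        have r2: "\<kappa> * sqrt d / (\<alpha> n * real n) + 1 / real n \<le> D1 * z" "1 / (\<alpha> n * real n) powr (1 / 4) \<le> D1 * z"
          using rates(2,3) by (simp_all add: d_def)
        have r4: "\<Phi> \<le> D2 * z" using rates(4) by (simp add: \<Phi>_def \<gamma>_def d_def)
        have r5: "2 * (\<kappa> * sqrt d) / \<gamma> \<le> 1 / z0 * z" using rates(5) by (simp add: \<gamma>_def d_def)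
        note err = usvt_kernel_error[OF n0 \<alpha>(1) c \<open>0 \<le> \<kappa> * sqrt d\<close> r1 \<gamma> adj(1) adj(3) G near r2 \<Phi>_def,
            folded \<gamma>_def[unfolded d_def[symmetric]]]
        have KnC: "?Kn \<omega> \<in> carrier_mat n n" using err(1) by (simp add: \<gamma>_def)
        have z: "z > 0" "z \<le> z0" by (rule rates(7), rule rates(8))
        have "D1 * z * (\<Phi> + 1) + \<Phi> \<le> D1 * z * (D2 * z0 + 1) + D2 * z"
        proof (intro add_mono mult_left_mono)
          have "D2 * z \<le> D2 * z0" using z D12 by simp
          thus "\<Phi> \<le> D2 * z0" using r4 by linarith
        qed (use z D12 r4 in auto)
        also have "\<dots> = (D1 * (D2 * z0 + 1) + D2) * z" by (simp add: algebra_simps)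
        also have "\<dots> \<le> D * z" unfolding D_def using z z0 D12 by (intro mult_right_mono) auto
        finally have f1: "frobenius_norm ((1 / real n) \<cdot>\<^sub>m (?Kn \<omega> - ?KX \<omega>)) \<le> D * z"
        proof -
          assume le: "D1 * z * (\<Phi> + 1) + \<Phi> \<le> D * z"
          have "frobenius_norm ((1 / real n) \<cdot>\<^sub>m (?Kn \<omega> - ?KX \<omega>)) = fro n (ent ((1 / real n) \<cdot>\<^sub>m (?Kn \<omega> - ?KX \<omega>)))"
            by (intro frobenius_norm_eq_fro) (auto simp: kernel_matrix_def)
          also have "\<dots> = fro n (\<lambda>r s. (1 / real n) * (ent (?Kn \<omega>) r s - G r s))"
            using KnC by (intro fro_cong) (simp add: ent_def kernel_matrix_def G_def)
          also have "\<dots> = fro n (\<lambda>r s. ent (?Kn \<omega>) r s - G r s) / real n"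
            unfolding fro_cmult by simp
          finally show ?thesis using err(2) le by (simp add: \<gamma>_def)
        qed
        have "2 * (\<kappa> * sqrt d) / \<gamma> + 2 * (D1 * z) \<le> (1 / z0 + 2 * D1) * z" using r5 by (simp add: algebra_simps)
        also have "\<dots> \<le> D * z" unfolding D_def using z z0 D12 by (intro mult_right_mono) (auto intro!: add_nonneg_nonneg)
        finally have f2: "\<bar>mat_trace ((1 / real n) \<cdot>\<^sub>m ?Kn \<omega>) - mat_trace ((1 / real n) \<cdot>\<^sub>m ?KX \<omega>)\<bar> \<le> D * z"
        proof -
          assume le: "2 * (\<kappa> * sqrt d) / \<gamma> + 2 * (D1 * z) \<le> D * z"
          have tr: "mat_trace ((1 / real n) \<cdot>\<^sub>m B) = mat_trace B / real n" if "B \<in> carrier_mat n n" for B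
            using that by (simp add: mat_trace_def sum_divide_distrib)
          have "mat_trace (?KX \<omega>) = real n * c"
            using G(3) by (simp add: mat_trace_def kernel_matrix_def G_def)
          moreover have "?KX \<omega> \<in> carrier_mat n n" by (simp add: kernel_matrix_def)
          ultimately have "mat_trace ((1 / real n) \<cdot>\<^sub>m ?KX \<omega>) = c" using n0 by (simp add: tr)
          thus ?thesis using err(3) le tr[OF KnC] by (simp add: \<gamma>_def)
        qed
        have "((D + 1) * z) ^ 8 \<le> \<epsilon> ^ 8"
        proof -
          have "(D + 1) ^ 8 \<le> real n * (\<alpha> n * \<epsilon> ^ 8)" using large2 \<alpha> \<epsilon> by (simp add: divide_le_eq)
          hence "(D + 1) ^ 8 \<le> d * \<epsilon> ^ 8" by (simp add: d_def mult_ac)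
          hence "(D + 1) ^ 8 * (1 / d) \<le> \<epsilon> ^ 8" using dpos by (simp add: divide_le_eq mult.commute)
          thus ?thesis unfolding rates(6) power_mult_distrib .
        qed
        hence "(D + 1) * z \<le> \<epsilon>" using \<epsilon> by (simp add: power_mono_iff z D less_imp_le)
        hence "D * z < \<epsilon>" using z by (simp add: algebra_simps)
        with f1 f2 bad show False by auto
      qed
    qed
    show "measure (M n) {\<omega> \<in> space (M n). (let Kn = ?Kn \<omega>; KX = ?KX \<omega> in
      max (frobenius_norm ((1 / real n) \<cdot>\<^sub>m (Kn - KX)))
        \<bar>mat_trace ((1 / real n) \<cdot>\<^sub>m Kn) - mat_trace ((1 / real n) \<cdot>\<^sub>m KX)\<bar> \<ge> \<epsilon>)} \<le> \<delta>"
    proof -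
      have "measure (M n) ?bad \<le> \<delta>"
      \<comment> \<open>The kernel is built with a choice operator, and measurability of the event
        is not part of the argument. Outside the sigma-algebra \<open>measure\<close> takes its
        default value 0.\<close>
      proof (cases "?bad \<in> sets (M n)")
        case True
        have "measure (M n) ?bad \<le> measure (M n) (S \<union> R)"
          using S(1) R \<open>?bad \<subseteq> S \<union> R\<close> by (intro M.finite_measure_mono) auto
        also have "\<dots> = measure (M n) S" using S(1) R by (intro measure_Un_null_set) auto
        also have "\<dots> \<le> real n powr (- 1 / q)" by (rule S(2))
        also have "\<dots> = (1 / real n) powr (1 / q)"
          using n0 by (simp add: powr_minus_divide powr_divide)
        also have "\<dots> \<le> (\<delta> powr q) powr (1 / q)"
        proof (intro powr_mono2)
          show "1 / real n \<le> \<delta> powr q" using large1 \<delta> n0 by (simp add: divide_le_eq mult.commute)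
        qed (use \<open>q > 0\<close> in auto)
        also have "\<dots> = \<delta>" using \<delta> \<open>q > 0\<close> by (simp add: powr_powr)
        finally show ?thesis .
      qed (use \<delta> in \<open>simp add: measure_notin_sets\<close>)
      thus ?thesis by (simp only: Let_def)
    qed
  qed (use \<rho> D in auto)
qed

end
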